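(* Let $H$ be an $n\times n$ GUE matrix and let $M$ be an $n\times n$ Hermitian random matrix, independent of $H$, whose eigenvalues follow the polynomial ensemble on $\mathbb R$ with density $\frac{1}{Z_n}\Delta_n(x)\det[f_{k-1}(x_j)]_{j,k=1}^n$. Let $p_0,\ldots,p_{n-1}$, $q_0,\ldots,q_{n-1}$ be a biorthogonal system, $k_n(x,y)=\sum_{j=0}^{n-1}p_j(x)q_j(y)$ the correlation kernel, and $p_n$ the average characteristic polynomial of this ensemble. Let $F_k(y)=\int_{-\infty}^\infty f_k(t)e^{-\frac12(y-t)^2}dt$ for $k=0,\ldots,n-1$. Then: (a) a biorthogonal system for the polynomial ensemble $\frac1{Z_n'}\Delta_n(y)\det[F_{k-1}(y_j)]_{j,k=1}^n$ of the eigenvalues of $H+M$ is given, for $k=0,\ldots,n-1$, by $$P_k(x)=\frac{1}{\sqrt{2\pi}\,i}\int_{-i\infty}^{+i\infty}p_k(s)\,e^{\frac12(x-s)^2}\,ds,\qquad Q_k(y)=\frac1{\sqrt{2\pi}}\int_{-\infty}^{\infty}q_k(t)\,e^{-\frac12(y-t)^2}\,dt;$$ (b) the correlation kernel for the eigenvalues of $H+M$ is given by $$K_n(x,y)=\frac1{2\pi i}\int_{-i\infty}^{+i\infty}ds\int_{-\infty}^{\infty}dt\;k_n(s,t)\,e^{\frac12\left((x-s)^2-(y-t)^2\right)};$$ (c) the average characteristic polynomial $P_n$ of $H+M$ is $$P_n(x)=\frac{1}{\sqrt{2\pi}\,i}\int_{-i\infty}^{+i\infty}p_n(s)\,e^{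\frac12(x-s)^2}\,ds.$$
   Context: $\Delta_n(x)=\prod_{1\le j<k\le n}(x_k-x_j)$. A polynomial ensemble is a probability density for $n$ particles on $\mathbb R$ of the form $\frac1{Z_n}\Delta_n(x)\det[f_{k-1}(x_j)]_{j,k=1}^n$. A biorthogonal system for it consists of polynomials $p_j$ of degree $j$ and functions $q_j$ (dual functions) in the linear span of $f_0,\ldots,f_{n-1}$, $j=0,\ldots,n-1$, with $\int_{-\infty}^\infty p_j(x)q_k(x)\,dx=\delta_{j,k}$ for $j,k=0,\ldots,n-1$ (such systems are not unique). The ensemble is a determinantal point process with correlation kernel $k_n(x,y)=\sum_{j=0}^{n-1}p_j(x)q_j(y)$, which does not depend on the choice of biorthogonal system. For each $t$, $k_n(s,t)$ is a polynomial in $s$ and is thereby extended to complex $s$. The average characteristic polynomial of the ensemble is $p_n(x)=\mathbb E\left[\prod_{j=1}^n(x-x_j)\right]$, the unique monic polynomial of degree $n$ with $\int_{-\infty}^{\infty} p_n f_k\,dx=0$ for $k=0,\ldots,n-1$; the average characteristic polynomial of $H+M$ is $\mathbb E\prod_{j=1}^n(x-y_j)$ with $y_j$ its eigenvalues. A GUE matrix is a Hermitian random matrix with standard real normal diagonal entries, standard complex normal strictly upper-triangular entries ($\mathbb E|H_{jk}|^2=1$), all independent. The eigenvalues of $H+M$ follow the polynomial ensemble $\frac1{Z_n'}\Delta_n(y)\det[F_{k-1}(y_j)]$ for some constant $Z_n'$. *)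

theory Defs
  imports "HOL-Probability.Probability" "Jordan_Normal_Form.Schur_Decomposition"
begin

text \<open>Particles and matrix rows/columns are indexed by \<open>{..<n}\<close>, so \<open>x\<^sub>j\<close> of the mathematical
  text is \<open>x (j - 1)\<close>. A point of \<open>n\<close>-dimensional space is an element of the product space below.\<close>

abbreviation lborel_pow :: "nat \<Rightarrow> (nat \<Rightarrow> real) measure" where
  "lborel_pow n \<equiv> Pi\<^sub>M {..<n} (\<lambda>_. lborel)"

definition vandermonde :: "nat \<Rightarrow> (nat \<Rightarrow> real) \<Rightarrow> real" where
  "vandermonde n x = (\<Prod>k<n. \<Prod>j<k. x k - x j)"

definition ensemble_density ::
  "nat \<Rightarrow> (nat \<Rightarrow> real \<Rightarrow> real) \<Rightarrow> real \<Rightarrow> (nat \<Rightarrow> real) \<Rightarrow> real" where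
  "ensemble_density n f Z x =
     1 / Z * vandermonde n x * Determinant.det (Matrix.mat n n (\<lambda>(j, k). f k (x j)))"

definition polynomial_ensemble :: "nat \<Rightarrow> (nat \<Rightarrow> real \<Rightarrow> real) \<Rightarrow> real \<Rightarrow> bool" where
  "polynomial_ensemble n f Z \<longleftrightarrow>
     (AE x in lborel_pow n. 0 \<le> ensemble_density n f Z x) \<and>
     integrable (lborel_pow n) (ensemble_density n f Z) \<and>
     integral\<^sup>L (lborel_pow n) (ensemble_density n f Z) = 1"

definition biorthogonal_system ::
  "nat \<Rightarrow> (nat \<Rightarrow> real \<Rightarrow> real) \<Rightarrow> (nat \<Rightarrow> real poly) \<Rightarrow> (nat \<Rightarrow> real \<Rightarrow> real) \<Rightarrow> bool" where
  "biorthogonal_system n f p q \<longleftrightarrow>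
     (\<forall>j<n. degree (p j) = j) \<and>
     (\<forall>j<n. \<exists>c. \<forall>x. q j x = (\<Sum>k<n. c k * f k x)) \<and>
     (\<forall>j<n. \<forall>k<n. integrable lborel (\<lambda>x. poly (p j) x * q k x) \<and>
        (LINT x|lborel. poly (p j) x * q k x) = (if j = k then 1 else 0))"

definition cpoly :: "real poly \<Rightarrow> complex \<Rightarrow> complex" where
  "cpoly p s = poly (map_poly complex_of_real p) s"

text \<open>The kernel \<open>k\<^sub>n(s, t)\<close>, extended to complex values of the first variable.\<close>

definition ensemble_kernel ::
  "nat \<Rightarrow> (nat \<Rightarrow> real poly) \<Rightarrow> (nat \<Rightarrow> real \<Rightarrow> real) \<Rightarrow> complex \<Rightarrow> real \<Rightarrow> complex" where
  "ensemble_kernel n p q s t = (\<Sum>j<n. cpoly (p j) s * complex_of_real (q j t))"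

text \<open>\<open>\<integral> g(s) ds\<close> along the imaginary axis, upwards, with the parametrization \<open>s = \<i> u\<close>.\<close>

definition imag_axis_integral :: "(complex \<Rightarrow> complex) \<Rightarrow> complex" where
  "imag_axis_integral g = (LINT u|lborel. g (\<i> * complex_of_real u) * \<i>)"

definition matrix_entries :: "nat \<Rightarrow> complex mat \<Rightarrow> nat \<times> nat \<Rightarrow> complex" where
  "matrix_entries n A = (\<lambda>(j, k)\<in>{..<n} \<times> {..<n}. A $$ (j, k))"

definition random_hermitian :: "'w measure \<Rightarrow> nat \<Rightarrow> ('w \<Rightarrow> complex mat) \<Rightarrow> bool" where
  "random_hermitian N n X \<longleftrightarrow>
     (\<forall>\<omega>\<in>space N. X \<omega> \<in> carrier_mat n n \<and> mat_adjoint (X \<omega>) = X \<omega>) \<and>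
     (\<lambda>\<omega>. matrix_entries n (X \<omega>)) \<in> N \<rightarrow>\<^sub>M Pi\<^sub>M ({..<n} \<times> {..<n}) (\<lambda>_. borel)"

definition independent_matrices ::
  "'w measure \<Rightarrow> nat \<Rightarrow> ('w \<Rightarrow> complex mat) \<Rightarrow> ('w \<Rightarrow> complex mat) \<Rightarrow> bool" where
  "independent_matrices N n X Y \<longleftrightarrow>
     prob_space.indep_var N
       (Pi\<^sub>M ({..<n} \<times> {..<n}) (\<lambda>_. borel)) (\<lambda>\<omega>. matrix_entries n (X \<omega>))
       (Pi\<^sub>M ({..<n} \<times> {..<n}) (\<lambda>_. borel)) (\<lambda>\<omega>. matrix_entries n (Y \<omega>))"

text \<open>A standard complex normal variable \<open>h\<close> has independent real and imaginary parts of variance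
  \<open>1/2\<close>, so that \<open>\<bar>h\<bar>\<^sup>2\<close> has expectation \<open>1\<close>.\<close>

definition gue :: "'w measure \<Rightarrow> nat \<Rightarrow> ('w \<Rightarrow> complex mat) \<Rightarrow> bool" where
  "gue N n H \<longleftrightarrow>
     random_hermitian N n H \<and>
     prob_space.indep_vars N (\<lambda>_. borel) (\<lambda>(j, k) \<omega>. H \<omega> $$ (j, k)) {(j, k). j \<le> k \<and> k < n} \<and>
     (\<forall>j<n. distributed N lborel (\<lambda>\<omega>. Re (H \<omega> $$ (j, j))) (normal_density 0 1)) \<and>
     (\<forall>k<n. \<forall>j<k.
        prob_space.indep_var N borel (\<lambda>\<omega>. Re (H \<omega> $$ (j, k))) borel (\<lambda>\<omega>. Im (H \<omega> $$ (j, k))) \<and>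
        distributed N lborel (\<lambda>\<omega>. Re (H \<omega> $$ (j, k))) (normal_density 0 (1 / sqrt 2)) \<and>
        distributed N lborel (\<lambda>\<omega>. Im (H \<omega> $$ (j, k))) (normal_density 0 (1 / sqrt 2)))"

text \<open>The eigenvalues with algebraic multiplicity in increasing order; meaningful for Hermitian
  matrices, whose eigenvalues are real.\<close>

definition eigs :: "nat \<Rightarrow> complex mat \<Rightarrow> nat \<Rightarrow> real" where
  "eigs n A = (\<lambda>j\<in>{..<n}. sorted_list_of_multiset (image_mset Re (proots (char_poly A))) ! j)"

text \<open>The \<open>n\<close> eigenvalues, as unlabelled particles, have the density \<open>\<rho>\<close> (with respect to all of
  \<open>n\<close>-dimensional space, not only ordered tuples): the law is tested on the Borel sets that are
  invariant under permutations of the coordinates.\<close>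

definition eigenvalues_have_density ::
  "'w measure \<Rightarrow> nat \<Rightarrow> ('w \<Rightarrow> complex mat) \<Rightarrow> ((nat \<Rightarrow> real) \<Rightarrow> real) \<Rightarrow> bool" where
  "eigenvalues_have_density N n X \<rho> \<longleftrightarrow>
     (\<forall>B\<in>sets (lborel_pow n). (\<forall>x\<in>B. \<forall>\<sigma>. \<sigma> permutes {..<n} \<longrightarrow> x \<circ> \<sigma> \<in> B) \<longrightarrow>
        measure N {\<omega> \<in> space N. eigs n (X \<omega>) \<in> B} = (LINT x:B|lborel_pow n. \<rho> x))"

definition eigenvalues_follow ::
  "'w measure \<Rightarrow> nat \<Rightarrow> ('w \<Rightarrow> complex mat) \<Rightarrow> (nat \<Rightarrow> real \<Rightarrow> real) \<Rightarrow> real \<Rightarrow> bool" where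
  "eigenvalues_follow N n X f Z \<longleftrightarrow>
     polynomial_ensemble n f Z \<and> eigenvalues_have_density N n X (ensemble_density n f Z)"

text \<open>The eigenvalue point process is determinantal with correlation kernel \<open>K\<close>: for every \<open>m\<close> the
  \<open>m\<close>-point correlation function is the determinant of the matrix of the \<open>K(y\<^sub>i, y\<^sub>j)\<close>. The cardinality
  counts the \<open>m\<close>-tuples of distinct particles that lie in \<open>B\<close>.\<close>

definition eigenvalues_determinantal ::
  "'w measure \<Rightarrow> nat \<Rightarrow> ('w \<Rightarrow> complex mat) \<Rightarrow> (real \<Rightarrow> real \<Rightarrow> complex) \<Rightarrow> bool" where
  "eigenvalues_determinantal N n X K \<longleftrightarrow>
     (\<forall>m. \<forall>B\<in>sets (lborel_pow m).
        set_integrable (lborel_pow m) B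
          (\<lambda>y. Determinant.det (Matrix.mat m m (\<lambda>(i, j). K (y i) (y j)))) \<and>
        complex_of_real (LINT \<omega>|N. real (card {\<iota> \<in> {..<m} \<rightarrow>\<^sub>E {..<n}.
          inj_on \<iota> {..<m} \<and> (\<lambda>l\<in>{..<m}. eigs n (X \<omega>) (\<iota> l)) \<in> B})) =
        (LINT y:B|lborel_pow m. Determinant.det (Matrix.mat m m (\<lambda>(i, j). K (y i) (y j)))))"

text \<open>\<open>P\<close> is the average characteristic polynomial, as a function on the real line; that the
  expectation exists is part of the notion.\<close>

definition average_char_poly ::
  "'w measure \<Rightarrow> nat \<Rightarrow> ('w \<Rightarrow> complex mat) \<Rightarrow> (real \<Rightarrow> real) \<Rightarrow> bool" where
  "average_char_poly N n X P \<longleftrightarrow>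
     (\<forall>x. integrable N (\<lambda>\<omega>. (\<Prod>j<n. x - eigs n (X \<omega>) j)) \<and>
          P x = (LINT \<omega>|N. (\<Prod>j<n. x - eigs n (X \<omega>) j)))"

end

theory Submission
  imports Defs
begin

text \<open>The map \<open>p \<mapsto> P\<close> of the theorem sends \<open>x\<^sup>k\<close> to the Hermite polynomial
  \<open>He\<^sub>k\<close>; it is the backward heat flow, so convolution with the Gaussian density undoes it. Fubini then
  moves the convolution from \<open>q\<^sub>k\<close> onto \<open>P\<^sub>j\<close>, which turns biorthogonality of \<open>(P, Q)\<close> into
  biorthogonality of \<open>(p, q)\<close>. The kernel of an ensemble does not depend on the biorthogonal system, its
  \<open>n\<times>n\<close> determinant is proportional to the ensemble density, and integrating out one variable at a time
  (Dyson) gives all correlation functions.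

  For the average characteristic polynomial, Wick's rule is applied to each term of the Leibniz expansion of
  \<open>det (x - M - H)\<close>: only the 2-cycles of the permutation are corrected by the randomness of \<open>H\<close>. The
  resulting sum and the value at \<open>x\<close> of the Hermite transform of \<open>det (z - M)\<close> satisfy the same recursion
  when the Gaussian entries are switched on one row and column at a time.\<close>

text \<open>Integrability is the obstacle. What \<open>average_char_poly\<close> says about M is
  that det(x - M) is integrable for every real x, nothing about moments of its entries or of single
  eigenvalues; so the Leibniz terms of det(x - M - H) cannot be averaged over M one by one. The way
  out is a bound |det(x - M - H)| <= C(H) |det(x + i - M)|, where C(H) is polynomial in the moduli
  of the Gaussian entries and the last factor is a characteristic polynomial at a nonreal point,
  integrable by interpolation from real points. Independence makes the product integrable; then H is
  averaged with M frozen, and only a linear functional of the whole characteristic polynomial of M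
  remains to be averaged. In (a), the dual functions have guaranteed moments only below order n, so
  Fubini needs a bound of the exact degree of p_j.\<close>

hide_const (open) Module.smult

section \<open>Hermite polynomials and the heat flow\<close>

fun hermite :: "nat \<Rightarrow> 'a::comm_ring_1 poly" where
  "hermite 0 = 1"
| "hermite (Suc 0) = [:0, 1:]"
| "hermite (Suc (Suc n)) = pCons 0 (hermite (Suc n)) - smult (of_nat (Suc n)) (hermite n)"

text \<open>One recursion for all n: at n = 0 the truncated \<open>n - 1\<close> is harmless because
  its coefficient is 0.\<close>

lemma hermite_Suc: "hermite (Suc n) = pCons 0 (hermite n) - smult (of_nat n) (hermite (n - 1))"
  by (cases n) (auto simp: one_pCons)

lemma pderiv_hermite: "pderiv (hermite n) = smult (of_nat n) (hermite (n - 1) :: 'a::idom poly)"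
proof (induction n rule: hermite.induct)
  case (3 n)
  have "pderiv (hermite (Suc (Suc n))) = hermite (Suc n) +
      (pCons 0 (pderiv (hermite (Suc n))) - smult (of_nat (Suc n)) (pderiv (hermite n :: 'a poly)))"
    by (simp only: hermite.simps(3) pderiv_diff pderiv_smult pderiv_pCons add_diff_eq)
  also have "pCons 0 (pderiv (hermite (Suc n))) - smult (of_nat (Suc n)) (pderiv (hermite n)) =
      smult (of_nat (Suc n)) (hermite (Suc n) :: 'a poly)"
    using 3 by (simp only: hermite_Suc[of n] smult_diff_right smult_pCons) simp
  also have "hermite (Suc n) + \<dots> = smult (of_nat (Suc (Suc n))) (hermite (Suc (Suc n) - 1))"
    by (simp only: diff_Suc_1 of_nat_Suc[of "Suc n"] smult_add_left smult_1_left)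
  finally show ?case .
qed (auto simp: pderiv_pCons one_pCons)

lemma degree_hermite_le: "degree (hermite n :: 'a::idom poly) \<le> n"
  by (induction n rule: hermite.induct)
     (auto intro!: degree_diff_le order.trans[OF degree_smult_le] simp: degree_pCons_eq_if)

lemma coeff_hermite_self: "coeff (hermite n :: 'a::idom poly) n = 1"
  by (induction n rule: hermite.induct)
     (auto intro!: coeff_eq_0 order.strict_trans1[OF degree_hermite_le])

text \<open>This is exp(-D^2/2), with D the derivative. The ring is left open because the transform
  acts on the real p_k and on characteristic polynomials of complex matrices.\<close>

definition hermite_transform :: "'a::comm_ring_1 poly \<Rightarrow> 'a poly" where
  "hermite_transform p = (\<Sum>k\<le>degree p. smult (coeff p k) (hermite k))"

lemma hermite_transform_bound:
  "degree p \<le> N \<Longrightarrow> hermite_transform p = (\<Sum>k\<le>N. smult (coeff p k) (hermite k))"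
  unfolding hermite_transform_def
  by (rule sum.mono_neutral_left) (auto simp: coeff_eq_0)

lemma hermite_transform_add:
  "hermite_transform (p + q) = hermite_transform p + hermite_transform q"
proof -
  let ?N = "max (degree p) (degree q)"
  have "degree (p + q) \<le> ?N"
    by (rule degree_add_le) auto
  then show ?thesis
    by (simp add: hermite_transform_bound[of _ ?N] smult_add_left sum.distrib)
qed

lemma hermite_transform_smult: "hermite_transform (smult c p) = smult c (hermite_transform p)"
  using degree_smult_le[of c p]
  by (simp add: hermite_transform_bound[of _ "degree p"] smult_sum2)

lemma hermite_transform_0 [simp]: "hermite_transform 0 = 0"
  by (simp add: hermite_transform_def)

lemma hermite_transform_sum: "hermite_transform (sum f A) = (\<Sum>x\<in>A. hermite_transform (f x))"
  by (induction A rule: infinite_finite_induct) (auto simp: hermite_transform_add)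

lemma hermite_transform_monom: "hermite_transform (monom c k) = smult c (hermite k)"
proof -
  have "hermite_transform (monom c k) = (\<Sum>j\<le>k. if j = k then smult c (hermite k) else 0)"
    unfolding hermite_transform_bound[OF degree_monom_le] by (intro sum.cong) auto
  then show ?thesis by simp
qed

text \<open>Conjugating multiplication by X with exp(-D^2/2) gives X - D. On monomials this is the
  three-term recursion \<open>hermite_Suc\<close>; linearity does the rest. It is the only property
  of the transform behind the recursion for expected determinants.\<close>

lemma hermite_transform_pCons_0:
  "hermite_transform (pCons 0 p) = pCons 0 (hermite_transform p) - hermite_transform (pderiv p)"
proof -
  have m: "hermite_transform (pCons 0 (monom c k)) =
      pCons 0 (hermite_transform (monom c k)) - hermite_transform (pderiv (monom c k))" for c :: 'a and k
    by (simp only: monom_Suc[symmetric] hermite_transform_monom pderiv_monom hermite_Suc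
        smult_diff_right smult_smult smult_pCons) (simp add: mult.commute)
  have A: "hermite_transform (pCons 0 (\<Sum>k\<in>I. monom (coeff p k) k)) =
      pCons 0 (hermite_transform (\<Sum>k\<in>I. monom (coeff p k) k))
        - hermite_transform (pderiv (\<Sum>k\<in>I. monom (coeff p k) k))" if "finite I" for I
    using that
  proof induction
    case (insert k I)
    have "pCons 0 (a + b) = pCons 0 a + pCons 0 b" for a b :: "'a poly" by simp
    then show ?case using insert m[of "coeff p k" k]
      by (simp add: hermite_transform_add pderiv_add del: add_pCons)
  qed (auto simp: hermite_transform_add)
  show ?thesis
    using A[of "{..degree p}"] by (simp add: poly_as_sum_of_monoms)
qed

lemma degree_hermite_transform:
  "degree (hermite_transform p :: 'a::idom poly) = degree p"
proof -
  have le: "degree (hermite_transform p) \<le> degree p"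
    unfolding hermite_transform_def
    by (intro degree_sum_le) (auto intro!: order.trans[OF degree_smult_le] order.trans[OF degree_hermite_le])
  have *: "coeff (hermite k :: 'a poly) (degree p) = 0" if "k < degree p" for k
    using that by (intro coeff_eq_0) (auto intro: order.strict_trans1[OF degree_hermite_le])
  have c: "coeff (hermite_transform p) (degree p) = coeff p (degree p)"
    unfolding hermite_transform_def
    by (simp add: coeff_sum * coeff_hermite_self lessThan_Suc_atMost[symmetric])
  show "degree (hermite_transform p) = degree p"
    using le c by (metis degree_0 eq_iff hermite_transform_0 le_degree leading_coeff_0_iff)
qed

lemma map_poly_of_real_hermite:
  "map_poly complex_of_real (hermite n) = hermite n"
proof -
  interpret h: map_poly_comm_ring_hom complex_of_real
    by standard auto
  show ?thesis
    by (induction n rule: hermite.induct)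
     (auto simp: h.hom_minus of_real_hom.map_poly_pCons_hom map_poly_smult simp del: of_nat_Suc)
qed

lemma map_poly_of_real_hermite_transform:
  "map_poly complex_of_real (hermite_transform p) = hermite_transform (map_poly complex_of_real p)"
proof -
  interpret h: map_poly_comm_ring_hom complex_of_real
    by standard auto
  have "degree (map_poly complex_of_real p) = degree p" by simp
  then show ?thesis
    by (simp add: hermite_transform_def h.hom_sum map_poly_smult map_poly_of_real_hermite coeff_map_poly)
qed

lemma cpoly_of_real: "cpoly p (complex_of_real x) = complex_of_real (poly p x)"
  by (simp add: cpoly_def)

text \<open>The common form of all integrations by parts below; values in a Euclidean space let it
  serve the real Gaussian integrals and the complex ones along the imaginary axis.\<close>

lemma integral_derivative_eq_0:
  fixes F f :: "real \<Rightarrow> 'a::euclidean_space"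
  assumes "\<And>x. (F has_vector_derivative f x) (at x)" "\<And>x. isCont f x" "integrable lborel f"
    and "(F \<longlongrightarrow> 0) at_top" "(F \<longlongrightarrow> 0) at_bot"
  shows "integral\<^sup>L lborel f = 0"
proof -
  have [simp]: "einterval (-\<infinity>) \<infinity> = UNIV" by (auto simp: einterval_def)
  have "(LBINT x=-\<infinity>..\<infinity>. f x) = 0 - 0"
    using assms
    by (intro interval_integral_FTC_integrable[where F = F])
       (auto simp: ereal_tendsto_simps set_integrable_def)
  then show ?thesis
    by (simp add: interval_lebesgue_integral_def set_lebesgue_integral_def)
qed

section \<open>Polynomials against a shifted Gaussian\<close>

lemma tendsto_power_mult_gaussian:
  "((\<lambda>u::real. \<bar>u\<bar> ^ k * exp (- (u\<^sup>2 / 2))) \<longlongrightarrow> 0) at_top" (is ?top)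
  "((\<lambda>u::real. \<bar>u\<bar> ^ k * exp (- (u\<^sup>2 / 2))) \<longlongrightarrow> 0) at_bot"
proof -
  have lim: "((\<lambda>u::real. exp (1/2) * (u ^ k / exp u)) \<longlongrightarrow> 0) at_top"
    by (intro tendsto_mult_right_zero tendsto_power_div_exp_0)
  have "\<bar>u\<bar> ^ k * exp (- (u\<^sup>2 / 2)) \<le> exp (1/2) * (u ^ k / exp u)" if "u \<ge> 0" for u :: real
  proof -
    \<comment> \<open>This is u^2/2 >= u - 1/2, which trades the Gaussian for an exponential and
      produces the factor \<open>exp (1/2)\<close>.\<close>
    have "0 \<le> (u - 1)\<^sup>2" by simp
    then have "exp (- (u\<^sup>2 / 2)) \<le> exp (1/2 - u)"
      by (simp add: power2_eq_square algebra_simps)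
    then have "\<bar>u\<bar> ^ k * exp (- (u\<^sup>2 / 2)) \<le> \<bar>u\<bar> ^ k * exp (1/2 - u)"
      by (intro mult_left_mono) auto
    then show ?thesis
      using that by (simp add: exp_diff mult.commute)
  qed
  then have bound: "\<forall>\<^sub>F u::real in at_top. \<bar>u\<bar> ^ k * exp (- (u\<^sup>2 / 2)) \<le> exp (1/2) * (u ^ k / exp u)"
    by (intro eventually_mono[OF eventually_ge_at_top[of 0]])
  show top: ?top
    by (rule tendsto_sandwich[OF _ bound tendsto_const lim]) simp
  show "((\<lambda>u::real. \<bar>u\<bar> ^ k * exp (- (u\<^sup>2 / 2))) \<longlongrightarrow> 0) at_bot"
    unfolding filterlim_at_bot_mirror using top by simp
qed

lemma integrable_power_mult_gaussian:
  "integrable lborel (\<lambda>u::real. (u - t) ^ k * exp (- ((u - t)\<^sup>2 / 2)))"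
proof -
  have "integrable lborel (\<lambda>u. sqrt (2 * pi) * (normal_density t 1 u * (u - t) ^ k))"
    by (intro integrable_mult_right integrable_normal_moment) auto
  then show ?thesis
    by (simp add: normal_density_def ac_simps)
qed

lemma integral_gaussian: "(LINT u|lborel. exp (- ((u - t)\<^sup>2 / 2))) = sqrt (2 * pi)"
  using integral_normal_moment_even[of 1 t 0] by (simp add: normal_density_def)

lemma integrable_poly_mult_gaussian:
  fixes p :: "real poly"
  shows "integrable lborel (\<lambda>y. poly p y * exp (- ((y - t)\<^sup>2 / 2)))"
proof -
  \<comment> \<open>Recentring at t turns the integrand into a combination of central
    moments.\<close>
  let ?p = "pcompose p [:t, 1:]"
  have "poly p y * exp (- ((y - t)\<^sup>2 / 2)) =
      (\<Sum>k\<le>degree ?p. coeff ?p k * ((y - t) ^ k * exp (- ((y - t)\<^sup>2 / 2))))" for y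
  proof -
    have "poly p y = poly ?p (y - t)" by (simp add: poly_pcompose)
    then show ?thesis by (simp add: poly_altdef sum_distrib_right mult.assoc)
  qed
  then show ?thesis
    by (simp only: integrable_power_mult_gaussian Bochner_Integration.integrable_sum integrable_mult_right)
qed

lemma abs_poly_le:
  fixes p :: "real poly"
  shows "\<bar>poly p y\<bar> \<le> (\<Sum>k\<le>degree p. \<bar>coeff p k\<bar>) * (1 + \<bar>y\<bar> ^ degree p)"
proof -
  have "\<bar>poly p y\<bar> \<le> (\<Sum>k\<le>degree p. \<bar>coeff p k\<bar> * \<bar>y\<bar> ^ k)"
    unfolding poly_altdef by (rule order.trans[OF sum_abs]) (simp add: abs_mult power_abs)
  also have "\<dots> \<le> (\<Sum>k\<le>degree p. \<bar>coeff p k\<bar> * (1 + \<bar>y\<bar> ^ degree p))"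
  proof (intro sum_mono mult_left_mono)
    fix k assume k: "k \<in> {..degree p}"
    show "\<bar>y\<bar> ^ k \<le> 1 + \<bar>y\<bar> ^ degree p"
    proof (cases "\<bar>y\<bar> \<le> 1")
      case True
      then have "\<bar>y\<bar> ^ k \<le> 1" by (simp add: power_le_one)
      then show ?thesis by (simp add: add_increasing2)
    next
      case False
      then have "\<bar>y\<bar> ^ k \<le> \<bar>y\<bar> ^ degree p" using k by (intro power_increasing) auto
      then show ?thesis by simp
    qed
  qed auto
  finally show ?thesis by (simp add: sum_distrib_right)
qed

lemma tendsto_poly_mult_gaussian:
  fixes p :: "real poly"
  shows "((\<lambda>y. poly p y * exp (- ((y - t)\<^sup>2 / 2))) \<longlongrightarrow> 0) at_top"
    and "((\<lambda>y. poly p y * exp (- ((y - t)\<^sup>2 / 2))) \<longlongrightarrow> 0) at_bot"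
proof -
  let ?p = "pcompose p [:t, 1:]"
  let ?g = "\<lambda>u. \<Sum>k\<le>degree ?p. \<bar>coeff ?p k\<bar> * (\<bar>u\<bar> ^ k * exp (- (u\<^sup>2 / 2)))"
  have g: "(?g \<longlongrightarrow> 0) at_top" "(?g \<longlongrightarrow> 0) at_bot"
    by (intro tendsto_null_sum tendsto_mult_right_zero tendsto_power_mult_gaussian)+
  have b: "norm (poly p y * exp (- ((y - t)\<^sup>2 / 2))) \<le> ?g (y - t)" for y
  proof -
    have "poly p y = poly ?p (y - t)" by (simp add: poly_pcompose)
    then have "poly p y * exp (- ((y - t)\<^sup>2 / 2)) =
        (\<Sum>k\<le>degree ?p. coeff ?p k * (y - t) ^ k * exp (- ((y - t)\<^sup>2 / 2)))"
      by (simp add: poly_altdef sum_distrib_right)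
    then show ?thesis
      by (simp only: real_norm_def) (rule order.trans[OF sum_abs], simp add: abs_mult power_abs mult.assoc)
  qed
  have "\<exists>N. \<forall>y\<ge>N. Z \<le> y - t" "\<exists>N. \<forall>y\<le>N. y - t \<le> Z" for Z
    by (rule exI[of _ "Z + t"], simp)+
  then have "filterlim (\<lambda>y. y - t) at_top at_top" "filterlim (\<lambda>y. y - t) at_bot at_bot"
    by (auto simp: filterlim_at_top filterlim_at_bot eventually_at_top_linorder
        eventually_at_bot_linorder)
  note lim = filterlim_compose[OF g(1) this(1)] filterlim_compose[OF g(2) this(2)]
  show "((\<lambda>y. poly p y * exp (- ((y - t)\<^sup>2 / 2))) \<longlongrightarrow> 0) at_top"
    by (rule Lim_null_comparison[OF always_eventually lim(1)]) (intro allI b)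
  show "((\<lambda>y. poly p y * exp (- ((y - t)\<^sup>2 / 2))) \<longlongrightarrow> 0) at_bot"
    by (rule Lim_null_comparison[OF always_eventually lim(2)]) (intro allI b)
qed

text \<open>Stein's identity for mean t. The polynomial \<open>r\<close> is the factor left in front
  of the Gaussian when p times the Gaussian is differentiated.\<close>

lemma gaussian_integration_by_parts:
  fixes p :: "real poly"
  shows "(LINT y|lborel. poly (pCons 0 p) y * exp (- ((y - t)\<^sup>2 / 2))) =
    t * (LINT y|lborel. poly p y * exp (- ((y - t)\<^sup>2 / 2))) +
    (LINT y|lborel. poly (pderiv p) y * exp (- ((y - t)\<^sup>2 / 2)))"
proof -
  define r where "r = smult t p + pderiv p - pCons 0 p"
  have "(LINT y|lborel. poly r y * exp (- ((y - t)\<^sup>2 / 2))) = 0"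
  proof (rule integral_derivative_eq_0)
    show "((\<lambda>y. poly p y * exp (- ((y - t)\<^sup>2 / 2))) has_vector_derivative
        poly r y * exp (- ((y - t)\<^sup>2 / 2))) (at y)" for y
      unfolding has_real_derivative_iff_has_vector_derivative[symmetric]
      by (auto intro!: derivative_eq_intros simp: r_def) (simp add: field_simps)
  qed (auto intro!: tendsto_poly_mult_gaussian integrable_poly_mult_gaussian continuous_intros)
  then show ?thesis
    using integrable_poly_mult_gaussian[of p t] integrable_poly_mult_gaussian[of "pderiv p" t]
      integrable_poly_mult_gaussian[of "pCons 0 p" t]
    by (simp add: r_def distrib_right left_diff_distrib mult.assoc del: poly_pCons)
qed

text \<open>The recursion reads He_(k+1) = y He_k - He_k'. Under the Gaussian integral, Stein's
  identity cancels the derivative, so each step contributes one factor t.\<close>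

lemma integral_hermite_gaussian:
  "(LINT y|lborel. poly (hermite k) y * exp (- ((y - t)\<^sup>2 / 2))) = sqrt (2 * pi) * t ^ k"
proof (induction k)
  case 0
  then show ?case using integral_gaussian[of t] by simp
next
  case (Suc k)
  have "(LINT y|lborel. poly (hermite (Suc k)) y * exp (- ((y - t)\<^sup>2 / 2))) =
      (LINT y|lborel. poly (pCons 0 (hermite k)) y * exp (- ((y - t)\<^sup>2 / 2))) -
      (LINT y|lborel. poly (pderiv (hermite k)) y * exp (- ((y - t)\<^sup>2 / 2)))"
    by (simp only: hermite_Suc pderiv_hermite poly_diff left_diff_distrib)
       (intro Bochner_Integration.integral_diff integrable_poly_mult_gaussian)
  then show ?case
    using Suc by (simp only: gaussian_integration_by_parts) simp
qed

lemma integral_hermite_transform_gaussian: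
  "(LINT y|lborel. poly (hermite_transform p) y * exp (- ((y - t)\<^sup>2 / 2))) = sqrt (2 * pi) * poly p t"
proof -
  have "(LINT y|lborel. poly (hermite_transform p) y * exp (- ((y - t)\<^sup>2 / 2))) =
      (LINT y|lborel. (\<Sum>k\<le>degree p. coeff p k * (poly (hermite k) y * exp (- ((y - t)\<^sup>2 / 2)))))"
    by (simp add: hermite_transform_def poly_sum sum_distrib_right mult.assoc)
  also have "\<dots> = (\<Sum>k\<le>degree p. coeff p k * (sqrt (2 * pi) * t ^ k))"
    by (simp add: integrable_poly_mult_gaussian integral_hermite_gaussian)
  finally show ?thesis
    by (simp add: poly_altdef sum_distrib_left ac_simps)
qed

section \<open>The contour integral along the imaginary axis\<close>

definition hermite_integrand :: "real \<Rightarrow> nat \<Rightarrow> real \<Rightarrow> complex" where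
  "hermite_integrand x k u = (\<i> * of_real u) ^ k * exp (1/2 * (of_real x - \<i> * of_real u)\<^sup>2)"

text \<open>At s = iu the real part of (x - s)^2 is x^2 - u^2, so the exponential with positive
  exponent decays like a Gaussian along the contour.\<close>

lemma norm_hermite_integrand:
  "norm (hermite_integrand x k u) = exp (x\<^sup>2 / 2) * (\<bar>u\<bar> ^ k * exp (- (u\<^sup>2 / 2)))"
proof -
  have "Re (1/2 * (of_real x - \<i> * of_real u)\<^sup>2) = x\<^sup>2 / 2 + (- (u\<^sup>2 / 2))"
    by (simp add: power2_eq_square algebra_simps diff_divide_distrib)
  then show ?thesis
    unfolding hermite_integrand_def norm_mult norm_exp_eq_Re norm_power
    by (simp only: exp_add) (simp add: norm_mult)
qed

lemma continuous_hermite_integrand: "continuous_on UNIV (hermite_integrand x k)"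
  unfolding hermite_integrand_def by (intro continuous_intros)

lemma integrable_hermite_integrand: "integrable lborel (hermite_integrand x k)"
proof (rule Bochner_Integration.integrable_bound)
  have "integrable lborel (\<lambda>u::real. norm ((u - 0) ^ k * exp (- ((u - 0)\<^sup>2 / 2))))"
    by (intro integrable_norm integrable_power_mult_gaussian)
  then show "integrable lborel (\<lambda>u::real. exp (x\<^sup>2 / 2) * (\<bar>u\<bar> ^ k * exp (- (u\<^sup>2 / 2))))"
    by (intro integrable_mult_right) (simp add: abs_mult power_abs)
  show "hermite_integrand x k \<in> borel_measurable lborel"
    using borel_measurable_continuous_onI[OF continuous_hermite_integrand] by simp
qed (simp add: norm_hermite_integrand abs_mult)

text \<open>Integrating d/du of s^k exp((x - s)^2/2) at s = iu gives 0 and yields exactly the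
  Hermite recursion; for k = 0 the coefficient again removes the truncated index.\<close>

lemma integral_hermite_integrand_Suc:
  "integral\<^sup>L lborel (hermite_integrand x (Suc k)) =
    of_real x * integral\<^sup>L lborel (hermite_integrand x k)
      - of_nat k * integral\<^sup>L lborel (hermite_integrand x (k - 1))"
proof -
  let ?h = "hermite_integrand x"
  let ?f = "\<lambda>u. \<i> * (of_nat k * ?h (k - 1) u - of_real x * ?h k u + ?h (Suc k) u)"
  have "integral\<^sup>L lborel ?f = 0"
  proof (rule integral_derivative_eq_0)
    show "(?h k has_vector_derivative ?f u) (at u)" for u
    proof -
      \<comment> \<open>The integrand continued to complex u, so that the derivative along the real
        line comes from a complex derivative.\<close>
      let ?e = "\<lambda>z::complex. (\<i> * z) ^ k * exp (1/2 * (of_real x - \<i> * z)\<^sup>2)"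
      have "(?e has_field_derivative ?f u) (at (of_real u))"
        unfolding hermite_integrand_def
        by (auto intro!: derivative_eq_intros) (simp add: algebra_simps)
      from has_vector_derivative_real_field[OF this] show ?thesis
        unfolding hermite_integrand_def .
    qed
    show "isCont ?f u" for u
      using continuous_hermite_integrand
      by (auto intro!: continuous_intros simp: continuous_on_eq_continuous_at)
    show "integrable lborel ?f"
      by (intro integrable_mult_right Bochner_Integration.integrable_add
          Bochner_Integration.integrable_diff integrable_hermite_integrand)
    have "((\<lambda>u. norm (?h k u)) \<longlongrightarrow> 0) at_top" "((\<lambda>u. norm (?h k u)) \<longlongrightarrow> 0) at_bot"
      unfolding norm_hermite_integrand
      by (auto intro!: tendsto_mult_right_zero simp: tendsto_power_mult_gaussian[simplified])
    then show "(?h k \<longlongrightarrow> 0) at_top" "(?h k \<longlongrightarrow> 0) at_bot"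
      by (auto intro: tendsto_norm_zero_cancel)
  qed
  then have "\<i> * (of_nat k * integral\<^sup>L lborel (?h (k - 1)) - of_real x * integral\<^sup>L lborel (?h k)
      + integral\<^sup>L lborel (?h (Suc k))) = 0"
    by (simp add: integrable_hermite_integrand)
  then show ?thesis
    by (simp only: mult_eq_0_iff complex_i_not_zero) (simp add: algebra_simps)
qed

text \<open>Expanding the square leaves the characteristic function of the standard normal law at
  -x, and its value exp(-x^2/2) cancels the prefactor exp(x^2/2). No shift of the contour is
  involved.\<close>

lemma integral_hermite_integrand_0:
  "integral\<^sup>L lborel (hermite_integrand x 0) = of_real (sqrt (2 * pi))"
proof -
  have "(CLINT u|std_normal_distribution. iexp (- x * u)) = complex_of_real (exp (- (x\<^sup>2) / 2))"
    using fun_cong[OF char_std_normal_distribution, of "- x"] by (simp add: char_def)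
  then have "(CLINT u|lborel. std_normal_density u *\<^sub>R iexp (- x * u)) = of_real (exp (- (x\<^sup>2) / 2))"
    by (subst (asm) integral_density) auto
  moreover have eq: "hermite_integrand x 0 u =
      of_real (sqrt (2 * pi) * exp (x\<^sup>2 / 2)) * (std_normal_density u *\<^sub>R iexp (- x * u))" for u
  proof -
    have "exp (1/2 * (of_real x - \<i> * of_real u)\<^sup>2) =
        exp (of_real (x\<^sup>2 / 2) + of_real (- (u\<^sup>2 / 2)) + \<i> * complex_of_real (- x * u))"
      by (rule arg_cong[of _ _ exp]) (simp add: power2_eq_square field_simps)
    also have "\<dots> = of_real (exp (x\<^sup>2 / 2)) * of_real (exp (- (u\<^sup>2 / 2))) * iexp (- x * u)"
      by (simp only: exp_add exp_of_real)
    finally show ?thesis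
      by (simp add: hermite_integrand_def std_normal_density_def scaleR_conv_of_real)
  qed
  ultimately have "integral\<^sup>L lborel (hermite_integrand x 0) =
      of_real (sqrt (2 * pi) * exp (x\<^sup>2 / 2)) * of_real (exp (- (x\<^sup>2) / 2))"
    unfolding Bochner_Integration.integral_cong[OF refl eq] integral_mult_right_zero by (simp only:)
  then show ?thesis
    by (simp add: mult.assoc flip: of_real_mult exp_add)
qed

lemma integral_hermite_integrand:
  "integral\<^sup>L lborel (hermite_integrand x k) = of_real (sqrt (2 * pi) * poly (hermite k) x)"
proof (induction k rule: hermite.induct)
  case 1
  then show ?case
    by (simp add: integral_hermite_integrand_0)
next
  case 2
  then show ?case
    using integral_hermite_integrand_Suc[of x 0] by (simp add: integral_hermite_integrand_0)
next
  case (3 n)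
  then show ?case
    using integral_hermite_integrand_Suc[of x "Suc n"] by (simp add: algebra_simps)
qed

lemma cpoly_altdef: "cpoly p s = (\<Sum>k\<le>degree p. of_real (coeff p k) * s ^ k)"
  by (simp add: cpoly_def poly_altdef coeff_map_poly)

lemma cpoly_mult_gaussian:
  "cpoly p (\<i> * of_real u) * exp (1/2 * (of_real x - \<i> * of_real u)\<^sup>2) =
    (\<Sum>k\<le>degree p. of_real (coeff p k) * hermite_integrand x k u)"
  by (simp add: cpoly_altdef hermite_integrand_def sum_distrib_right mult.assoc)

lemma integrable_cpoly_mult_gaussian:
  "integrable lborel (\<lambda>u. cpoly p (\<i> * of_real u) * exp (1/2 * (of_real x - \<i> * of_real u)\<^sup>2))"
  unfolding cpoly_mult_gaussian
  by (intro Bochner_Integration.integrable_sum integrable_mult_right integrable_hermite_integrand)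

lemma integral_cpoly_mult_gaussian:
  "(LINT u|lborel. cpoly p (\<i> * of_real u) * exp (1/2 * (of_real x - \<i> * of_real u)\<^sup>2)) =
    of_real (sqrt (2 * pi) * poly (hermite_transform p) x)"
  unfolding cpoly_mult_gaussian
  by (subst Bochner_Integration.integral_sum)
     (auto simp: integrable_hermite_integrand integral_hermite_integrand hermite_transform_def
        poly_sum sum_distrib_left ac_simps)

lemma imag_axis_integral_eq_hermite_transform:
  "1 / (of_real (sqrt (2 * pi)) * \<i>) *
      imag_axis_integral (\<lambda>s. cpoly p s * exp (1/2 * (of_real x - s)\<^sup>2)) =
    of_real (poly (hermite_transform p) x)"
proof -
  have "imag_axis_integral (\<lambda>s. cpoly p s * exp (1/2 * (of_real x - s)\<^sup>2)) =
      of_real (sqrt (2 * pi) * poly (hermite_transform p) x) * \<i>"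
    unfolding imag_axis_integral_def integral_mult_left_zero integral_cpoly_mult_gaussian ..
  then show ?thesis by (simp add: of_real_mult)
qed

text \<open>The point is the growth rate: no power of t beyond \<open>degree p\<close> may appear,
  because the dual functions are integrable only against polynomials of degree below n.\<close>

lemma integral_abs_poly_gaussian_le:
  fixes p :: "real poly"
  shows "\<exists>C. \<forall>t. (LINT y|lborel. \<bar>poly p y * exp (- ((y - t)\<^sup>2 / 2))\<bar>) \<le> C * (1 + \<bar>t\<bar> ^ degree p)"
proof -
  define d A where "d = degree p" and "A = (\<Sum>k\<le>d. \<bar>coeff p k\<bar>)"
  define m where "m t = (LINT y|lborel. \<bar>(y - t) ^ d * exp (- ((y - t)\<^sup>2 / 2))\<bar>)" for t :: real
  \<comment> \<open>Translation invariance makes the absolute central moment independent of t, hence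
    part of the constant.\<close>
  have m: "m t = m 0" for t
    unfolding m_def using lborel_integral_real_affine[of 1
      "\<lambda>y. \<bar>(y - t) ^ d * exp (- ((y - t)\<^sup>2 / 2))\<bar>" t] by simp
  have "A \<ge> 0" by (simp add: A_def sum_nonneg)
  have i: "integrable lborel (\<lambda>y. exp (- ((y - t)\<^sup>2 / 2)))"
    "integrable lborel (\<lambda>y. \<bar>(y - t) ^ d * exp (- ((y - t)\<^sup>2 / 2))\<bar>)" for t :: real
    using integrable_power_mult_gaussian[of t 0] integrable_abs[OF integrable_power_mult_gaussian[of t d]]
    by simp_all
  have "(LINT y|lborel. \<bar>poly p y * exp (- ((y - t)\<^sup>2 / 2))\<bar>) \<le>
      (A * sqrt (2 * pi) + A * 2 ^ d * sqrt (2 * pi) + A * 2 ^ d * m 0) * (1 + \<bar>t\<bar> ^ d)" for t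
  proof -
    have "(LINT y|lborel. \<bar>poly p y * exp (- ((y - t)\<^sup>2 / 2))\<bar>) \<le>
      (LINT y|lborel. (A + A * 2 ^ d * \<bar>t\<bar> ^ d) * exp (- ((y - t)\<^sup>2 / 2)) +
        (A * 2 ^ d) * \<bar>(y - t) ^ d * exp (- ((y - t)\<^sup>2 / 2))\<bar>)"
    proof (intro integral_mono integrable_abs integrable_poly_mult_gaussian
        integrable_power_mult_gaussian
        Bochner_Integration.integrable_add integrable_mult_right i)
      fix y :: real
      \<comment> \<open>From |y| <= |t| + |y - t|; the maximum to the power d is at most the sum of
        both powers, which is where \<open>2 ^ d\<close> comes from.\<close>
      have "\<bar>y\<bar> ^ d \<le> (2 * max \<bar>t\<bar> \<bar>y - t\<bar>) ^ d"
        by (intro power_mono) (auto simp: max_def abs_if)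
      also have "\<dots> \<le> 2 ^ d * (\<bar>t\<bar> ^ d + \<bar>y - t\<bar> ^ d)"
        by (simp add: power_mult_distrib max_def)
      finally have *: "\<bar>y\<bar> ^ d \<le> 2 ^ d * (\<bar>t\<bar> ^ d + \<bar>y - t\<bar> ^ d)" .
      have "\<bar>poly p y\<bar> \<le> A * (1 + \<bar>y\<bar> ^ d)"
        using abs_poly_le[of p y] by (simp add: A_def d_def)
      also have "\<dots> \<le> A * (1 + 2 ^ d * (\<bar>t\<bar> ^ d + \<bar>y - t\<bar> ^ d))"
        using * \<open>A \<ge> 0\<close> by (intro mult_left_mono add_left_mono) auto
      finally have "\<bar>poly p y\<bar> * exp (- ((y - t)\<^sup>2 / 2)) \<le>
          A * (1 + 2 ^ d * (\<bar>t\<bar> ^ d + \<bar>y - t\<bar> ^ d)) * exp (- ((y - t)\<^sup>2 / 2))"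
        by (intro mult_right_mono) auto
      then show "\<bar>poly p y * exp (- ((y - t)\<^sup>2 / 2))\<bar> \<le>
          (A + A * 2 ^ d * \<bar>t\<bar> ^ d) * exp (- ((y - t)\<^sup>2 / 2)) +
          (A * 2 ^ d) * \<bar>(y - t) ^ d * exp (- ((y - t)\<^sup>2 / 2))\<bar>"
        by (simp add: abs_mult power_abs algebra_simps)
    qed
    also have "\<dots> = (A + A * 2 ^ d * \<bar>t\<bar> ^ d) * sqrt (2 * pi) + (A * 2 ^ d) * m t"
      by (subst Bochner_Integration.integral_add)
         (simp_all add: i m_def integral_gaussian integrable_mult_right del: abs_mult)
    also have "\<dots> \<le> (A * sqrt (2 * pi) + A * 2 ^ d * sqrt (2 * pi) + A * 2 ^ d * m 0) * (1 + \<bar>t\<bar> ^ d)"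
    proof -
      have "m 0 \<ge> 0" by (simp add: m_def)
      with \<open>A \<ge> 0\<close> have "0 \<le> A * sqrt (2 * pi) * \<bar>t\<bar> ^ d" "0 \<le> A * 2 ^ d * sqrt (2 * pi)"
        "0 \<le> A * 2 ^ d * m 0 * \<bar>t\<bar> ^ d" by simp_all
      then show ?thesis unfolding m[of t] by (simp add: algebra_simps)
    qed
    finally show ?thesis .
  qed
  then show ?thesis unfolding d_def by blast
qed

lemma integrable_heat_convolution:
  fixes p :: "real poly"
  assumes "integrable lborel q" "integrable lborel (\<lambda>t. t ^ degree p * q t)"
  shows "integrable (lborel \<Otimes>\<^sub>M lborel) (\<lambda>(t, y). q t * (poly p y * exp (- ((y - t)\<^sup>2 / 2))))"
proof (rule lborel_pair.Fubini_integrable)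
  have [measurable]: "q \<in> borel_measurable lborel" using assms(1) by auto
  have [measurable]: "poly p \<in> borel_measurable borel"
    by (intro borel_measurable_continuous_onI continuous_intros)
  show "(\<lambda>(t, y). q t * (poly p y * exp (- ((y - t)\<^sup>2 / 2)))) \<in> borel_measurable (lborel \<Otimes>\<^sub>M lborel)"
    by measurable
  obtain C where C: "(LINT y|lborel. \<bar>poly p y * exp (- ((y - t)\<^sup>2 / 2))\<bar>) \<le> C * (1 + \<bar>t\<bar> ^ degree p)" for t
    using integral_abs_poly_gaussian_le[of p] by blast
  have [measurable]: "(\<lambda>t. LINT y|lborel. \<bar>poly p y * exp (- ((y - t)\<^sup>2 / 2))\<bar>) \<in> borel_measurable lborel"
    by measurable
  have "integrable lborel (\<lambda>t. \<bar>q t\<bar> * (LINT y|lborel. \<bar>poly p y * exp (- ((y - t)\<^sup>2 / 2))\<bar>))"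
  proof (rule Bochner_Integration.integrable_bound)
    show "integrable lborel (\<lambda>t. C * (\<bar>q t\<bar> + \<bar>t ^ degree p * q t\<bar>))"
      by (intro integrable_mult_right Bochner_Integration.integrable_add integrable_abs assms)
    show "AE t in lborel. norm (\<bar>q t\<bar> * (LINT y|lborel. \<bar>poly p y * exp (- ((y - t)\<^sup>2 / 2))\<bar>)) \<le>
        norm (C * (\<bar>q t\<bar> + \<bar>t ^ degree p * q t\<bar>))"
    proof (intro AE_I2)
      fix t
      let ?I = "LINT y|lborel. \<bar>poly p y * exp (- ((y - t)\<^sup>2 / 2))\<bar>"
      have "\<bar>q t\<bar> * ?I \<le> \<bar>q t\<bar> * (C * (1 + \<bar>t\<bar> ^ degree p))"
        by (intro mult_left_mono C) auto
      also have "\<dots> = C * (\<bar>q t\<bar> + \<bar>t ^ degree p * q t\<bar>)"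
        by (simp add: algebra_simps abs_mult power_abs)
      \<comment> \<open>The sign of \<open>C\<close> is unknown, so the absolute value is taken only
        here.\<close>
      also have "\<dots> \<le> norm (C * (\<bar>q t\<bar> + \<bar>t ^ degree p * q t\<bar>))"
        unfolding real_norm_def by (rule abs_ge_self)
      finally show "norm (\<bar>q t\<bar> * ?I) \<le> norm (C * (\<bar>q t\<bar> + \<bar>t ^ degree p * q t\<bar>))"
        by (simp add: abs_mult del: abs_abs)
    qed
  qed measurable
  then show "integrable lborel (\<lambda>x. LINT y|lborel. norm (case (x, y) of (t, y) \<Rightarrow> q t * (poly p y * exp (- ((y - t)\<^sup>2 / 2)))))"
    by (simp add: abs_mult)
  show "AE x in lborel. integrable lborel (\<lambda>y. case (x, y) of (t, y) \<Rightarrow> q t * (poly p y * exp (- ((y - t)\<^sup>2 / 2))))"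
    using integrable_poly_mult_gaussian by auto
qed

lemma integral_hermite_transform_heat_convolution:
  fixes p :: "real poly"
  assumes "integrable lborel q" "integrable lborel (\<lambda>t. t ^ degree p * q t)"
  defines "Q \<equiv> \<lambda>y. LINT t|lborel. q t * exp (- ((y - t)\<^sup>2 / 2))"
  shows "integrable lborel (\<lambda>y. poly (hermite_transform p) y * Q y)"
    and "(LINT y|lborel. poly (hermite_transform p) y * Q y) = sqrt (2 * pi) * (LINT t|lborel. poly p t * q t)"
proof -
  let ?T = "hermite_transform p"
  have int: "integrable (lborel \<Otimes>\<^sub>M lborel) (\<lambda>(t, y). q t * (poly ?T y * exp (- ((y - t)\<^sup>2 / 2))))"
    using assms by (intro integrable_heat_convolution) (auto simp: degree_hermite_transform)
  have eq: "poly ?T y * Q y = (LINT t|lborel. q t * (poly ?T y * exp (- ((y - t)\<^sup>2 / 2))))" for y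
    unfolding Q_def by (simp add: mult.left_commute[of "q _"])
  show "integrable lborel (\<lambda>y. poly ?T y * Q y)"
    unfolding eq using lborel_pair.integrable_snd[OF int] by simp
  have "(LINT y|lborel. poly ?T y * Q y) =
      (LINT t|lborel. LINT y|lborel. q t * (poly ?T y * exp (- ((y - t)\<^sup>2 / 2))))"
    unfolding eq using lborel_pair.Fubini_integral[OF int] by simp
  also have "\<dots> = (LINT t|lborel. sqrt (2 * pi) * (poly p t * q t))"
    by (intro Bochner_Integration.integral_cong refl)
       (simp add: integral_hermite_transform_gaussian ac_simps)
  finally show "(LINT y|lborel. poly ?T y * Q y) = sqrt (2 * pi) * (LINT t|lborel. poly p t * q t)"
    by simp
qed

section \<open>Determinants\<close>

text \<open>Determinants of arrays given as functions: permuting, replacing or combining rows is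
  plain function manipulation, free of carrier conditions, and only indices below n matter.\<close>

definition mdet :: "nat \<Rightarrow> (nat \<Rightarrow> nat \<Rightarrow> 'a::comm_ring_1) \<Rightarrow> 'a" where
  "mdet n a = Determinant.det (Matrix.mat n n (\<lambda>(i, j). a i j))"

lemma mdet_leibniz: "mdet n a = (\<Sum>\<sigma> | \<sigma> permutes {..<n}. signof \<sigma> * (\<Prod>i<n. a i (\<sigma> i)))"
proof -
  have "mdet n a = (\<Sum>\<sigma> | \<sigma> permutes {0..<n}. signof \<sigma> * (\<Prod>i = 0..<n. a i (\<sigma> i)))"
    unfolding mdet_def det_def'[OF mat_carrier]
    by (intro sum.cong arg_cong2[of _ _ _ _ "(*)"] prod.cong refl) (auto simp: permutes_in_image)
  then show ?thesis by (simp add: atLeast0LessThan)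
qed

lemma mdet_cong: "(\<And>i j. i < n \<Longrightarrow> j < n \<Longrightarrow> a i j = b i j) \<Longrightarrow> mdet n a = mdet n b"
  unfolding mdet_def by (intro arg_cong[of _ _ Determinant.det] eq_matI) auto

lemma mdet_transpose: "mdet n (\<lambda>i j. a j i) = mdet n a"
proof -
  have "Matrix.mat n n (\<lambda>(i, j). a j i) = transpose_mat (Matrix.mat n n (\<lambda>(i, j). a i j))"
    by (intro eq_matI) auto
  then show ?thesis
    unfolding mdet_def using det_transpose[of "Matrix.mat n n (\<lambda>(i, j). a i j)" n] by simp
qed

lemma mdet_mult: "mdet n (\<lambda>i j. \<Sum>l<n. a i l * b l j) = mdet n a * mdet n b"
proof -
  have "Matrix.mat n n (\<lambda>(i, j). \<Sum>l<n. a i l * b l j) =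
      Matrix.mat n n (\<lambda>(i, j). a i j) * Matrix.mat n n (\<lambda>(i, j). b i j)"
    by (intro eq_matI) (auto simp: scalar_prod_def atLeast0LessThan)
  then show ?thesis
    unfolding mdet_def by (simp add: det_mult[OF mat_carrier mat_carrier])
qed

lemma mdet_permute_rows:
  "\<sigma> permutes {..<n} \<Longrightarrow> mdet n (\<lambda>i j. a (\<sigma> i) j) = signof \<sigma> * mdet n a"
  unfolding mdet_def
  by (subst det_permute_rows[symmetric, OF mat_carrier, of \<sigma>])
     (auto simp: atLeast0LessThan permutes_in_image intro!: arg_cong[of _ _ Determinant.det] eq_matI)

lemma mdet_permute_both:
  assumes "\<sigma> permutes {..<n}"
  shows "mdet n (\<lambda>i j. a (\<sigma> i) (\<sigma> j)) = mdet n a"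
proof -
  have "mdet n (\<lambda>i j. a (\<sigma> i) (\<sigma> j)) = signof \<sigma> * mdet n (\<lambda>j i. a i (\<sigma> j))"
    using mdet_permute_rows[OF assms, of "\<lambda>i j. a i (\<sigma> j)"] mdet_transpose[of n "\<lambda>i j. a i (\<sigma> j)"]
    by simp
  also have "mdet n (\<lambda>j i. a i (\<sigma> j)) = signof \<sigma> * mdet n a"
    using mdet_permute_rows[OF assms, of "\<lambda>j i. a i j"] mdet_transpose[of n a] by simp
  also have "signof \<sigma> * (signof \<sigma> * mdet n a) = mdet n a"
    by (simp add: mult.assoc[symmetric] of_int_mult[symmetric] del: of_int_mult)
  finally show ?thesis .
qed

lemma mdet_identical_rows:
  assumes "i < n" "j < n" "i \<noteq> j" "\<And>k. k < n \<Longrightarrow> a i k = a j k"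
  shows "mdet n a = 0"
  unfolding mdet_def using assms
  by (intro det_identical_rows[OF mat_carrier, of i j]) (auto intro!: eq_vecI)

lemma mdet_zero_column:
  assumes "j < n" "\<And>i. i < n \<Longrightarrow> a i j = 0"
  shows "mdet n a = 0"
proof -
  have "(\<Prod>i<n. a i (\<sigma> i)) = 0" if \<sigma>: "\<sigma> permutes {..<n}" for \<sigma>
  proof (rule prod_zero)
    have "Hilbert_Choice.inv \<sigma> j < n" "\<sigma> (Hilbert_Choice.inv \<sigma> j) = j"
      using permutes_in_image[OF permutes_inv[OF \<sigma>], of j] permutes_inverses[OF \<sigma>] assms(1) by auto
    then show "\<exists>i\<in>{..<n}. a i (\<sigma> i) = 0"
      using assms(2) by (metis lessThan_iff)
  qed simp
  then show ?thesis by (simp add: mdet_leibniz)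
qed

text \<open>Padding u with zero columns up to width m exhibits the matrix as a product with a
  singular factor. This is why an ensemble of n particles has no correlations of order m >
  n.\<close>

lemma mdet_low_rank:
  fixes u v :: "nat \<Rightarrow> nat \<Rightarrow> 'a::comm_ring_1"
  assumes "n < m"
  shows "mdet m (\<lambda>i j. \<Sum>l<n. u i l * v l j) = 0"
proof -
  let ?u = "\<lambda>i l. if l < n then u i l else 0"
  have "mdet m (\<lambda>i j. \<Sum>l<n. u i l * v l j) = mdet m (\<lambda>i j. \<Sum>l<m. ?u i l * v l j)"
  proof (rule mdet_cong)
    fix i j
    show "(\<Sum>l<n. u i l * v l j) = (\<Sum>l<m. ?u i l * v l j)"
      using assms by (intro sum.mono_neutral_cong_left) auto
  qed
  also have "\<dots> = mdet m ?u * mdet m v"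
    by (rule mdet_mult)
  also have "mdet m ?u = 0"
    using assms by (intro mdet_zero_column[of n]) auto
  finally show ?thesis by simp
qed

text \<open>Entrywise form of "trivial kernel implies invertible". It is used twice: to exchange the
  dual functions with the weights, and to form the resolvent of a Hermitian matrix at distance 1
  from the real axis.\<close>

lemma mdet_inverse:
  fixes g :: "nat \<Rightarrow> nat \<Rightarrow> 'a::field"
  assumes ker: "\<And>v j. (\<And>i. i < n \<Longrightarrow> (\<Sum>l<n. g i l * v l) = 0) \<Longrightarrow> j < n \<Longrightarrow> v j = 0"
  obtains w where "\<And>i j. i < n \<Longrightarrow> j < n \<Longrightarrow> (\<Sum>l<n. g i l * w l j) = (if i = j then 1 else 0)"
proof -
  define G where "G = Matrix.mat n n (\<lambda>(i, j). g i j)"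
  have G: "G \<in> carrier_mat n n" by (simp add: G_def)
  have "Determinant.det G \<noteq> 0"
  proof
    assume "Determinant.det G = 0"
    then obtain v where v: "v \<in> carrier_vec n" "v \<noteq> 0\<^sub>v n" "G *\<^sub>v v = 0\<^sub>v n"
      using det_0_iff_vec_prod_zero[OF G] by blast
    have "(\<Sum>l<n. g i l * vec_index v l) = 0" if "i < n" for i
      using arg_cong[OF v(3), of "\<lambda>w. vec_index w i"] that v(1) G
      by (simp add: G_def scalar_prod_def atLeast0LessThan)
    then have "vec_index v j = 0" if "j < n" for j using ker that by blast
    then have "v = 0\<^sub>v n" using v(1) by (intro eq_vecI) auto
    with v(2) show False by contradiction
  qed
  then obtain W where W: "W \<in> carrier_mat n n" "G * W = 1\<^sub>m n"
    using det_non_zero_imp_unit[OF G, of undefined] by (auto simp: Units_def ring_mat_def)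
  show thesis
  proof
    fix i j assume "i < n" "j < n"
    then show "(\<Sum>l<n. g i l * W $$ (l, j)) = (if i = j then 1 else 0)"
      using arg_cong[OF W(2), of "\<lambda>M. M $$ (i, j)"] G W(1)
      by (simp add: G_def scalar_prod_def atLeast0LessThan)
  qed
qed

section \<open>Biorthogonal systems\<close>

text \<open>A kernel vector of the transposed coefficient matrix would be a vanishing combination of
  the q, so the matrix is invertible and the relation can be solved for the f, pointwise rather than
  almost everywhere.\<close>

lemma exchange_spanning_functions:
  fixes f q :: "nat \<Rightarrow> 'x \<Rightarrow> real"
  assumes q: "\<And>j x. j < n \<Longrightarrow> q j x = (\<Sum>k<n. c j k * f k x)"
    and indep: "\<And>a j. (\<And>x. (\<Sum>j<n. a j * q j x) = 0) \<Longrightarrow> j < n \<Longrightarrow> a j = 0"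
  obtains d where "\<And>k x. k < n \<Longrightarrow> f k x = (\<Sum>j<n. d k j * q j x)"
proof -
  have rearrange: "(\<Sum>j<n. a j * q j x) = (\<Sum>k<n. (\<Sum>j<n. c j k * a j) * f k x)" for a x
  proof -
    have "(\<Sum>j<n. a j * q j x) = (\<Sum>j<n. \<Sum>k<n. c j k * a j * f k x)"
      by (simp add: q sum_distrib_left mult.assoc mult.left_commute)
    also have "\<dots> = (\<Sum>k<n. (\<Sum>j<n. c j k * a j) * f k x)"
      by (subst sum.swap) (simp add: sum_distrib_right)
    finally show ?thesis .
  qed
  have "v j = 0" if "\<And>i. i < n \<Longrightarrow> (\<Sum>l<n. c l i * v l) = 0" "j < n" for v j
  proof (rule indep[OF _ that(2)])
    show "(\<Sum>j<n. v j * q j x) = 0" for x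
      unfolding rearrange using that(1) by (intro sum.neutral) simp
  qed
  then obtain w where w: "\<And>i j. i < n \<Longrightarrow> j < n \<Longrightarrow> (\<Sum>l<n. c l i * w l j) = (if i = j then 1 else 0)"
    using mdet_inverse[of n "\<lambda>i l. c l i"] by blast
  show thesis
  proof
    fix k x assume k: "k < n"
    have "(\<Sum>j<n. w j k * q j x) = (\<Sum>i<n. if i = k then f i x else 0)"
      unfolding rearrange using k by (intro sum.cong) (auto simp: w)
    then show "f k x = (\<Sum>j<n. w j k * q j x)" using k by simp
  qed
qed

lemma poly_in_span_of_graded:
  fixes p :: "nat \<Rightarrow> 'a::field poly"
  assumes "\<And>j. j < n \<Longrightarrow> degree (p j) = j" "\<And>j. j < n \<Longrightarrow> p j \<noteq> 0" "r = 0 \<or> degree r < n"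
  shows "\<exists>a. r = (\<Sum>j<n. smult (a j) (p j))"
  using assms
proof (induction n arbitrary: r)
  case 0
  then show ?case by simp
next
  case (Suc n)
  define c where "c = coeff r n / coeff (p n) n"
  define r' where "r' = r - smult c (p n)"
  have lc: "coeff (p n) n \<noteq> 0" using Suc.prems by (metis leading_coeff_0_iff lessI)
  have "degree r \<le> n" using Suc.prems(3) by auto
  then have "degree r' \<le> n" 
    unfolding r'_def using Suc.prems(1)[of n] 
    by (intro degree_diff_le order.trans[OF degree_smult_le]) auto
  moreover have "coeff r' n = 0" using lc by (simp add: r'_def c_def)
  ultimately have "r' = 0 \<or> degree r' < n"
    by (metis le_neq_implies_less leading_coeff_0_iff)
  then obtain a where "r' = (\<Sum>j<n. smult (a j) (p j))"
    using Suc.IH[of r'] Suc.prems by auto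
  then have "r = (\<Sum>j<Suc n. smult ((a(n := c)) j) (p j))"
    by (simp add: r'_def algebra_simps)
  then show ?case by blast
qed

context
  fixes n :: nat and f :: "nat \<Rightarrow> real \<Rightarrow> real" and p :: "nat \<Rightarrow> real poly" and q :: "nat \<Rightarrow> real \<Rightarrow> real"
  assumes bi: "biorthogonal_system n f p q"
begin

lemma biorthogonal_degree: "j < n \<Longrightarrow> degree (p j) = j"
  and biorthogonal_integrable: "j < n \<Longrightarrow> k < n \<Longrightarrow> integrable lborel (\<lambda>x. poly (p j) x * q k x)"
  and biorthogonal_integral:
    "j < n \<Longrightarrow> k < n \<Longrightarrow> (LINT x|lborel. poly (p j) x * q k x) = (if j = k then 1 else 0)"
  using bi by (auto simp: biorthogonal_system_def)

text \<open>The degree condition still allows p_0 = 0, which has degree 0; the normalization of the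
  pairing excludes it.\<close>

lemma biorthogonal_nonzero: "j < n \<Longrightarrow> p j \<noteq> 0"
  using biorthogonal_integral[of j j] by auto

text \<open>Only the products p_j q_k are integrable by definition. Since the p_j have one degree
  each, they span all polynomials of degree below n, so all moments of q_k below order n
  exist.\<close>

lemma biorthogonal_integrable_poly:
  assumes "degree r < n" "k < n"
  shows "integrable lborel (\<lambda>x. poly r x * q k x)"
proof -
  obtain a where r: "r = (\<Sum>j<n. smult (a j) (p j))"
    using poly_in_span_of_graded[OF biorthogonal_degree biorthogonal_nonzero] assms(1) by blast
  have "poly r x * q k x = (\<Sum>j<n. a j * (poly (p j) x * q k x))" for x
    by (simp add: r poly_sum sum_distrib_right mult.assoc)
  then show ?thesis
    using assms(2)
    by (auto intro!: Bochner_Integration.integrable_sum integrable_mult_right biorthogonal_integrable)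
qed

lemma biorthogonal_integrable_power:
  assumes "j < n" "k < n"
  shows "integrable lborel (\<lambda>x. x ^ j * q k x)"
  using biorthogonal_integrable_poly[of "monom 1 j" k] assms by (simp add: degree_monom_eq poly_monom)

lemma biorthogonal_dual_integrable:
  assumes "k < n"
  shows "integrable lborel (q k)"
  using biorthogonal_integrable_power[of 0 k] assms by simp

lemma biorthogonal_dual_coefficient:
  assumes "j < n"
  shows "(LINT x|lborel. poly (p j) x * (\<Sum>k<n. a k * q k x)) = a j"
proof -
  have "(LINT x|lborel. poly (p j) x * (\<Sum>k<n. a k * q k x)) =
      (LINT x|lborel. (\<Sum>k<n. a k * (poly (p j) x * q k x)))"
    by (simp add: sum_distrib_left mult.left_commute)
  also have "\<dots> = (\<Sum>k<n. a k * (if j = k then 1 else 0))"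
    using assms by (simp add: biorthogonal_integrable biorthogonal_integral)
  finally show ?thesis using assms by (simp add: sum.delta if_distrib cong: if_cong)
qed

lemma biorthogonal_dual_independent:
  assumes "\<And>x. (\<Sum>k<n. a k * q k x) = 0" "j < n"
  shows "a j = 0"
  using biorthogonal_dual_coefficient[OF assms(2), of a] assms(1) by simp

lemma biorthogonal_dual_coeffs:
  obtains c where "\<And>j x. j < n \<Longrightarrow> q j x = (\<Sum>k<n. c j k * f k x)"
proof -
  have "\<forall>j. \<exists>c. j < n \<longrightarrow> (\<forall>x. q j x = (\<Sum>k<n. c k * f k x))"
    using bi by (auto simp: biorthogonal_system_def)
  then show thesis using that by metis
qed

text \<open>Pairing with the p_j shows that the q_j are independent, so the exchange argument
  applies. It transfers facts about the q_j to the weights, whose integrability is not part of the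
  definition.\<close>

lemma biorthogonal_dual_spans:
  obtains d where "\<And>k x. k < n \<Longrightarrow> f k x = (\<Sum>j<n. d k j * q j x)"
proof -
  obtain c where c: "\<And>j x. j < n \<Longrightarrow> q j x = (\<Sum>k<n. c j k * f k x)"
    using biorthogonal_dual_coeffs by blast
  show thesis
  proof (rule exchange_spanning_functions[of n q c f, OF c])
    fix a j assume "\<And>x. (\<Sum>j<n. a j * q j x) = 0" "j < n"
    then show "a j = 0" by (rule biorthogonal_dual_independent)
  qed (use that in blast)+
qed

lemma biorthogonal_weight_integrable:
  assumes "k < n"
  shows "integrable lborel (f k)"
proof -
  obtain d where "\<And>k x. k < n \<Longrightarrow> f k x = (\<Sum>j<n. d k j * q j x)"
    using biorthogonal_dual_spans by blast
  then have "f k = (\<lambda>x. \<Sum>j<n. d k j * q j x)" using assms by auto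
  then show ?thesis 
    by (auto intro!: Bochner_Integration.integrable_sum integrable_mult_right biorthogonal_dual_integrable)
qed

end

text \<open>Expand p in p' and q' in q. Pairing p_j with q'_i, once in each expansion, shows that
  the two coefficient matrices are transposes of each other, so the double sum can be read either
  way.\<close>

lemma biorthogonal_kernel_unique:
  assumes bi: "biorthogonal_system n f p q" and bi': "biorthogonal_system n f p' q'"
  shows "(\<Sum>j<n. poly (p j) x * q j y) = (\<Sum>j<n. poly (p' j) x * q' j y)"
proof -
  have "\<forall>j. \<exists>a. j < n \<longrightarrow> p j = (\<Sum>i<n. smult (a i) (p' i))"
    using poly_in_span_of_graded[OF biorthogonal_degree[OF bi'] biorthogonal_nonzero[OF bi']]
      biorthogonal_degree[OF bi] by metis
  then obtain a where a: "\<And>j. j < n \<Longrightarrow> p j = (\<Sum>i<n. smult (a j i) (p' i))" by metis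
  obtain c where c: "\<And>j x. j < n \<Longrightarrow> q' j x = (\<Sum>k<n. c j k * f k x)"
    using biorthogonal_dual_coeffs[OF bi'] by blast
  obtain d where d: "\<And>k x. k < n \<Longrightarrow> f k x = (\<Sum>j<n. d k j * q j x)"
    using biorthogonal_dual_spans[OF bi] by blast
  define b where "b i j = (\<Sum>k<n. c i k * d k j)" for i j
  have b: "q' i x = (\<Sum>j<n. b i j * q j x)" if "i < n" for i x
    using that by (simp add: c d b_def sum_distrib_left sum_distrib_right mult.assoc)
      (subst sum.swap, simp)
  have "a j i = b i j" if "i < n" "j < n" for i j
  proof -
    have "b i j = (LINT x|lborel. poly (p j) x * q' i x)"
      using biorthogonal_dual_coefficient[OF bi \<open>j < n\<close>, of "b i"] b[OF \<open>i < n\<close>] by simp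
    also have "\<dots> = (LINT x|lborel. (\<Sum>l<n. a j l * (poly (p' l) x * q' i x)))"
      using a[OF \<open>j < n\<close>] by (simp add: poly_sum sum_distrib_right mult.assoc)
    also have "\<dots> = (\<Sum>l<n. a j l * (if l = i then 1 else 0))"
      using that by (simp add: biorthogonal_integrable[OF bi'] biorthogonal_integral[OF bi'])
    also have "\<dots> = a j i" using that by (simp add: sum.delta' if_distrib cong: if_cong)
    finally show ?thesis by simp
  qed
  then have "(\<Sum>j<n. poly (p j) x * q j y) = (\<Sum>j<n. \<Sum>i<n. b i j * poly (p' i) x * q j y)"
    by (simp add: a poly_sum sum_distrib_right)
  also have "\<dots> = (\<Sum>i<n. poly (p' i) x * q' i y)"
    by (subst sum.swap) (simp add: b sum_distrib_left ac_simps)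
  finally show ?thesis .
qed

context
  fixes n :: nat and f q F Q :: "nat \<Rightarrow> real \<Rightarrow> real" and p :: "nat \<Rightarrow> real poly"
  assumes bi: "biorthogonal_system n f p q"
    and F: "\<And>k y. F k y = (LINT t|lborel. f k t * exp (- (1/2) * (y - t)\<^sup>2))"
    and Q: "\<And>k y. Q k y = 1 / sqrt (2 * pi) * (LINT t|lborel. q k t * exp (- (1/2) * (y - t)\<^sup>2))"
begin

lemma integrable_mult_heat_kernel:
  fixes g :: "real \<Rightarrow> real"
  assumes "integrable lborel g"
  shows "integrable lborel (\<lambda>t. g t * exp (- (1/2) * (y - t)\<^sup>2))"
proof (rule Bochner_Integration.integrable_bound[OF assms])
  show "(\<lambda>t. g t * exp (- (1/2) * (y - t)\<^sup>2)) \<in> borel_measurable lborel"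
    using assms by measurable
qed (auto simp: abs_mult intro!: mult_left_le)

lemma heat_flow_biorthogonal: "biorthogonal_system n F (\<lambda>k. hermite_transform (p k)) Q"
  unfolding biorthogonal_system_def
proof (intro conjI allI impI)
  fix j assume j: "j < n"
  show "degree (hermite_transform (p j)) = j"
    using biorthogonal_degree[OF bi j] by (simp add: degree_hermite_transform)
  obtain c where c: "\<And>x. q j x = (\<Sum>k<n. c k * f k x)"
    using bi j by (auto simp: biorthogonal_system_def)
  have "Q j x = (\<Sum>k<n. c k / sqrt (2 * pi) * F k x)" for x
  proof -
    have "(LINT t|lborel. q j t * exp (- (1/2) * (x - t)\<^sup>2)) =
        (LINT t|lborel. (\<Sum>k<n. c k * (f k t * exp (- (1/2) * (x - t)\<^sup>2))))"
      by (simp add: c sum_distrib_right mult.assoc)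
    also have "\<dots> = (\<Sum>k<n. LINT t|lborel. c k * (f k t * exp (- (1/2) * (x - t)\<^sup>2)))"
      by (intro Bochner_Integration.integral_sum integrable_mult_right integrable_mult_heat_kernel
          biorthogonal_weight_integrable[OF bi]) auto
    also have "\<dots> = (\<Sum>k<n. c k * F k x)"
      by (simp only: F integral_mult_right_zero)
    finally show ?thesis
      by (simp add: Q sum_divide_distrib)
  qed
  then show "\<exists>c. \<forall>x. Q j x = (\<Sum>k<n. c k * F k x)" by (intro exI allI)
next
  fix j k assume jk: "j < n" "k < n"
  let ?Q = "\<lambda>y. LINT t|lborel. q k t * exp (- ((y - t)\<^sup>2 / 2))"
  have Qk: "Q k y = 1 / sqrt (2 * pi) * ?Q y" for y by (simp add: Q)
  have q: "integrable lborel (q k)" "integrable lborel (\<lambda>t. t ^ degree (p j) * q k t)"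
    using biorthogonal_dual_integrable[OF bi jk(2)] biorthogonal_integrable_power[OF bi jk]
      biorthogonal_degree[OF bi jk(1)] by auto
  have eq: "poly (hermite_transform (p j)) y * Q k y =
      1 / sqrt (2 * pi) * (poly (hermite_transform (p j)) y * ?Q y)" for y
    by (simp add: Qk)
  note h = integral_hermite_transform_heat_convolution[OF q]
  show "integrable lborel (\<lambda>y. poly (hermite_transform (p j)) y * Q k y)"
    unfolding eq by (intro integrable_mult_right h)
  show "(LINT y|lborel. poly (hermite_transform (p j)) y * Q k y) = (if j = k then 1 else 0)"
    unfolding eq integral_mult_right_zero h biorthogonal_integral[OF bi jk] by simp
qed

text \<open>The exponential splits into a factor in s and one in t, and the kernel is a finite sum
  of products, so the iterated integral separates without Fubini. Each of the two integrals
  contributes sqrt(2 pi), and ds contributes i; together they cancel 2 pi i.\<close>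

lemma heat_flow_kernel:
  "1 / (2 * of_real pi * \<i>) *
      imag_axis_integral (\<lambda>s. LINT t|lborel. ensemble_kernel n p q s t *
        exp (1/2 * ((of_real x - s)\<^sup>2 - (of_real y - of_real t)\<^sup>2))) =
    complex_of_real (\<Sum>j<n. poly (hermite_transform (p j)) x * Q j y)"
proof -
  let ?e = "\<lambda>s. exp (1/2 * (of_real x - s)\<^sup>2) :: complex"
  have inner: "(LINT t|lborel. ensemble_kernel n p q s t *
        exp (1/2 * ((of_real x - s)\<^sup>2 - (of_real y - of_real t)\<^sup>2))) =
      (\<Sum>j<n. (cpoly (p j) s * ?e s) * of_real (sqrt (2 * pi) * Q j y))" for s
  proof -
    have "exp (1/2 * ((of_real x - s)\<^sup>2 - (of_real y - of_real t)\<^sup>2)) =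
        ?e s * of_real (exp (- (1/2) * (y - t)\<^sup>2))" for t
      by (simp add: exp_of_real[symmetric] exp_add[symmetric] diff_divide_distrib)
    then have eq: "ensemble_kernel n p q s t * exp (1/2 * ((of_real x - s)\<^sup>2 - (of_real y - of_real t)\<^sup>2)) =
        (\<Sum>j<n. (cpoly (p j) s * ?e s) * of_real (q j t * exp (- (1/2) * (y - t)\<^sup>2)))" for t
      by (simp only: ensemble_kernel_def sum_distrib_right of_real_mult ac_simps)
    have "(LINT t|lborel. (\<Sum>j<n. (cpoly (p j) s * ?e s) * of_real (q j t * exp (- (1/2) * (y - t)\<^sup>2)))) =
        (\<Sum>j<n. LINT t|lborel. (cpoly (p j) s * ?e s) * of_real (q j t * exp (- (1/2) * (y - t)\<^sup>2)))"
      by (intro Bochner_Integration.integral_sum integrable_mult_right integrable_of_real integrable_mult_heat_kernel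
          biorthogonal_dual_integrable[OF bi]) auto
    also have "\<dots> = (\<Sum>j<n. (cpoly (p j) s * ?e s) *
        of_real (LINT t|lborel. q j t * exp (- (1/2) * (y - t)\<^sup>2)))"
      by (simp only: integral_mult_right_zero integral_complex_of_real)
    also have "\<dots> = (\<Sum>j<n. (cpoly (p j) s * ?e s) * of_real (sqrt (2 * pi) * Q j y))"
      by (simp add: Q)
    finally show ?thesis unfolding eq .
  qed
  have "imag_axis_integral (\<lambda>s. \<Sum>j<n. (cpoly (p j) s * ?e s) * of_real (sqrt (2 * pi) * Q j y)) =
      (LINT u|lborel. (\<Sum>j<n. (cpoly (p j) (\<i> * of_real u) * ?e (\<i> * of_real u)) *
        of_real (sqrt (2 * pi) * Q j y))) * \<i>"
    by (simp only: imag_axis_integral_def integral_mult_left_zero)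
  also have "\<dots> = (\<Sum>j<n. of_real (sqrt (2 * pi) * poly (hermite_transform (p j)) x) *
        of_real (sqrt (2 * pi) * Q j y)) * \<i>"
    by (subst Bochner_Integration.integral_sum)
       (simp_all only: integrable_mult_left integrable_cpoly_mult_gaussian integral_mult_left_zero
        integral_cpoly_mult_gaussian)
  also have "\<dots> = 2 * of_real pi * \<i> * complex_of_real (\<Sum>j<n. poly (hermite_transform (p j)) x * Q j y)"
  proof -
    have s: "sqrt (2 * pi) * a * (sqrt (2 * pi) * b) = 2 * pi * (a * b)" for a b :: real
      by (simp add: algebra_simps) 
    show ?thesis
      by (simp only: of_real_mult[symmetric] s of_real_sum[symmetric] sum_distrib_left[symmetric]) simp
  qed
  finally show ?thesis
    unfolding inner by simp
qed

end

section \<open>Correlation functions of a polynomial ensemble\<close>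

lemma vandermonde_Suc: "vandermonde (Suc n) x = vandermonde n x * (\<Prod>j<n. x n - x j)"
  by (simp add: vandermonde_def)

text \<open>As a function of its last point the determinant is a polynomial of degree at most n that
  vanishes at the other n points, so it equals its coefficient at z^n, a smaller determinant of the
  same kind, times the product of the differences.\<close>

lemma mdet_graded_polys:
  assumes "\<And>j. j < n \<Longrightarrow> degree (p j) = j"
  shows "mdet n (\<lambda>i j. poly (p j) (x i)) = (\<Prod>j<n. lead_coeff (p j)) * vandermonde n x"
  using assms
proof (induction n)
  case 0
  then show ?case by (simp add: mdet_leibniz vandermonde_def)
next
  case (Suc n)
  define A where "A z = Matrix.mat (Suc n) (Suc n) (\<lambda>(i, j). poly (p j) (if i = n then z else x i))" for z
  define R where "R = (\<Sum>j<Suc n. smult (cofactor (A 0) n j) (p j))"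
  \<comment> \<open>The variable sits only in row n, which these cofactors delete; the 0 in
    \<open>A 0\<close> is an arbitrary choice.\<close>
  have cof: "cofactor (A z) n j = cofactor (A 0) n j" for z j
    unfolding cofactor_def mat_delete_def A_def
    by (intro arg_cong2[of _ _ _ _ "(*)"] arg_cong[of _ _ Determinant.det] eq_matI refl) auto
  have R: "poly R z = Determinant.det (A z)" for z
  proof -
    have Az: "A z \<in> carrier_mat (Suc n) (Suc n)" by (simp add: A_def)
    have "A z $$ (n, j) = poly (p j) z" if "j < Suc n" for j
      using that by (simp add: A_def)
    then show ?thesis
      unfolding laplace_expansion_row[OF Az lessI] R_def poly_sum cof[of z]
      by (intro sum.cong) (auto simp: mult.commute)
  qed
  have det_A: "Determinant.det (A (x n)) = mdet (Suc n) (\<lambda>i j. poly (p j) (x i))"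
    unfolding A_def mdet_def by (intro arg_cong[of _ _ Determinant.det] eq_matI) auto
  show ?case
  \<comment> \<open>Repeated points would leave too few interpolation nodes; in that case both sides
    vanish.\<close>
  proof (cases "inj_on x {..<n}")
    case False
    then obtain i j where ij: "i < n" "j < n" "i \<noteq> j" "x i = x j" by (auto simp: inj_on_def)
    have "vandermonde n x = 0"
    proof -
      have "\<exists>k<n. \<exists>j<k. x k - x j = 0"
        using ij by (metis diff_self nat_neq_iff)
      then show ?thesis
        unfolding vandermonde_def by (auto simp: prod_zero_iff intro!: bexI)
    qed
    moreover have "mdet (Suc n) (\<lambda>i j. poly (p j) (x i)) = 0"
      using ij by (intro mdet_identical_rows[of i _ j]) auto
    ultimately show ?thesis by (simp add: vandermonde_Suc)
  next
    case True
    define S where "S = smult (coeff R n) (\<Prod>j<n. [:- x j, 1:])"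
    have "R = S"
    \<comment> \<open>With the coefficient at z^n fixed, agreement at n points suffices instead of n
      + 1.\<close>
    proof (rule poly_eqI_degree_lead_coeff[where A = "x ` {..<n}"])
      have dS: "degree (\<Prod>j<n. [:- x j, 1:]) = n"
        by (subst degree_prod_eq_sum_degree) auto
      have "coeff (\<Prod>j<n. [:- x j, 1:]) n = 1"
        using lead_coeff_prod[of "\<lambda>j. [:- x j, 1:]" "{..<n}"] dS by simp
      then show "coeff R n = coeff S n" by (simp add: S_def)
      show "n \<le> card (x ` {..<n})" using True by (simp add: card_image)
      show "degree R \<le> n"
        unfolding R_def using Suc.prems
        by (intro degree_sum_le) (auto intro!: order.trans[OF degree_smult_le])
      show "degree S \<le> n"
        unfolding S_def using dS by (metis degree_smult_le)
      fix z assume "z \<in> x ` {..<n}"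
      then obtain i where i: "i < n" "z = x i" by auto
      have "poly R z = 0"
        unfolding R A_def using i
        by (intro det_identical_rows[OF mat_carrier, of i n]) (auto intro!: eq_vecI)
      moreover have "poly S z = 0"
        using i by (auto simp: S_def poly_prod prod_zero_iff)
      ultimately show "poly R z = poly S z" by simp
    qed
    moreover have "coeff R n = lead_coeff (p n) * mdet n (\<lambda>i j. poly (p j) (x i))"
    proof -
      have "cofactor (A 0) n n = mdet n (\<lambda>i j. poly (p j) (x i))"
        unfolding cofactor_def mat_delete_def A_def mdet_def
        by (simp, intro arg_cong[of _ _ Determinant.det] eq_matI) auto
      moreover have "coeff (p j) n = 0" if "j < n" for j
        using Suc.prems[of j] that by (intro coeff_eq_0) auto
      ultimately show ?thesis
        using Suc.prems[of n] by (simp add: R_def coeff_sum)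
    qed
    ultimately have "Determinant.det (A (x n)) =
        lead_coeff (p n) * mdet n (\<lambda>i j. poly (p j) (x i)) * (\<Prod>j<n. x n - x j)"
      using R[of "x n"] by (simp add: S_def poly_prod)
    then show ?thesis
      using Suc by (simp add: det_A vandermonde_Suc)
  qed
qed

section \<open>Integrating out particles one at a time\<close>

interpretation lborel_product: product_sigma_finite "\<lambda>_. lborel :: real measure" by standard

text \<open>A permutation of the larger set is determined by the image b of \<open>a\<close> and a
  permutation of S: composing with the transposition of \<open>a\<close> and b makes
  \<open>a\<close> a fixed point.\<close>

lemma sum_over_permutations_insert:
  fixes g :: "(nat \<Rightarrow> nat) \<Rightarrow> 'b::comm_monoid_add"
  assumes "finite S" "a \<notin> S"
  shows "(\<Sum>\<sigma> | \<sigma> permutes insert a S. g \<sigma>) =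
    (\<Sum>b\<in>insert a S. \<Sum>\<tau> | \<tau> permutes S. g (Transposition.transpose a b \<circ> \<tau>))"
proof -
  have inj: "inj_on (\<lambda>(b, \<tau>). Transposition.transpose a b \<circ> \<tau>) (insert a S \<times> {\<tau>. \<tau> permutes S})"
  proof (rule inj_onI, clarify)
    fix b \<tau> b' \<tau>'
    assume h: "\<tau> permutes S" "\<tau>' permutes S" "Transposition.transpose a b \<circ> \<tau> = Transposition.transpose a b' \<circ> \<tau>'"
    have "\<tau> a = a" "\<tau>' a = a"
      using h(1,2) assms(2) by (auto simp: permutes_not_in)
    then have "b = b'" using fun_cong[OF h(3), of a] by simp
    moreover have "\<tau> = \<tau>'"
    proof -
      have "Transposition.transpose a b \<circ> (Transposition.transpose a b \<circ> \<tau>) = Transposition.transpose a b \<circ> (Transposition.transpose a b \<circ> \<tau>')"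
        using h(3) \<open>b = b'\<close> by simp
      then show ?thesis by (simp add: o_assoc[symmetric] fun_eq_iff)
    qed
    ultimately show "b = b' \<and> \<tau> = \<tau>'" by simp
  qed
  have "(\<Sum>\<sigma> | \<sigma> permutes insert a S. g \<sigma>) =
      (\<Sum>\<sigma>\<in>(\<lambda>(b, \<tau>). Transposition.transpose a b \<circ> \<tau>) ` (insert a S \<times> {\<tau>. \<tau> permutes S}). g \<sigma>)"
    unfolding permutes_insert by (intro sum.cong) auto
  also have "\<dots> = (\<Sum>(b, \<tau>)\<in>insert a S \<times> {\<tau>. \<tau> permutes S}. g (Transposition.transpose a b \<circ> \<tau>))"
    by (subst sum.reindex[OF inj]) (auto intro!: sum.cong)
  finally show ?thesis
    by (simp add: sum.cartesian_product)
qed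

lemma prod_replace_one_factor:
  fixes u :: "nat \<Rightarrow> 'a::comm_monoid_mult"
  assumes "finite A" "a \<in> A"
  shows "(\<Prod>i\<in>A. if i = a then c else u i) = c * (\<Prod>i\<in>A - {a}. u i)"
  using assms by (subst prod.remove[of A a]) (auto intro!: prod.cong arg_cong2[of _ _ _ _ "(*)"])

context
  fixes n :: nat and F Q :: "nat \<Rightarrow> real \<Rightarrow> real" and P :: "nat \<Rightarrow> real poly"
  assumes bi: "biorthogonal_system n F P Q"
begin

definition real_kernel :: "real \<Rightarrow> real \<Rightarrow> real" where
  "real_kernel x y = (\<Sum>l<n. poly (P l) x * Q l y)"

definition kernel_det :: "nat \<Rightarrow> (nat \<Rightarrow> real) \<Rightarrow> real" where
  "kernel_det m x = mdet m (\<lambda>i j. real_kernel (x i) (x j))"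

lemma integrable_kernel_diagonal: "integrable lborel (\<lambda>y. real_kernel y y)"
  unfolding real_kernel_def
  by (auto intro!: Bochner_Integration.integrable_sum biorthogonal_integrable[OF bi])

lemma integral_kernel_diagonal: "(LINT y|lborel. real_kernel y y) = real n"
  unfolding real_kernel_def
  by (subst Bochner_Integration.integral_sum)
     (auto simp: biorthogonal_integrable[OF bi] biorthogonal_integral[OF bi])

lemma kernel_convolution:
  "real_kernel a y * real_kernel y b =
    (\<Sum>l<n. \<Sum>k<n. (poly (P l) a * Q k b) * (poly (P k) y * Q l y))"
  unfolding real_kernel_def sum_product by (intro sum.cong refl) (simp add: ac_simps)

lemma integrable_kernel_convolution: "integrable lborel (\<lambda>y. real_kernel a y * real_kernel y b)"
  unfolding kernel_convolution
  by (auto intro!: Bochner_Integration.integrable_sum integrable_mult_right biorthogonal_integrable[OF bi])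

text \<open>Reproducing property: the kernel is that of a projection, in general an oblique one,
  whose trace n was computed above.\<close>

lemma integral_kernel_convolution:
  "(LINT y|lborel. real_kernel a y * real_kernel y b) = real_kernel a b"
proof -
  have "(LINT y|lborel. real_kernel a y * real_kernel y b) =
      (\<Sum>l<n. \<Sum>k<n. (poly (P l) a * Q k b) * (if k = l then 1 else 0))"
  proof -
    have int: "integrable lborel (\<lambda>y. (poly (P l) a * Q k b) * (poly (P k) y * Q l y))"
      if "l < n" "k < n" for l k
      using that by (intro integrable_mult_right biorthogonal_integrable[OF bi])
    have "(LINT y|lborel. real_kernel a y * real_kernel y b) =
        (\<Sum>l<n. LINT y|lborel. (\<Sum>k<n. (poly (P l) a * Q k b) * (poly (P k) y * Q l y)))"
      unfolding kernel_convolution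
      by (intro Bochner_Integration.integral_sum Bochner_Integration.integrable_sum int) auto
    also have "\<dots> = (\<Sum>l<n. \<Sum>k<n. LINT y|lborel. (poly (P l) a * Q k b) * (poly (P k) y * Q l y))"
      by (intro sum.cong refl Bochner_Integration.integral_sum int) auto
    also have "\<dots> = (\<Sum>l<n. \<Sum>k<n. (poly (P l) a * Q k b) * (if k = l then 1 else 0))"
      by (intro sum.cong refl) (simp only: integral_mult_right_zero biorthogonal_integral[OF bi] lessThan_iff)
    finally show ?thesis .
  qed
  then show ?thesis
    by (simp add: real_kernel_def if_distrib sum.delta cong: if_cong)
qed

text \<open>In the Leibniz sum the new point either is a fixed point, and the trace gives the factor
  n, or is inserted into a permutation of the others just before some b. In the latter case the
  reproducing property contracts it away, the sign flips, and the m choices of b give -m.\<close>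

lemma integral_kernel_det_last:
  "(LINT y|lborel. kernel_det (Suc m) (x(m := y))) = (real n - real m) * kernel_det m x"
proof -
  let ?k = real_kernel
  define T where "T b \<tau> y = (of_int (sign (Transposition.transpose m b \<circ> \<tau>)) :: real) *
      (\<Prod>i<Suc m. ?k ((x(m := y)) i) ((x(m := y)) ((Transposition.transpose m b \<circ> \<tau>) i)))" for b \<tau> y
  have expand: "kernel_det (Suc m) (x(m := y)) =
      (\<Sum>b\<in>insert m {..<m}. \<Sum>\<tau> | \<tau> permutes {..<m}. T b \<tau> y)" for y
    unfolding kernel_det_def mdet_leibniz T_def
    by (simp only: lessThan_Suc sum_over_permutations_insert[OF finite_lessThan] lessThan_iff
        less_irrefl not_False_eq_True)
  have T1: "T m \<tau> y = of_int (sign \<tau>) * (\<Prod>i<m. ?k (x i) (x (\<tau> i))) * ?k y y"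
    if \<tau>: "\<tau> permutes {..<m}" for \<tau> y
  proof -
    have "\<tau> m = m" "\<And>i. i < m \<Longrightarrow> \<tau> i < m"
      using \<tau> by (auto simp: permutes_not_in permutes_in_image[OF \<tau>, simplified])
    then have "(\<Prod>i<m. ?k ((x(m := y)) i) ((x(m := y)) (\<tau> i))) = (\<Prod>i<m. ?k (x i) (x (\<tau> i)))"
      by (intro prod.cong) (auto simp: less_imp_neq)
    with \<open>\<tau> m = m\<close> show ?thesis
      by (simp add: T_def)
  qed
  have T2: "\<exists>a<m. \<tau> a = b \<and> (\<forall>y. T b \<tau> y = - of_int (sign \<tau>) *
      (\<Prod>i\<in>{..<m} - {a}. ?k (x i) (x (\<tau> i))) * (?k (x a) y * ?k y (x b)))"
    if \<tau>: "\<tau> permutes {..<m}" and b: "b < m" for \<tau> b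
  proof -
    \<comment> \<open>The predecessor of b: the composed permutation runs through a, m, b in this
      order, so y occurs exactly in the factors K(x_a, y) and K(y, x_b).\<close>
    define a where "a = Hilbert_Choice.inv \<tau> b"
    have a: "\<tau> a = b" using permutes_inverses(1)[OF \<tau>] by (simp add: a_def)
    have am: "a < m"
      using permutes_in_image[OF \<tau>, of a] a b by simp
    have \<tau>m: "\<tau> m = m" using \<tau> by (simp add: permutes_not_in)
    have \<tau>i: "\<tau> i < m" if "i < m" for i
      using permutes_in_image[OF \<tau>, of i] that by simp
    have sgn: "sign (Transposition.transpose m b \<circ> \<tau>) = - sign \<tau>"
      using b \<tau> by (subst sign_compose) (auto simp: sign_swap_id permutation_swap_id permutes_imp_permutation[OF finite_lessThan])
    have "(\<Prod>i<m. ?k ((x(m := y)) i) ((x(m := y)) ((Transposition.transpose m b \<circ> \<tau>) i))) =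
        (\<Prod>i<m. if i = a then ?k (x a) y else ?k (x i) (x (\<tau> i)))" for y
    proof (intro prod.cong refl)
      fix i assume i: "i \<in> {..<m}"
      show "?k ((x(m := y)) i) ((x(m := y)) ((Transposition.transpose m b \<circ> \<tau>) i)) =
          (if i = a then ?k (x a) y else ?k (x i) (x (\<tau> i)))"
      proof (cases "i = a")
        case True
        then show ?thesis using i a by simp
      next
        case False
        then have "\<tau> i \<noteq> b" using a permutes_inj[OF \<tau>] by (auto dest: injD)
        moreover have "\<tau> i \<noteq> m" using \<tau>i[of i] i by auto
        ultimately show ?thesis using False i by (simp add: transpose_apply_other)
      qed
    qed
    then have "T b \<tau> y = - of_int (sign \<tau>) *
        (\<Prod>i\<in>{..<m} - {a}. ?k (x i) (x (\<tau> i))) * (?k (x a) y * ?k y (x b))" for y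
      using am b \<tau>m by (simp add: T_def sgn prod_replace_one_factor)
    then show ?thesis using a am by blast
  qed
  have int1: "integrable lborel (T m \<tau>)" "integral\<^sup>L lborel (T m \<tau>) =
      real n * (of_int (sign \<tau>) * (\<Prod>i<m. ?k (x i) (x (\<tau> i))))" if "\<tau> permutes {..<m}" for \<tau>
  proof -
    have "T m \<tau> = (\<lambda>y. of_int (sign \<tau>) * (\<Prod>i<m. ?k (x i) (x (\<tau> i))) * ?k y y)"
      using T1[OF that] by (rule ext)
    then show "integrable lborel (T m \<tau>)" "integral\<^sup>L lborel (T m \<tau>) =
        real n * (of_int (sign \<tau>) * (\<Prod>i<m. ?k (x i) (x (\<tau> i))))"
      by (simp_all add: integrable_kernel_diagonal integral_kernel_diagonal)
  qed
  have int2: "integrable lborel (T b \<tau>) \<and> integral\<^sup>L lborel (T b \<tau>) =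
      - (of_int (sign \<tau>) * (\<Prod>i<m. ?k (x i) (x (\<tau> i))))" if \<tau>: "\<tau> permutes {..<m}" and "b < m" for \<tau> b
  proof -
    from T2[OF that] obtain a where a: "a < m" "\<tau> a = b" and Tb: "\<And>y. T b \<tau> y = - of_int (sign \<tau>) *
      (\<Prod>i\<in>{..<m} - {a}. ?k (x i) (x (\<tau> i))) * (?k (x a) y * ?k y (x b))" by blast
    have "(\<Prod>i<m. ?k (x i) (x (\<tau> i))) = ?k (x a) (x b) * (\<Prod>i\<in>{..<m} - {a}. ?k (x i) (x (\<tau> i)))"
      using a by (subst prod.remove[of _ a]) auto
    moreover have "T b \<tau> = (\<lambda>y. - of_int (sign \<tau>) *
      (\<Prod>i\<in>{..<m} - {a}. ?k (x i) (x (\<tau> i))) * (?k (x a) y * ?k y (x b)))"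
      using Tb by auto
    ultimately show ?thesis
      by (simp add: integrable_kernel_convolution integral_kernel_convolution del: mult_minus_left)
  qed
  have "(LINT y|lborel. kernel_det (Suc m) (x(m := y))) =
      (\<Sum>b\<in>insert m {..<m}. \<Sum>\<tau> | \<tau> permutes {..<m}. integral\<^sup>L lborel (T b \<tau>))"
    unfolding expand
    by (subst Bochner_Integration.integral_sum, rule Bochner_Integration.integrable_sum)
       (auto simp: int1 int2 intro!: sum.cong)
  also have "\<dots> = (\<Sum>\<tau> | \<tau> permutes {..<m}. real n * (of_int (sign \<tau>) * (\<Prod>i<m. ?k (x i) (x (\<tau> i))))) +
      (\<Sum>b<m. \<Sum>\<tau> | \<tau> permutes {..<m}. - (of_int (sign \<tau>) * (\<Prod>i<m. ?k (x i) (x (\<tau> i)))))"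
    by (simp add: int1 int2)
  also have "\<dots> = real n * kernel_det m x - real m * kernel_det m x"
    by (simp add: kernel_det_def mdet_leibniz sum_distrib_left sum_negf)
  finally show ?thesis by (simp add: left_diff_distrib)
qed

text \<open>Multiplying out the kernels and moving the permutation from the arguments of the Q to
  their indices leaves a finite sum of products of one-variable functions, each an integrable P_j
  Q_k.\<close>

lemma integrable_kernel_det: "integrable (lborel_pow m) (kernel_det m)"
proof -
  have "kernel_det m x = (\<Sum>\<sigma> | \<sigma> permutes {..<m}. of_int (sign \<sigma>) *
      (\<Sum>g\<in>PiE {..<m} (\<lambda>_. {..<n}). \<Prod>i<m. poly (P (g i)) (x i) * Q (g (Hilbert_Choice.inv \<sigma> i)) (x i)))" for x
    unfolding kernel_det_def mdet_leibniz real_kernel_def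
  proof (intro sum.cong refl arg_cong2[of _ _ _ _ "(*)"])
    fix \<sigma> :: "nat \<Rightarrow> nat" assume "\<sigma> \<in> {\<sigma>. \<sigma> permutes {..<m}}"
    then have \<sigma>: "\<sigma> permutes {..<m}" by simp
    have "(\<Prod>i<m. \<Sum>l<n. poly (P l) (x i) * Q l (x (\<sigma> i))) =
        (\<Sum>g\<in>PiE {..<m} (\<lambda>_. {..<n}). \<Prod>i<m. poly (P (g i)) (x i) * Q (g i) (x (\<sigma> i)))"
      by (rule prod_sum_PiE) auto
    also have "\<dots> = (\<Sum>g\<in>PiE {..<m} (\<lambda>_. {..<n}).
        \<Prod>i<m. poly (P (g i)) (x i) * Q (g (Hilbert_Choice.inv \<sigma> i)) (x i))"
    proof (intro sum.cong refl)
      fix g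
      have "(\<Prod>i<m. Q (g i) (x (\<sigma> i))) = (\<Prod>i<m. Q (g (Hilbert_Choice.inv \<sigma> i)) (x i))"
        by (subst prod.permute[OF \<sigma>]) (simp add: permutes_inverses[OF \<sigma>])
      then show "(\<Prod>i<m. poly (P (g i)) (x i) * Q (g i) (x (\<sigma> i))) =
          (\<Prod>i<m. poly (P (g i)) (x i) * Q (g (Hilbert_Choice.inv \<sigma> i)) (x i))"
        by (simp add: prod.distrib)
    qed
    finally show "(\<Prod>i<m. \<Sum>l<n. poly (P l) (x i) * Q l (x (\<sigma> i))) = \<dots>" .
  qed
  then have "kernel_det m = (\<lambda>x. \<Sum>\<sigma> | \<sigma> permutes {..<m}. of_int (sign \<sigma>) *
      (\<Sum>g\<in>PiE {..<m} (\<lambda>_. {..<n}). \<Prod>i<m. poly (P (g i)) (x i) * Q (g (Hilbert_Choice.inv \<sigma> i)) (x i)))"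
    by (rule ext)
  moreover have "integrable (lborel_pow m)
      (\<lambda>x. \<Prod>i<m. poly (P (g i)) (x i) * Q (g (Hilbert_Choice.inv \<sigma> i)) (x i))"
    if "\<sigma> permutes {..<m}" "g \<in> PiE {..<m} (\<lambda>_. {..<n})" for \<sigma> g
  proof (rule lborel_product.product_integrable_prod)
    fix i assume "i \<in> {..<m}"
    then have "g i < n" "g (Hilbert_Choice.inv \<sigma> i) < n"
      using that permutes_in_image[OF permutes_inv[OF that(1)], of i] by (auto simp: PiE_iff)
    then show "integrable lborel (\<lambda>y. poly (P (g i)) y * Q (g (Hilbert_Choice.inv \<sigma> i)) y)"
      by (rule biorthogonal_integrable[OF bi])
  qed simp
  ultimately show ?thesis
    by (auto intro!: Bochner_Integration.integrable_sum integrable_mult_right)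
qed

text \<open>Integrating out the particle with index k, for k from n - 1 down to m, gives the factor
  n - k each time, in total (n - m)!. The set B constrains only the first m coordinates and is
  untouched.\<close>

lemma integral_kernel_det_marginal:
  assumes "m \<le> n" and B: "B \<in> sets (lborel_pow m)"
  shows "(LINT x|lborel_pow n. indicator B (restrict x {..<m}) * kernel_det n x) =
    fact (n - m) * (LINT x|lborel_pow m. indicator B x * kernel_det m x)"
proof -
  define J where "J k = (LINT x|lborel_pow k. indicator B (restrict x {..<m}) * kernel_det k x)" for k
  have step: "J (Suc k) = (real n - real k) * J k" if "m \<le> k" for k
  proof -
    have meas: "(\<lambda>x. restrict x {..<m}) \<in> lborel_pow (Suc k) \<rightarrow>\<^sub>M lborel_pow m"
      using that by (intro measurable_restrict_subset) auto
    have ind: "(\<lambda>x. indicator B (restrict x {..<m}) :: real) \<in> borel_measurable (lborel_pow (Suc k))"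
      using measurable_compose[OF meas borel_measurable_indicator[OF B]] .
    have "integrable (lborel_pow (Suc k)) (\<lambda>x. indicator B (restrict x {..<m}) * kernel_det (Suc k) x)"
      by (rule Bochner_Integration.integrable_bound[OF integrable_kernel_det[of "Suc k"]])
         (use ind integrable_kernel_det[of "Suc k"] in \<open>auto simp: indicator_def\<close>)
    then have "J (Suc k) = (LINT x|lborel_pow k. LINT y|lborel.
        indicator B (restrict (x(k := y)) {..<m}) * kernel_det (Suc k) (x(k := y)))"
      unfolding J_def lessThan_Suc by (intro lborel_product.product_integral_insert) auto
    also have "\<dots> = (LINT x|lborel_pow k. (real n - real k) * (indicator B (restrict x {..<m}) * kernel_det k x))"
    proof (intro Bochner_Integration.integral_cong refl)
      fix x :: "nat \<Rightarrow> real"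
      have "restrict (x(k := y)) {..<m} = restrict x {..<m}" for y
        using that by (auto simp: restrict_def fun_eq_iff)
      then show "(LINT y|lborel. indicator B (restrict (x(k := y)) {..<m}) * kernel_det (Suc k) (x(k := y))) =
          (real n - real k) * (indicator B (restrict x {..<m}) * kernel_det k x)"
        by (simp add: integral_kernel_det_last)
    qed
    finally show ?thesis by (simp add: J_def)
  qed
  \<comment> \<open>A form without division that can be induced upwards in the number of particles;
    d = n - m is the claim.\<close>
  have "J (m + d) * fact (n - (m + d)) = fact (n - m) * J m" if "m + d \<le> n" for d
    using that
  proof (induction d)
    case (Suc d)
    have "fact (n - (m + d)) = (real n - real (m + d)) * (fact (n - (m + Suc d)) :: real)"
      using Suc.prems by (subst fact_reduce) (auto simp: of_nat_diff)
    then show ?case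
      using Suc step[of "m + d"] by (simp add: ac_simps)
  qed simp
  from this[of "n - m"] have "J n = fact (n - m) * J m" using assms(1) by simp
  moreover have "J m = (LINT x|lborel_pow m. indicator B x * kernel_det m x)"
    unfolding J_def by (intro Bochner_Integration.integral_cong refl) (auto simp: space_PiM PiE_restrict)
  ultimately show ?thesis by (simp add: J_def)
qed

lemma integral_kernel_det: "(LINT x|lborel_pow n. kernel_det n x) = fact n"
proof -
  \<comment> \<open>The case m = 0, where the empty determinant is 1 and the remaining space is a
    single point.\<close>
  have "(LINT x|lborel_pow n. indicator (space (lborel_pow 0)) (restrict x {..<0}) * kernel_det n x) = fact n"
    by (subst integral_kernel_det_marginal)
       (auto simp: kernel_det_def mdet_leibniz PiM_empty lebesgue_integral_count_space_finite)
  moreover have "restrict x {} = (\<lambda>_. undefined)" for x :: "nat \<Rightarrow> real"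
    by (simp add: restrict_def)
  ultimately show ?thesis by (simp add: space_PiM)
qed

lemma kernel_det_permute: "\<sigma> permutes {..<n} \<Longrightarrow> kernel_det n (x \<circ> \<sigma>) = kernel_det n x"
  unfolding kernel_det_def o_def by (rule mdet_permute_both)

text \<open>Up to constants, the Vandermonde factor is det[P_l(x_i)] and the weight determinant is
  det[Q_l(x_j)], by a change of basis; the product of the two is the determinant of the
  kernel.\<close>

lemma ensemble_density_proportional:
  "\<exists>c. \<forall>x. ensemble_density n F Z x = c * kernel_det n x"
proof -
  obtain d where d: "\<And>k x. k < n \<Longrightarrow> F k x = (\<Sum>j<n. d k j * Q j x)"
    using biorthogonal_dual_spans[OF bi] by blast
  have "ensemble_density n F Z x =
      1 / Z * (1 / (\<Prod>j<n. lead_coeff (P j))) * mdet n (\<lambda>l k. d k l) * kernel_det n x" for x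
  proof -
    have "(\<Prod>j<n. lead_coeff (P j)) \<noteq> 0"
      using biorthogonal_nonzero[OF bi] by simp
    then have v: "vandermonde n x = 1 / (\<Prod>j<n. lead_coeff (P j)) * mdet n (\<lambda>i l. poly (P l) (x i))"
      using mdet_graded_polys[of n P x] biorthogonal_degree[OF bi] by simp
    have "Determinant.det (Matrix.mat n n (\<lambda>(j, k). F k (x j))) = mdet n (\<lambda>j k. F k (x j))"
      by (simp add: mdet_def)
    also have "\<dots> = mdet n (\<lambda>j k. \<Sum>l<n. Q l (x j) * d k l)"
      by (intro mdet_cong) (simp add: d mult.commute)
    also have "\<dots> = mdet n (\<lambda>l j. Q l (x j)) * mdet n (\<lambda>l k. d k l)"
      unfolding mdet_mult using mdet_transpose[of n "\<lambda>l j. Q l (x j)"] by simp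
    finally show ?thesis
      unfolding ensemble_density_def v kernel_det_def real_kernel_def mdet_mult by simp
  qed
  then show ?thesis by blast
qed

text \<open>Both sides have a known total mass, which fixes the constant without evaluating
  Z.\<close>

lemma ensemble_density_eq_kernel_det:
  assumes "polynomial_ensemble n F Z"
  shows "ensemble_density n F Z x = kernel_det n x / fact n"
proof -
  obtain c where c: "\<And>x. ensemble_density n F Z x = c * kernel_det n x"
    using ensemble_density_proportional by blast
  have "1 = (LINT x|lborel_pow n. ensemble_density n F Z x)"
    using assms by (simp add: polynomial_ensemble_def)
  also have "\<dots> = c * fact n"
    by (simp add: c integral_kernel_det)
  finally have "c = 1 / fact n" by (simp add: field_simps)
  then show ?thesis by (simp add: c)
qed

end

section \<open>Relabelling particles\<close>

lemma card_injective_tuples: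
  assumes "m \<le> n"
  shows "real (card {\<iota> \<in> {..<m} \<rightarrow>\<^sub>E {..<n}. inj_on \<iota> {..<m}}) = fact n / fact (n - m)"
proof -
  let ?L = "{xs. length xs = m \<and> distinct xs \<and> set xs \<subseteq> {..<n}}"
  have "bij_betw (\<lambda>\<iota>. map \<iota> [0..<m]) {\<iota> \<in> {..<m} \<rightarrow>\<^sub>E {..<n}. inj_on \<iota> {..<m}} ?L"
  proof (rule bij_betw_byWitness[where f' = "\<lambda>xs. \<lambda>l\<in>{..<m}. xs ! l"])
    show "\<forall>xs\<in>?L. map (\<lambda>l\<in>{..<m}. xs ! l) [0..<m] = xs"
      by (auto intro!: nth_equalityI)
    show "(\<lambda>\<iota>. map \<iota> [0..<m]) ` {\<iota> \<in> {..<m} \<rightarrow>\<^sub>E {..<n}. inj_on \<iota> {..<m}} \<subseteq> ?L"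
      by (auto simp: distinct_map atLeast0LessThan PiE_iff)
    show "(\<lambda>xs. \<lambda>l\<in>{..<m}. xs ! l) ` ?L \<subseteq> {\<iota> \<in> {..<m} \<rightarrow>\<^sub>E {..<n}. inj_on \<iota> {..<m}}"
    proof (rule image_subsetI)
      fix xs assume xs: "xs \<in> ?L"
      then have "xs ! l < n" if "l < m" for l
      proof -
        have "xs ! l \<in> set xs" using xs that by (intro nth_mem) auto
        then show ?thesis using xs by auto
      qed
      moreover have "inj_on (\<lambda>l\<in>{..<m}. xs ! l) {..<m}"
        using xs by (auto simp: inj_on_def nth_eq_iff_index_eq)
      ultimately show "(\<lambda>l\<in>{..<m}. xs ! l) \<in> {\<iota> \<in> {..<m} \<rightarrow>\<^sub>E {..<n}. inj_on \<iota> {..<m}}"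
        by auto
    qed
  qed (auto simp: PiE_iff extensional_def fun_eq_iff restrict_def)
  then have "card {\<iota> \<in> {..<m} \<rightarrow>\<^sub>E {..<n}. inj_on \<iota> {..<m}} = card ?L"
    by (rule bij_betw_same_card)
  also have "\<dots> = \<Prod>{n - m + 1..n}"
    using card_lists_distinct_length_eq[of "{..<n}" m] assms by simp
  also have "\<dots> = fact n div fact (n - m)"
    using fact_div_fact[of "n - m" n] by simp
  finally show ?thesis
    by (simp add: real_of_nat_div fact_dvd)
qed

lemma injective_tuple_extends_to_permutation:
  fixes \<iota> :: "nat \<Rightarrow> nat"
  assumes "\<iota> \<in> {..<m} \<rightarrow>\<^sub>E {..<n}" "inj_on \<iota> {..<m}"
  obtains \<sigma> where "\<sigma> permutes {..<n}" "\<And>l. l < m \<Longrightarrow> \<sigma> l = \<iota> l"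
proof -
  have sub: "\<iota> ` {..<m} \<subseteq> {..<n}" using assms(1) by auto
  have mn: "m \<le> n" using card_inj_on_le[OF assms(2) sub] by simp
  have "card ({..<n} - {..<m}) = card ({..<n} - \<iota> ` {..<m})"
    using mn sub by (simp add: card_Diff_subset card_image[OF assms(2)])
  then obtain h where h: "bij_betw h ({..<n} - {..<m}) ({..<n} - \<iota> ` {..<m})"
    by (metis finite_Diff finite_lessThan finite_same_card_bij)
  have "bij_betw \<iota> {..<m} (\<iota> ` {..<m})" using assms(2) by (rule inj_on_imp_bij_betw)
  from bij_betw_disjoint_Un[OF this h]
  have b: "bij_betw (\<lambda>x. if x \<in> {..<m} then \<iota> x else h x) ({..<m} \<union> ({..<n} - {..<m}))
      (\<iota> ` {..<m} \<union> ({..<n} - \<iota> ` {..<m}))" by blast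
  define \<sigma> where "\<sigma> x = (if x \<in> {..<n} then if x \<in> {..<m} then \<iota> x else h x else x)" for x
  have "bij_betw \<sigma> {..<n} {..<n}"
  proof -
    have "{..<m} \<union> ({..<n} - {..<m}) = {..<n}" "\<iota> ` {..<m} \<union> ({..<n} - \<iota> ` {..<m}) = {..<n}"
      using mn sub by auto
    then show ?thesis
      using b bij_betw_cong[of "{..<n}" \<sigma> "\<lambda>x. if x \<in> {..<m} then \<iota> x else h x"] by (simp add: \<sigma>_def)
  qed
  then have "\<sigma> permutes {..<n}"
    by (rule bij_imp_permutes) (simp add: \<sigma>_def)
  moreover have "\<sigma> l = \<iota> l" if "l < m" for l using that mn by (simp add: \<sigma>_def)
  ultimately show thesis using that by blast
qed

lemma comp_permutation_in_space:
  assumes "\<sigma> permutes {..<n}" "x \<in> space (lborel_pow n)"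
  shows "x \<circ> \<sigma> \<in> space (lborel_pow n)"
  using assms by (auto simp: space_PiM PiE_iff extensional_def permutes_not_in)

lemma measurable_comp_permutation:
  assumes "\<sigma> permutes {..<n}"
  shows "(\<lambda>x. x \<circ> \<sigma>) \<in> lborel_pow n \<rightarrow>\<^sub>M lborel_pow n"
proof (rule measurable_PiM_single')
  fix i assume "i \<in> {..<n}"
  then have "\<sigma> i \<in> {..<n}" using permutes_in_image[OF assms] by blast
  then show "(\<lambda>x. (x \<circ> \<sigma>) i) \<in> lborel_pow n \<rightarrow>\<^sub>M lborel"
    unfolding o_def by (rule measurable_component_singleton)
next
  show "(\<lambda>x. x \<circ> \<sigma>) \<in> space (lborel_pow n) \<rightarrow> {..<n} \<rightarrow>\<^sub>E space lborel"
    using comp_permutation_in_space[OF assms] by (auto simp: space_PiM)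
qed

lemma distr_comp_permutation:
  assumes \<sigma>: "\<sigma> permutes {..<n}"
  shows "distr (lborel_pow n) (lborel_pow n) (\<lambda>x. x \<circ> \<sigma>) = lborel_pow n"
proof (rule lborel_product.PiM_eqI)
  fix A :: "nat \<Rightarrow> real set" assume A: "\<And>i. i \<in> {..<n} \<Longrightarrow> A i \<in> sets lborel"
  let ?i = "Hilbert_Choice.inv \<sigma>"
  have i: "?i i < n \<longleftrightarrow> i < n" for i
    using permutes_in_image[OF permutes_inv[OF \<sigma>], of i] by simp
  have s: "\<sigma> i < n \<longleftrightarrow> i < n" for i
    using permutes_in_image[OF \<sigma>, of i] by simp
  have "(\<lambda>x. x \<circ> \<sigma>) -` Pi\<^sub>E {..<n} A \<inter> space (lborel_pow n) = Pi\<^sub>E {..<n} (\<lambda>i. A (?i i))"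
  proof (intro equalityI subsetI)
    fix x assume x: "x \<in> (\<lambda>x. x \<circ> \<sigma>) -` Pi\<^sub>E {..<n} A \<inter> space (lborel_pow n)"
    have "x i \<in> A (?i i)" if "i < n" for i
    proof -
      have "x (\<sigma> (?i i)) \<in> A (?i i)" using x that i[of i] by (auto simp: PiE_iff)
      then show ?thesis by (simp add: permutes_inverses[OF \<sigma>])
    qed
    then show "x \<in> Pi\<^sub>E {..<n} (\<lambda>i. A (?i i))" using x by (auto simp: space_PiM PiE_iff)
  next
    fix x assume x: "x \<in> Pi\<^sub>E {..<n} (\<lambda>i. A (?i i))"
    have "x (\<sigma> i) \<in> A i" if "i < n" for i
    proof -
      have "x (\<sigma> i) \<in> A (?i (\<sigma> i))" using x that s[of i] by (auto simp: PiE_iff)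
      then show ?thesis by (simp add: permutes_inverses[OF \<sigma>])
    qed
    moreover have "x \<in> space (lborel_pow n)" using x by (auto simp: space_PiM PiE_iff)
    moreover have "x \<circ> \<sigma> \<in> extensional {..<n}"
      using comp_permutation_in_space[OF \<sigma> \<open>x \<in> space (lborel_pow n)\<close>] by (simp add: space_PiM PiE_iff)
    ultimately show "x \<in> (\<lambda>x. x \<circ> \<sigma>) -` Pi\<^sub>E {..<n} A \<inter> space (lborel_pow n)" by (auto simp: PiE_iff)
  qed
  then have "emeasure (distr (lborel_pow n) (lborel_pow n) (\<lambda>x. x \<circ> \<sigma>)) (Pi\<^sub>E {..<n} A) =
      emeasure (lborel_pow n) (Pi\<^sub>E {..<n} (\<lambda>i. A (?i i)))"
    using A by (subst emeasure_distr[OF measurable_comp_permutation[OF \<sigma>]]) (auto intro!: sets_PiM_I_finite)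
  also have "\<dots> = (\<Prod>i<n. emeasure lborel (A (?i i)))"
    using A i by (intro lborel_product.emeasure_PiM) auto
  also have "\<dots> = (\<Prod>i<n. emeasure lborel (A i))"
    using prod.permute[OF permutes_inv[OF \<sigma>], of "\<lambda>i. emeasure lborel (A i)"] by (simp add: o_def)
  finally show "emeasure (distr (lborel_pow n) (lborel_pow n) (\<lambda>x. x \<circ> \<sigma>)) (Pi\<^sub>E {..<n} A) =
      (\<Prod>i<n. emeasure lborel (A i))" .
qed simp_all

lemma integral_comp_permutation:
  fixes h :: "(nat \<Rightarrow> real) \<Rightarrow> real"
  assumes \<sigma>: "\<sigma> permutes {..<n}" and [measurable]: "h \<in> borel_measurable (lborel_pow n)"
  shows "(LINT x|lborel_pow n. h (x \<circ> \<sigma>)) = (LINT x|lborel_pow n. h x)"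
  using integral_distr[OF measurable_comp_permutation[OF \<sigma>], of h] distr_comp_permutation[OF \<sigma>]
  by simp

section \<open>From the law of unlabelled eigenvalues to expectations\<close>

lemma eigs_in_space: "eigs n A \<in> space (lborel_pow n)"
  by (simp add: eigs_def space_PiM)

context
  fixes N :: "'w measure" and n :: nat and X :: "'w \<Rightarrow> complex mat" and \<rho> :: "(nat \<Rightarrow> real) \<Rightarrow> real"
  assumes N: "prob_space N" and law: "eigenvalues_have_density N n X \<rho>"
    and \<rho>: "integrable (lborel_pow n) \<rho>" "integral\<^sup>L (lborel_pow n) \<rho> = 1"
begin

text \<open>\<open>measure\<close> vanishes outside the \<open>\<sigma>\<close>-algebra, and an event and its complement cannot both be
  assigned the value 0; so the law alone makes every such event measurable.\<close>

lemma symmetric_eigenvalue_event: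
  assumes B: "B \<in> sets (lborel_pow n)" and sym: "\<And>x \<sigma>. x \<in> B \<Longrightarrow> \<sigma> permutes {..<n} \<Longrightarrow> x \<circ> \<sigma> \<in> B"
  shows "{\<omega> \<in> space N. eigs n (X \<omega>) \<in> B} \<in> sets N" (is "?E \<in> _")
proof (cases "measure N ?E = 0")
  case False
  then show ?thesis by (meson measure_notin_sets)
next
  case True
  let ?C = "space (lborel_pow n) - B"
  have C: "?C \<in> sets (lborel_pow n)" using B by auto
  have symC: "x \<circ> \<sigma> \<in> ?C" if x: "x \<in> ?C" and \<sigma>: "\<sigma> permutes {..<n}" for x \<sigma>
  proof -
    have "x \<circ> \<sigma> \<notin> B"
    proof
      assume "x \<circ> \<sigma> \<in> B"
      from sym[OF this permutes_inv[OF \<sigma>]] have "x \<in> B"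
        by (simp add: o_assoc[symmetric] permutes_inv_o[OF \<sigma>])
      with x show False by simp
    qed
    then show ?thesis using comp_permutation_in_space[OF \<sigma>] x by simp
  qed
  have "set_integrable (lborel_pow n) B \<rho>" "set_integrable (lborel_pow n) ?C \<rho>"
    using integrable_mult_indicator[OF B \<rho>(1)] integrable_mult_indicator[OF C \<rho>(1)]
    by (simp_all add: set_integrable_def)
  then have "(LINT x:B \<union> ?C|lborel_pow n. \<rho> x) = (LINT x:B|lborel_pow n. \<rho> x) + (LINT x:?C|lborel_pow n. \<rho> x)"
    by (intro set_integral_Un) auto
  moreover have "B \<union> ?C = space (lborel_pow n)"
    using sets.sets_into_space[OF B] by auto
  moreover have "(LINT x:space (lborel_pow n)|lborel_pow n. \<rho> x) = 1"
    using \<rho> by (simp add: set_integral_space)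
  moreover have "(LINT x:B|lborel_pow n. \<rho> x) = 0"
    using law B sym True by (simp add: eigenvalues_have_density_def)
  moreover have "measure N {\<omega> \<in> space N. eigs n (X \<omega>) \<in> ?C} = (LINT x:?C|lborel_pow n. \<rho> x)"
    using law C symC unfolding eigenvalues_have_density_def by blast
  ultimately have "measure N {\<omega> \<in> space N. eigs n (X \<omega>) \<in> ?C} \<noteq> 0" by simp
  then have "{\<omega> \<in> space N. eigs n (X \<omega>) \<in> ?C} \<in> sets N" by (meson measure_notin_sets)
  then have "space N - {\<omega> \<in> space N. eigs n (X \<omega>) \<in> ?C} \<in> sets N" by auto
  also have "space N - {\<omega> \<in> space N. eigs n (X \<omega>) \<in> ?C} = ?E"
    using eigs_in_space by auto
  finally show ?thesis .
qed

text \<open>The law is available only on permutation-invariant sets. The level sets of a symmetric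
  statistic are such sets, and a bounded natural-number-valued statistic has finitely many of
  them.\<close>

lemma integral_symmetric_statistic:
  fixes g :: "(nat \<Rightarrow> real) \<Rightarrow> nat"
  assumes g: "g \<in> lborel_pow n \<rightarrow>\<^sub>M count_space UNIV" and bound: "\<And>x. g x \<le> b"
    and sym: "\<And>x \<sigma>. x \<in> space (lborel_pow n) \<Longrightarrow> \<sigma> permutes {..<n} \<Longrightarrow> g (x \<circ> \<sigma>) = g x"
  shows "(LINT \<omega>|N. real (g (eigs n (X \<omega>)))) = (LINT x|lborel_pow n. real (g x) * \<rho> x)"
proof -
  interpret prob_space N by (rule N)
  define S where "S k = {x \<in> space (lborel_pow n). g x = k}" for k
  have S: "S k \<in> sets (lborel_pow n)" for k
    using measurable_sets[OF g, of "{k}"] by (simp add: S_def vimage_def Int_def conj_commute)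
  have symS: "x \<circ> \<sigma> \<in> S k" if "x \<in> S k" "\<sigma> permutes {..<n}" for x \<sigma> k
    using that sym comp_permutation_in_space by (auto simp: S_def)
  define E where "E k = {\<omega> \<in> space N. eigs n (X \<omega>) \<in> S k}" for k
  have E: "E k \<in> sets N" for k
    unfolding E_def using S symS by (intro symmetric_eigenvalue_event)
  have decomp: "real (g x) = (\<Sum>k\<le>b. real k * indicator (S k) x)" if "x \<in> space (lborel_pow n)" for x
  proof -
    have "(\<Sum>k\<le>b. real k * indicator (S k) x) = (\<Sum>k\<le>b. if k = g x then real k else 0)"
      using that by (intro sum.cong) (auto simp: S_def)
    then show ?thesis using bound[of x] by simp
  qed
  have "(LINT \<omega>|N. real (g (eigs n (X \<omega>)))) = (LINT \<omega>|N. (\<Sum>k\<le>b. real k * indicator (E k) \<omega>))"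
    by (intro Bochner_Integration.integral_cong refl)
       (simp add: decomp[OF eigs_in_space] E_def indicator_def)
  also have "\<dots> = (\<Sum>k\<le>b. real k * measure N (E k))"
    using E by (subst Bochner_Integration.integral_sum) (auto intro!: integrable_real_indicator simp: emeasure_eq_measure)
  also have "\<dots> = (\<Sum>k\<le>b. real k * (LINT x:S k|lborel_pow n. \<rho> x))"
    using law S symS unfolding eigenvalues_have_density_def E_def by (intro sum.cong refl) auto
  also have "\<dots> = (LINT x|lborel_pow n. (\<Sum>k\<le>b. real k * (indicator (S k) x * \<rho> x)))"
    using integrable_mult_indicator[OF S \<rho>(1)]
    by (subst Bochner_Integration.integral_sum) (auto simp: set_lebesgue_integral_def)
  also have "\<dots> = (LINT x|lborel_pow n. real (g x) * \<rho> x)"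
    by (intro Bochner_Integration.integral_cong refl) (simp only: decomp sum_distrib_right mult.assoc)
  finally show ?thesis .
qed

end

lemma mdet_of_real: "mdet n (\<lambda>i j. complex_of_real (a i j)) = complex_of_real (mdet n a)"
  by (simp add: mdet_leibniz)

text \<open>Makes the number of m-tuples that land in B a symmetric statistic, although B itself
  need not be symmetric: relabelling merely permutes the injective tuples.\<close>

lemma sum_injective_tuples_permute:
  fixes h :: "(nat \<Rightarrow> nat) \<Rightarrow> 'b::comm_monoid_add" and m n :: nat
  assumes \<sigma>: "\<sigma> permutes {..<n}"
  defines "I \<equiv> {\<iota> \<in> {..<m} \<rightarrow>\<^sub>E {..<n}. inj_on \<iota> {..<m}}"
  shows "(\<Sum>\<iota>\<in>I. h (restrict (\<sigma> \<circ> \<iota>) {..<m})) = (\<Sum>\<iota>\<in>I. h \<iota>)"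
proof -
  have into: "restrict (\<tau> \<circ> \<iota>) {..<m} \<in> I" if "\<tau> permutes {..<n}" "\<iota> \<in> I" for \<tau> \<iota>
  proof -
    have "inj_on (\<tau> \<circ> \<iota>) {..<m}"
      using that(2) by (intro comp_inj_on permutes_inj_on[OF that(1)]) (simp add: I_def)
    moreover have "\<tau> (\<iota> l) \<in> {..<n}" if "l < m" for l
      using \<open>\<iota> \<in> I\<close> that by (subst permutes_in_image[OF \<open>\<tau> permutes {..<n}\<close>]) (auto simp: I_def)
    ultimately show ?thesis by (auto simp: I_def inj_on_def)
  qed
  have cancel: "restrict (\<tau> \<circ> restrict (\<tau>' \<circ> \<iota>) {..<m}) {..<m} = \<iota>"
    if "\<And>x. \<tau> (\<tau>' x) = x" "\<iota> \<in> I" for \<tau> \<tau>' \<iota>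
    using that by (auto simp: I_def PiE_iff extensional_def fun_eq_iff restrict_def)
  show ?thesis
  proof (rule sum.reindex_bij_witness[where i = "\<lambda>\<iota>. restrict (Hilbert_Choice.inv \<sigma> \<circ> \<iota>) {..<m}"
      and j = "\<lambda>\<iota>. restrict (\<sigma> \<circ> \<iota>) {..<m}"])
    fix \<iota> assume "\<iota> \<in> I"
    then show "restrict (Hilbert_Choice.inv \<sigma> \<circ> restrict (\<sigma> \<circ> \<iota>) {..<m}) {..<m} = \<iota>"
      "restrict (\<sigma> \<circ> restrict (Hilbert_Choice.inv \<sigma> \<circ> \<iota>) {..<m}) {..<m} = \<iota>"
      by (auto intro!: cancel simp: permutes_inverses[OF \<sigma>])
    show "restrict (\<sigma> \<circ> \<iota>) {..<m} \<in> I" "restrict (Hilbert_Choice.inv \<sigma> \<circ> \<iota>) {..<m} \<in> I"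
      using \<open>\<iota> \<in> I\<close> by (auto intro!: into \<sigma> permutes_inv)
  qed simp
qed

text \<open>Every injective tuple extends to a permutation of all particles, and the symmetry of the
  density carries it to the first m coordinates. All n!/(n - m)! tuples thus contribute
  equally.\<close>

lemma integral_injective_tuples:
  fixes \<rho> :: "(nat \<Rightarrow> real) \<Rightarrow> real" and m n :: nat
  assumes "m \<le> n" and B: "B \<in> sets (lborel_pow m)" and \<rho>: "integrable (lborel_pow n) \<rho>"
    and sym: "\<And>\<sigma> x. \<sigma> permutes {..<n} \<Longrightarrow> \<rho> (x \<circ> \<sigma>) = \<rho> x"
  defines "I \<equiv> {\<iota> \<in> {..<m} \<rightarrow>\<^sub>E {..<n}. inj_on \<iota> {..<m}}"
  shows "(LINT x|lborel_pow n. (\<Sum>\<iota>\<in>I. indicator B (\<lambda>l\<in>{..<m}. x (\<iota> l))) * \<rho> x) =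
    fact n / fact (n - m) * (LINT x|lborel_pow n. indicator B (restrict x {..<m}) * \<rho> x)"
proof -
  have meas: "(\<lambda>x. \<lambda>l\<in>{..<m}. x (\<iota> l)) \<in> lborel_pow n \<rightarrow>\<^sub>M lborel_pow m" if "\<iota> \<in> {..<m} \<rightarrow> {..<n}" for \<iota>
    using that by (intro measurable_restrict measurable_component_singleton) auto
  have ind: "(\<lambda>x. indicator B (\<lambda>l\<in>{..<m}. x (\<iota> l)) * \<rho> x) \<in> borel_measurable (lborel_pow n)"
    if "\<iota> \<in> {..<m} \<rightarrow> {..<n}" for \<iota>
    by (intro borel_measurable_times borel_measurable_integrable[OF \<rho>]
        measurable_compose[OF meas[OF that] borel_measurable_indicator[OF B]])
  have int: "integrable (lborel_pow n) (\<lambda>x. indicator B (\<lambda>l\<in>{..<m}. x (\<iota> l)) * \<rho> x)"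
    if "\<iota> \<in> {..<m} \<rightarrow> {..<n}" for \<iota>
    by (rule Bochner_Integration.integrable_bound[OF \<rho> ind[OF that]]) (auto simp: indicator_def)
  have each: "(LINT x|lborel_pow n. indicator B (\<lambda>l\<in>{..<m}. x (\<iota> l)) * \<rho> x) =
      (LINT x|lborel_pow n. indicator B (restrict x {..<m}) * \<rho> x)" if "\<iota> \<in> I" for \<iota>
  proof -
    have "\<iota> \<in> {..<m} \<rightarrow>\<^sub>E {..<n}" "inj_on \<iota> {..<m}" using that by (auto simp: I_def)
    then obtain \<sigma> where \<sigma>: "\<sigma> permutes {..<n}" "\<And>l. l < m \<Longrightarrow> \<sigma> l = \<iota> l"
      by (rule injective_tuple_extends_to_permutation) blast
    have eq: "(\<lambda>l\<in>{..<m}. (x \<circ> \<sigma>) l) = (\<lambda>l\<in>{..<m}. x (\<iota> l))" for x :: "nat \<Rightarrow> real"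
      using \<sigma>(2) by (auto simp: fun_eq_iff restrict_def)
    have "(\<lambda>l. l) \<in> {..<m} \<rightarrow> {..<n}" using assms(1) by auto
    from integral_comp_permutation[OF \<sigma>(1) ind[OF this]] show ?thesis
      by (simp only: eq sym[OF \<sigma>(1)])
  qed
  have "(LINT x|lborel_pow n. (\<Sum>\<iota>\<in>I. indicator B (\<lambda>l\<in>{..<m}. x (\<iota> l))) * \<rho> x) =
      (\<Sum>\<iota>\<in>I. LINT x|lborel_pow n. indicator B (\<lambda>l\<in>{..<m}. x (\<iota> l)) * \<rho> x)"
    unfolding sum_distrib_right
    by (intro Bochner_Integration.integral_sum int) (auto simp: I_def PiE_iff)
  also have "\<dots> = real (card I) * (LINT x|lborel_pow n. indicator B (restrict x {..<m}) * \<rho> x)"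
    by (simp add: each)
  finally show ?thesis
    using card_injective_tuples[OF assms(1)] by (simp add: I_def)
qed

lemma eigenvalues_determinantal_kernel:
  assumes bi: "biorthogonal_system n F P Q"
    and N: "prob_space N" and follow: "eigenvalues_follow N n X F Z"
    and K: "\<And>x y. K x y = complex_of_real (\<Sum>j<n. poly (P j) x * Q j y)"
  shows "eigenvalues_determinantal N n X K"
  unfolding eigenvalues_determinantal_def
proof (intro allI ballI conjI)
  fix m B assume B: "B \<in> sets (lborel_pow m)"
  let ?D = "kernel_det n Q P"
  let ?\<rho> = "ensemble_density n F Z"
  have Kdet: "Determinant.det (Matrix.mat m m (\<lambda>(i, j). K (y i) (y j))) = complex_of_real (?D m y)" for y
    unfolding kernel_det_def[OF bi] real_kernel_def[OF bi] mdet_of_real[symmetric] K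
    by (simp only: mdet_def)
  show "set_integrable (lborel_pow m) B (\<lambda>y. Determinant.det (Matrix.mat m m (\<lambda>(i, j). K (y i) (y j))))"
    unfolding Kdet set_integrable_def
    by (intro integrable_mult_indicator B integrable_of_real integrable_kernel_det[OF bi])
  have right: "(LINT y:B|lborel_pow m. Determinant.det (Matrix.mat m m (\<lambda>(i, j). K (y i) (y j)))) =
      complex_of_real (LINT y|lborel_pow m. indicator B y * ?D m y)"
    unfolding Kdet set_lebesgue_integral_def integral_complex_of_real[symmetric]
    by (simp add: scaleR_conv_of_real)
  define I where "I = {\<iota> \<in> {..<m} \<rightarrow>\<^sub>E {..<n}. inj_on \<iota> {..<m}}"
  define g where "g x = card {\<iota> \<in> {..<m} \<rightarrow>\<^sub>E {..<n}. inj_on \<iota> {..<m} \<and> (\<lambda>l\<in>{..<m}. x (\<iota> l)) \<in> B}"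
    for x :: "nat \<Rightarrow> real"
  have fin: "finite I"
    unfolding I_def by (rule finite_subset[OF _ finite_PiE[of "{..<m}" "\<lambda>_. {..<n}"]]) auto
  have g_card: "g x = card {\<iota> \<in> I. (\<lambda>l\<in>{..<m}. x (\<iota> l)) \<in> B}" for x
    unfolding g_def I_def by (rule arg_cong[of _ _ card]) auto
  have g_sum: "g x = (\<Sum>\<iota>\<in>I. indicator B (\<lambda>l\<in>{..<m}. x (\<iota> l)))" for x
    unfolding g_card using fin by (simp add: indicator_def sum.If_cases Int_def)
  have left: "(LINT \<omega>|N. real (g (eigs n (X \<omega>)))) = (LINT y|lborel_pow m. indicator B y * ?D m y)"
  \<comment> \<open>For m > n there are no injective tuples, and the kernel of rank at most n has
    vanishing determinant.\<close>
  proof (cases "m \<le> n")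
    case False
    have "?D m y = 0" for y
      unfolding kernel_det_def[OF bi] real_kernel_def[OF bi] using False by (intro mdet_low_rank) simp
    moreover have "I = {}"
      using False by (auto simp: I_def PiE_iff dest!: card_inj_on_le[of _ "{..<m}" "{..<n}"])
    ultimately show ?thesis by (simp add: g_sum)
  next
    case True
    have pe: "polynomial_ensemble n F Z" and law: "eigenvalues_have_density N n X ?\<rho>"
      using follow by (auto simp: eigenvalues_follow_def)
    have \<rho>: "integrable (lborel_pow n) ?\<rho>" "integral\<^sup>L (lborel_pow n) ?\<rho> = 1"
      using pe by (auto simp: polynomial_ensemble_def)
    have \<rho>D: "?\<rho> x = ?D n x / fact n" for x
      by (rule ensemble_density_eq_kernel_det[OF bi pe])
    have meas: "(\<lambda>x. indicator B (\<lambda>l\<in>{..<m}. x (\<iota> l)) :: nat) \<in> lborel_pow n \<rightarrow>\<^sub>M count_space UNIV"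
      if "\<iota> \<in> I" for \<iota>
    proof -
      have "(\<lambda>x. \<lambda>l\<in>{..<m}. x (\<iota> l)) \<in> lborel_pow n \<rightarrow>\<^sub>M lborel_pow m"
        using that by (intro measurable_restrict measurable_component_singleton) (auto simp: I_def)
      moreover have "(indicator B :: _ \<Rightarrow> nat) \<in> lborel_pow m \<rightarrow>\<^sub>M count_space UNIV"
        unfolding indicator_def[abs_def] of_bool_def using B by (intro measurable_If_set) auto
      ultimately show ?thesis by (rule measurable_compose)
    qed
    have "(LINT \<omega>|N. real (g (eigs n (X \<omega>)))) = (LINT x|lborel_pow n. real (g x) * ?\<rho> x)"
    proof (rule integral_symmetric_statistic[OF N law \<rho>])
      show "g \<in> lborel_pow n \<rightarrow>\<^sub>M count_space UNIV"
        unfolding g_sum[abs_def] using meas by measurable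
      show "g x \<le> card I" for x
        unfolding g_card using fin by (intro card_mono) auto
      fix x :: "nat \<Rightarrow> real" and \<sigma> assume \<sigma>: "\<sigma> permutes {..<n}"
      have "(\<lambda>l\<in>{..<m}. x (restrict (\<sigma> \<circ> \<iota>) {..<m} l)) = (\<lambda>l\<in>{..<m}. (x \<circ> \<sigma>) (\<iota> l))" for \<iota>
        by (auto simp: restrict_def)
      then show "g (x \<circ> \<sigma>) = g x"
        using sum_injective_tuples_permute[OF \<sigma>, where m = m and
            h = "\<lambda>\<iota>. indicator B (\<lambda>l\<in>{..<m}. x (\<iota> l)) :: nat"]
        by (simp only: g_sum I_def)
    qed
    also have "\<dots> = (LINT x|lborel_pow n. (\<Sum>\<iota>\<in>I. indicator B (\<lambda>l\<in>{..<m}. x (\<iota> l))) * ?\<rho> x)"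
      by (simp add: g_sum indicator_def)
    also have "\<dots> = fact n / fact (n - m) * (LINT x|lborel_pow n. indicator B (restrict x {..<m}) * ?\<rho> x)"
      unfolding I_def
      by (rule integral_injective_tuples[OF True B \<rho>(1)]) (simp add: \<rho>D kernel_det_permute[OF bi])
    \<comment> \<open>The n! of the tuple count cancels the n! in the density; the remaining (n -
      m)! is absorbed by the marginal.\<close>
    also have "\<dots> = 1 / fact (n - m) * (LINT x|lborel_pow n. indicator B (restrict x {..<m}) * ?D n x)"
      by (simp add: \<rho>D)
    also have "\<dots> = (LINT y|lborel_pow m. indicator B y * ?D m y)"
      using integral_kernel_det_marginal[OF bi True B] by simp
    finally show ?thesis .
  qed
  show "complex_of_real (LINT \<omega>|N. real (card {\<iota> \<in> {..<m} \<rightarrow>\<^sub>E {..<n}.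
      inj_on \<iota> {..<m} \<and> (\<lambda>l\<in>{..<m}. eigs n (X \<omega>) (\<iota> l)) \<in> B})) =
    (LINT y:B|lborel_pow m. Determinant.det (Matrix.mat m m (\<lambda>(i, j). K (y i) (y j))))"
    unfolding right left[symmetric] g_def ..
qed

section \<open>The Gaussian average of a determinant\<close>

text \<open>Replacing row m by a unit row turns the determinant into the principal minor without m,
  while the array keeps its size and its indices.\<close>

definition unit_row :: "nat \<Rightarrow> (nat \<Rightarrow> nat \<Rightarrow> 'a::comm_ring_1) \<Rightarrow> nat \<Rightarrow> nat \<Rightarrow> 'a" where
  "unit_row m a = a(m := (\<lambda>k. if k = m then 1 else 0))"

text \<open>With only the entries of \<open>H\<close> in \<open>S \<times> S\<close> switched on, the expectation of
  \<open>a i (\<sigma> i) - H i (\<sigma> i)\<close> multiplied over all \<open>i\<close> is the product of the following factors; the joint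
  contribution of a 2-cycle is booked at its smaller element.\<close>

definition wick_factor ::
  "nat set \<Rightarrow> (nat \<Rightarrow> nat) \<Rightarrow> (nat \<Rightarrow> nat \<Rightarrow> 'a::comm_ring_1) \<Rightarrow> nat \<Rightarrow> 'a" where
  "wick_factor S \<sigma> a i =
    (if i \<in> S \<and> \<sigma> i \<in> S \<and> \<sigma> i \<noteq> i \<and> \<sigma> (\<sigma> i) = i
     then if i < \<sigma> i then a i (\<sigma> i) * a (\<sigma> i) i + 1 else 1
     else a i (\<sigma> i))"

definition wick_det :: "nat \<Rightarrow> nat set \<Rightarrow> (nat \<Rightarrow> nat \<Rightarrow> 'a::comm_ring_1) \<Rightarrow> 'a" where
  "wick_det n S a = (\<Sum>\<sigma> | \<sigma> permutes {..<n}. signof \<sigma> * (\<Prod>i<n. wick_factor S \<sigma> a i))"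

lemma prod_remove_two:
  fixes f :: "nat \<Rightarrow> 'a::comm_monoid_mult"
  assumes "finite A" "m \<in> A" "j \<in> A" "m \<noteq> j"
  shows "(\<Prod>i\<in>A. f i) = f m * f j * (\<Prod>i\<in>A - {m, j}. f i)"
proof -
  have "(\<Prod>i\<in>A. f i) = f m * (\<Prod>i\<in>A - {m}. f i)"
    using assms by (intro prod.remove)
  also have "(\<Prod>i\<in>A - {m}. f i) = f j * (\<Prod>i\<in>A - {m} - {j}. f i)"
    using assms by (intro prod.remove) auto
  also have "A - {m} - {j} = A - {m, j}" by auto
  finally show ?thesis by (simp add: mult.assoc)
qed

text \<open>Switching on m changes only permutations in which m forms a 2-cycle with some j already
  in S. There the pair a_mj a_jm gains the summand 1, so at most one term of the sum over j is
  nonzero.\<close>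

lemma prod_wick_factor_insert:
  assumes \<sigma>: "\<sigma> permutes {..<n}" and S: "S \<subseteq> {..<n}" "m < n" "m \<notin> S"
  shows "(\<Prod>i<n. wick_factor (insert m S) \<sigma> a i) = (\<Prod>i<n. wick_factor S \<sigma> a i) +
    (\<Sum>j\<in>S. if \<sigma> m = j \<and> \<sigma> j = m then \<Prod>i\<in>{..<n} - {m, j}. wick_factor S \<sigma> a i else 0)"
proof (cases "\<sigma> m \<in> S \<and> \<sigma> (\<sigma> m) = m")
  case False
  have "wick_factor (insert m S) \<sigma> a i = wick_factor S \<sigma> a i" for i
    using False S(3) unfolding wick_factor_def by auto
  moreover have "(\<Sum>j\<in>S. if \<sigma> m = j \<and> \<sigma> j = m then \<Prod>i\<in>{..<n} - {m, j}. wick_factor S \<sigma> a i else 0) = 0"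
    using False by (intro sum.neutral) auto
  ultimately show ?thesis by simp
next
  case True
  define j where "j = \<sigma> m"
  have j: "j \<in> S" "\<sigma> m = j" "\<sigma> j = m" "j \<noteq> m" "j < n" "finite S"
    using True S by (auto simp: j_def intro: finite_subset)
  have rest: "wick_factor (insert m S) \<sigma> a i = wick_factor S \<sigma> a i" if "i \<notin> {m, j}" for i
  proof -
    have "\<sigma> i \<noteq> m" using that j(3) permutes_inj[OF \<sigma>] by (auto dest: injD)
    then show ?thesis using that unfolding wick_factor_def by auto
  qed
  have new: "wick_factor (insert m S) \<sigma> a m * wick_factor (insert m S) \<sigma> a j = a m j * a j m + 1"
    using j by (auto simp: wick_factor_def not_less mult.commute)
  have old: "wick_factor S \<sigma> a m * wick_factor S \<sigma> a j = a m j * a j m"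
    using j S by (auto simp: wick_factor_def)
  let ?r = "\<Prod>i\<in>{..<n} - {m, j}. wick_factor S \<sigma> a i"
  have "(\<Prod>i<n. wick_factor (insert m S) \<sigma> a i) = (a m j * a j m + 1) * ?r"
    using j S by (subst prod_remove_two[of _ m j]) (auto simp: new rest intro!: prod.cong)
  moreover have "(\<Prod>i<n. wick_factor S \<sigma> a i) = a m j * a j m * ?r"
    using j S by (subst prod_remove_two[of _ m j]) (auto simp: old)
  moreover have "(\<Sum>j'\<in>S. if \<sigma> m = j' \<and> \<sigma> j' = m then \<Prod>i\<in>{..<n} - {m, j'}. wick_factor S \<sigma> a i else 0) = ?r"
  proof -
    have "(\<Sum>j'\<in>S. if \<sigma> m = j' \<and> \<sigma> j' = m then \<Prod>i\<in>{..<n} - {m, j'}. wick_factor S \<sigma> a i else 0) =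
        (\<Sum>j'\<in>S. if j' = j then ?r else 0)"
      using j by (intro sum.cong) auto
    then show ?thesis using j by simp
  qed
  ultimately show ?thesis by (simp add: algebra_simps)
qed

text \<open>Composing with the transposition of m and j matches the permutations that exchange them
  with those that fix both, at the cost of a sign. The two unit rows select exactly the latter in
  \<open>wick_det\<close>.\<close>

lemma sum_permutations_exchanging:
  fixes a :: "nat \<Rightarrow> nat \<Rightarrow> 'a::comm_ring_1"
  assumes S: "S \<subseteq> {..<n}" "m < n" "m \<notin> S" "j \<in> S"
  shows "(\<Sum>\<sigma> | \<sigma> permutes {..<n} \<and> \<sigma> m = j \<and> \<sigma> j = m.
      signof \<sigma> * (\<Prod>i\<in>{..<n} - {m, j}. wick_factor S \<sigma> a i)) =
    - wick_det n (S - {j}) (unit_row j (unit_row m a))"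
proof -
  let ?t = "Transposition.transpose m j"
  let ?a = "unit_row j (unit_row m a)"
  have jm: "j \<noteq> m" "j < n" using S by auto
  have t: "?t permutes {..<n}" using S jm by (intro permutes_swap_id) auto
  have fixed: "(\<Prod>i<n. wick_factor (S - {j}) \<tau> ?a i) = (\<Prod>i\<in>{..<n} - {m, j}. wick_factor S \<tau> a i)"
    if \<tau>: "\<tau> permutes {..<n}" "\<tau> m = m" "\<tau> j = j" for \<tau>
  proof -
    have "wick_factor (S - {j}) \<tau> ?a i = wick_factor S \<tau> a i" if i: "i \<in> {..<n} - {m, j}" for i
    proof -
      have "\<tau> i \<noteq> m" "\<tau> i \<noteq> j"
        using i \<tau> permutes_inj[OF \<tau>(1)] by (metis DiffD2 injD insertCI)+
      then show ?thesis using i by (auto simp: wick_factor_def unit_row_def)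
    qed
    moreover have "wick_factor (S - {j}) \<tau> ?a m * wick_factor (S - {j}) \<tau> ?a j = 1"
      using \<tau> jm by (simp add: wick_factor_def unit_row_def)
    ultimately show ?thesis
      using S jm by (subst prod_remove_two[of _ m j]) auto
  qed
  \<comment> \<open>Neither m nor j belongs to \<open>S - {j}\<close>, so their factors are plain
    entries of unit rows and vanish off the diagonal.\<close>
  have moves: "(\<Prod>i<n. wick_factor (S - {j}) \<tau> ?a i) = 0"
    if \<tau>: "\<tau> permutes {..<n}" "\<not> (\<tau> m = m \<and> \<tau> j = j)" for \<tau>
  proof -
    have "wick_factor (S - {j}) \<tau> ?a m = 0 \<or> wick_factor (S - {j}) \<tau> ?a j = 0"
      using \<tau>(2) S jm by (auto simp: wick_factor_def unit_row_def)
    then show ?thesis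
      using S jm by (subst prod_remove_two[of _ m j]) auto
  qed
  have "wick_det n (S - {j}) ?a = (\<Sum>\<tau> | \<tau> permutes {..<n} \<and> \<tau> m = m \<and> \<tau> j = j.
      signof \<tau> * (\<Prod>i\<in>{..<n} - {m, j}. wick_factor S \<tau> a i))"
    unfolding wick_det_def
    by (rule sum.mono_neutral_cong_right) (auto simp: finite_permutations fixed moves)
  also have "\<dots> = (\<Sum>\<sigma> | \<sigma> permutes {..<n} \<and> \<sigma> m = j \<and> \<sigma> j = m.
      - (signof \<sigma> * (\<Prod>i\<in>{..<n} - {m, j}. wick_factor S \<sigma> a i)))"
  proof (rule sum.reindex_bij_witness[where i = "\<lambda>\<sigma>. \<sigma> \<circ> ?t" and j = "\<lambda>\<sigma>. \<sigma> \<circ> ?t"])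
    fix \<sigma> assume "\<sigma> \<in> {\<sigma>. \<sigma> permutes {..<n} \<and> \<sigma> m = j \<and> \<sigma> j = m}"
    then show "\<sigma> \<circ> ?t \<in> {\<tau>. \<tau> permutes {..<n} \<and> \<tau> m = m \<and> \<tau> j = j}"
      using permutes_compose[OF t] by auto
    show "\<sigma> \<circ> ?t \<circ> ?t = \<sigma>" by (simp add: fun_eq_iff)
  next
    fix \<tau> assume "\<tau> \<in> {\<tau>. \<tau> permutes {..<n} \<and> \<tau> m = m \<and> \<tau> j = j}"
    then have \<tau>: "\<tau> permutes {..<n}" "\<tau> m = m" "\<tau> j = j" by auto
    show "\<tau> \<circ> ?t \<in> {\<sigma>. \<sigma> permutes {..<n} \<and> \<sigma> m = j \<and> \<sigma> j = m}"
      using \<tau> permutes_compose[OF t] by auto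
    show "\<tau> \<circ> ?t \<circ> ?t = \<tau>" by (simp add: fun_eq_iff)
    have "sign (\<tau> \<circ> ?t) = - sign \<tau>"
      using jm by (subst sign_compose)
        (auto simp: sign_swap_id permutation_swap_id permutes_imp_permutation[OF finite_lessThan \<tau>(1)])
    moreover have "(\<Prod>i\<in>{..<n} - {m, j}. wick_factor S (\<tau> \<circ> ?t) a i) =
        (\<Prod>i\<in>{..<n} - {m, j}. wick_factor S \<tau> a i)"
    proof (intro prod.cong refl)
      fix i assume i: "i \<in> {..<n} - {m, j}"
      have "\<tau> i \<noteq> m" "\<tau> i \<noteq> j"
        using i \<tau> permutes_inj[OF \<tau>(1)] by (metis DiffD2 injD insertCI)+
      then show "wick_factor S (\<tau> \<circ> ?t) a i = wick_factor S \<tau> a i"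
        using i by (auto simp: wick_factor_def transpose_apply_other)
    qed
    ultimately show "- (signof (\<tau> \<circ> ?t) * (\<Prod>i\<in>{..<n} - {m, j}. wick_factor S (\<tau> \<circ> ?t) a i)) =
        signof \<tau> * (\<Prod>i\<in>{..<n} - {m, j}. wick_factor S \<tau> a i)"
      by simp
  qed
  finally show ?thesis by (simp add: sum_negf)
qed

text \<open>Each newly correlated pair {m, j} contributes a minor with both indices struck out; the
  minus is the sign of their transposition.\<close>

lemma wick_det_insert:
  assumes S: "S \<subseteq> {..<n}" "m < n" "m \<notin> S"
  shows "wick_det n (insert m S) a =
    wick_det n S a - (\<Sum>j\<in>S. wick_det n (S - {j}) (unit_row j (unit_row m a)))"
proof -
  let ?r = "\<lambda>\<sigma> j. \<Prod>i\<in>{..<n} - {m, j}. wick_factor S \<sigma> a i"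
  have "wick_det n (insert m S) a = wick_det n S a +
      (\<Sum>\<sigma> | \<sigma> permutes {..<n}. \<Sum>j\<in>S. if \<sigma> m = j \<and> \<sigma> j = m then signof \<sigma> * ?r \<sigma> j else 0)"
    unfolding wick_det_def sum.distrib[symmetric]
  proof (intro sum.cong refl)
    fix \<sigma> assume "\<sigma> \<in> {\<sigma>. \<sigma> permutes {..<n}}"
    then show "signof \<sigma> * (\<Prod>i<n. wick_factor (insert m S) \<sigma> a i) =
        signof \<sigma> * (\<Prod>i<n. wick_factor S \<sigma> a i) +
        (\<Sum>j\<in>S. if \<sigma> m = j \<and> \<sigma> j = m then signof \<sigma> * ?r \<sigma> j else 0)"
      using prod_wick_factor_insert[OF _ S, of \<sigma> a]
      by (simp add: distrib_left sum_distrib_left if_distrib[of "\<lambda>u. _ * u"] cong: if_cong)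
  qed
  also have "(\<Sum>\<sigma> | \<sigma> permutes {..<n}. \<Sum>j\<in>S. if \<sigma> m = j \<and> \<sigma> j = m then signof \<sigma> * ?r \<sigma> j else 0) =
      (\<Sum>j\<in>S. \<Sum>\<sigma> | \<sigma> permutes {..<n} \<and> \<sigma> m = j \<and> \<sigma> j = m. signof \<sigma> * ?r \<sigma> j)"
    by (subst sum.swap, rule sum.cong[OF refl], rule sum.mono_neutral_cong_right)
       (auto simp: finite_permutations)
  also have "\<dots> = (\<Sum>j\<in>S. - wick_det n (S - {j}) (unit_row j (unit_row m a)))"
    using S by (intro sum.cong refl sum_permutations_exchanging)
  finally show ?thesis by (simp add: sum_negf)
qed

lemma wick_det_empty: "wick_det n {} a = mdet n a"
  by (simp add: wick_det_def mdet_leibniz wick_factor_def)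

lemma mdet_add_diagonal_entry:
  assumes "m < n"
  shows "mdet n (\<lambda>i k. b i k + (if i = m \<and> k = m then c else 0)) = mdet n b + c * mdet n (unit_row m b)"
proof -
  have "(\<Prod>i<n. b i (\<sigma> i) + (if i = m \<and> \<sigma> i = m then c else 0)) =
      (\<Prod>i<n. b i (\<sigma> i)) + c * (\<Prod>i<n. unit_row m b i (\<sigma> i))" for \<sigma>
  proof -
    let ?r = "\<Prod>i\<in>{..<n} - {m}. b i (\<sigma> i)"
    have "(\<Prod>i<n. b i (\<sigma> i) + (if i = m \<and> \<sigma> i = m then c else 0)) =
        (b m (\<sigma> m) + (if \<sigma> m = m then c else 0)) * ?r"
      using assms by (subst prod.remove[of _ m]) (auto intro!: prod.cong arg_cong2[of _ _ _ _ "(*)"])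
    moreover have "(\<Prod>i<n. b i (\<sigma> i)) = b m (\<sigma> m) * ?r"
      using assms by (subst prod.remove[of _ m]) auto
    moreover have "(\<Prod>i<n. unit_row m b i (\<sigma> i)) = (if \<sigma> m = m then 1 else 0) * ?r"
      using assms by (subst prod.remove[of _ m])
        (auto simp: unit_row_def intro!: prod.cong arg_cong2[of _ _ _ _ "(*)"])
    ultimately show ?thesis by (simp add: algebra_simps)
  qed
  then show ?thesis
    by (simp add: mdet_leibniz algebra_simps sum.distrib sum_distrib_left)
qed

lemma pderiv_mdet:
  fixes b :: "nat \<Rightarrow> nat \<Rightarrow> 'a::idom poly"
  shows "pderiv (mdet n b) = (\<Sum>j<n. mdet n (b(j := (\<lambda>k. pderiv (b j k)))))"
proof -
  have sg: "pderiv (signof \<sigma> * p) = signof \<sigma> * pderiv p" for \<sigma> and p :: "'a poly"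
    by (cases \<sigma> rule: sign_cases) (simp_all add: pderiv_minus)
  have "pderiv (\<Prod>i<n. b i (\<sigma> i)) = (\<Sum>j<n. \<Prod>i<n. (b(j := (\<lambda>k. pderiv (b j k)))) i (\<sigma> i))" for \<sigma>
    unfolding pderiv_prod
  proof (intro sum.cong refl)
    fix j assume "j \<in> {..<n}"
    then show "(\<Prod>i\<in>{..<n} - {j}. b i (\<sigma> i)) * pderiv (b j (\<sigma> j)) =
        (\<Prod>i<n. (b(j := (\<lambda>k. pderiv (b j k)))) i (\<sigma> i))"
      by (subst (2) prod.remove[of _ j]) (auto simp: mult.commute intro!: prod.cong arg_cong2[of _ _ _ _ "(*)"])
  qed
  then have "pderiv (mdet n b) = (\<Sum>\<sigma> | \<sigma> permutes {..<n}. \<Sum>j<n.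
      signof \<sigma> * (\<Prod>i<n. (b(j := (\<lambda>k. pderiv (b j k)))) i (\<sigma> i)))"
    by (simp add: mdet_leibniz pderiv_sum sg sum_distrib_left)
  then show ?thesis
    by (subst (asm) sum.swap) (simp add: mdet_leibniz)
qed

text \<open>A constant array whose diagonal carries an extra X - x at the indices in S. For the
  array x - M and all indices this is X - M, so one family interpolates between a constant
  determinant and a characteristic polynomial.\<close>

definition diag_shift :: "'a::comm_ring_1 \<Rightarrow> nat set \<Rightarrow> (nat \<Rightarrow> nat \<Rightarrow> 'a) \<Rightarrow> nat \<Rightarrow> nat \<Rightarrow> 'a poly" where
  "diag_shift x S a i k = [:a i k:] + (if i = k \<and> i \<in> S then [:- x, 1:] else 0)"

text \<open>By the commutation rule, X - x becomes X - x - D under the transform, and evaluation at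
  x leaves only -D.\<close>

lemma hermite_transform_linear_factor:
  "poly (hermite_transform ([:- x, 1:] * p)) x = - poly (hermite_transform (pderiv p)) x"
proof -
  have "[:- x, 1:] * p = pCons 0 p + smult (- x) p" by simp
  then show ?thesis
    by (simp only: hermite_transform_add hermite_transform_pCons_0 hermite_transform_smult) simp
qed

text \<open>Adding X - x at position (m, m) adds X - x times a minor. Transform and evaluation turn
  that factor into minus the derivative of the minor, and differentiating row by row reproduces the
  recursion \<open>wick_det_insert\<close>.\<close>

lemma mdet_diag_shift_insert:
  fixes a :: "nat \<Rightarrow> nat \<Rightarrow> 'a::idom" and x :: 'a
  assumes S: "S \<subseteq> {..<n}" "m < n" "m \<notin> S"
  defines "R \<equiv> \<lambda>S a. poly (hermite_transform (mdet n (diag_shift x S a))) x"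
  shows "R (insert m S) a = R S a - (\<Sum>j\<in>S. R (S - {j}) (unit_row j (unit_row m a)))"
proof -
  let ?a = "unit_row m a"
  have eq1: "diag_shift x (insert m S) a = (\<lambda>i k. diag_shift x S a i k + (if i = m \<and> k = m then [:- x, 1:] else 0))"
    using S(3) by (auto simp: diag_shift_def fun_eq_iff)
  have eq2: "unit_row m (diag_shift x S a) = diag_shift x S ?a"
    using S(3) by (auto simp: diag_shift_def unit_row_def fun_eq_iff)
  have det: "mdet n (diag_shift x (insert m S) a) =
      mdet n (diag_shift x S a) + [:- x, 1:] * mdet n (diag_shift x S ?a)"
    by (simp only: eq1 mdet_add_diagonal_entry[OF S(2)] eq2)
  \<comment> \<open>Differentiation kills the constants of row j and sends X - x to 1: a unit row
    for j in S, a zero row otherwise, in particular for j = m.\<close>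
  have "mdet n ((diag_shift x S ?a)(j := (\<lambda>k. pderiv (diag_shift x S ?a j k)))) =
      (if j \<in> S then mdet n (diag_shift x (S - {j}) (unit_row j ?a)) else 0)" if "j < n" for j
  proof (cases "j \<in> S")
    case True
    have "(diag_shift x S ?a)(j := (\<lambda>k. pderiv (diag_shift x S ?a j k))) = diag_shift x (S - {j}) (unit_row j ?a)"
      using True by (auto simp: diag_shift_def unit_row_def fun_eq_iff pderiv_pCons one_pCons)
    then show ?thesis using True by simp
  next
    case False
    then have "(\<Prod>i<n. ((diag_shift x S ?a)(j := (\<lambda>k. pderiv (diag_shift x S ?a j k)))) i (\<sigma> i)) = 0" for \<sigma>
      using that by (intro prod_zero) (auto intro!: bexI[of _ j] simp: diag_shift_def pderiv_pCons)
    then show ?thesis using False by (simp add: mdet_leibniz)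
  qed
  then have "pderiv (mdet n (diag_shift x S ?a)) =
      (\<Sum>j<n. if j \<in> S then mdet n (diag_shift x (S - {j}) (unit_row j ?a)) else 0)"
    by (simp add: pderiv_mdet)
  also have "\<dots> = (\<Sum>j\<in>S. mdet n (diag_shift x (S - {j}) (unit_row j ?a)))"
    using S(1) by (intro sum.mono_neutral_cong_right) auto
  finally show ?thesis
    unfolding R_def det hermite_transform_add poly_add hermite_transform_linear_factor
    by (simp add: hermite_transform_sum poly_sum)
qed

lemma mdet_const_poly: "mdet n (\<lambda>i k. [:a i k:]) = [:mdet n a:]"
proof -
  have p: "(\<Prod>i\<in>A. [:f i:]) = [:\<Prod>i\<in>A. f i:]" for f :: "nat \<Rightarrow> 'a" and A
    by (induction A rule: infinite_finite_induct) (auto simp: one_pCons)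
  have "signof \<sigma> * [:c:] = [:signof \<sigma> * c :: 'a:]" for \<sigma> c
    by (cases \<sigma> rule: sign_cases) simp_all
  moreover have "(\<Sum>\<sigma>\<in>A. [:f \<sigma>:]) = [:\<Sum>\<sigma>\<in>A. f \<sigma>:]" for f :: "(nat \<Rightarrow> nat) \<Rightarrow> 'a" and A
    by (induction A rule: infinite_finite_induct) auto
  ultimately show ?thesis by (simp add: mdet_leibniz p)
qed

lemma wick_det_eq_hermite_transform:
  fixes a :: "nat \<Rightarrow> nat \<Rightarrow> 'a::idom" and x :: 'a
  assumes "S \<subseteq> {..<n}"
  shows "wick_det n S a = poly (hermite_transform (mdet n (diag_shift x S a))) x"
  using assms
\<comment> \<open>The recursion passes to smaller sets \<open>S - {j}\<close> and to other arrays,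
  hence strong induction on the size with the array arbitrary.\<close>
proof (induction "card S" arbitrary: S a rule: less_induct)
  case less
  show ?case
  proof (cases "S = {}")
    case True
    have "diag_shift x {} a = (\<lambda>i k. [:a i k:])"
      by (simp add: diag_shift_def fun_eq_iff)
    then show ?thesis
      using True hermite_transform_monom[of "mdet n a" 0]
      by (simp add: wick_det_empty mdet_const_poly monom_0)
  next
    case False
    then obtain m where m: "m \<in> S" by blast
    have fin: "finite S" using less.prems by (rule finite_subset) simp
    define T where "T = S - {m}"
    have S: "S = insert m T" "m \<notin> T" "T \<subseteq> {..<n}" "m < n" "finite T"
      using m less.prems fin by (auto simp: T_def)
    have "card T < card S" "\<And>j. card (T - {j}) < card S"
      using S by (auto simp: card_insert_disjoint less_Suc_eq_le intro: card_Diff1_le)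
    then show ?thesis
      unfolding S(1) wick_det_insert[OF S(3,4,2)] mdet_diag_shift_insert[OF S(3,4,2)]
      using less.hyps[of T a] less.hyps[of "T - {_}"] S by (auto intro!: sum.cong arg_cong2[of _ _ _ _ "(-)"])
  qed
qed

section \<open>Hermitian matrices: a determinant bound and the eigenvalues\<close>

definition hermitian_array :: "nat \<Rightarrow> (nat \<Rightarrow> nat \<Rightarrow> complex) \<Rightarrow> bool" where
  "hermitian_array n a \<longleftrightarrow> (\<forall>i<n. \<forall>j<n. a i j = cnj (a j i))"

lemma hermitian_quadratic_form_real:
  assumes "hermitian_array n a"
  shows "Im (\<Sum>i<n. \<Sum>l<n. cnj (v i) * a i l * v l) = 0"
proof -
  have "cnj (\<Sum>i<n. \<Sum>l<n. cnj (v i) * a i l * v l) = (\<Sum>i<n. \<Sum>l<n. cnj (v l) * a l i * v i)"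
    unfolding cnj_sum
  proof (intro sum.cong refl)
    fix i l assume "i \<in> {..<n}" "l \<in> {..<n}"
    then have h: "a l i = cnj (a i l)"
      using assms unfolding hermitian_array_def lessThan_iff by blast
    show "cnj (cnj (v i) * a i l * v l) = cnj (v l) * a l i * v i"
      by (simp only: complex_cnj_mult complex_cnj_cnj h[symmetric] mult.commute mult.left_commute)
  qed
  also have "\<dots> = (\<Sum>i<n. \<Sum>l<n. cnj (v i) * a i l * v l)" by (rule sum.swap)
  finally have "Im (cnj (\<Sum>i<n. \<Sum>l<n. cnj (v i) * a i l * v l)) =
      Im (\<Sum>i<n. \<Sum>l<n. cnj (v i) * a i l * v l)"
    by (rule arg_cong)
  then show ?thesis
    unfolding cnj.sel by linarith
qed

text \<open>The quadratic form of a Hermitian array is real, so only the added imaginary unit shows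
  in the imaginary part. Both the invertibility of a + i and the bound on its inverse come from this
  identity.\<close>

lemma hermitian_shift_im:
  assumes "hermitian_array n a"
  shows "Im (\<Sum>i<n. cnj (v i) * (\<Sum>l<n. (a i l + (if i = l then \<i> else 0)) * v l)) = (\<Sum>i<n. (norm (v i))\<^sup>2)"
proof -
  have "(\<Sum>i<n. cnj (v i) * (\<Sum>l<n. (a i l + (if i = l then \<i> else 0)) * v l)) =
      (\<Sum>i<n. \<Sum>l<n. cnj (v i) * a i l * v l) + (\<Sum>i<n. \<i> * (v i * cnj (v i)))"
  proof -
    have "(\<Sum>l<n. (a i l + (if i = l then \<i> else 0)) * v l) = (\<Sum>l<n. a i l * v l) + \<i> * v i"
      if "i < n" for i
    proof -
      have "(\<Sum>l<n. (a i l + (if i = l then \<i> else 0)) * v l) =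
          (\<Sum>l<n. a i l * v l) + (\<Sum>l<n. if i = l then \<i> * v l else 0)"
        by (simp add: distrib_right sum.distrib if_distrib[of "\<lambda>u. u * _"] cong: if_cong)
      then show ?thesis using that by simp
    qed
    then show ?thesis
      by (simp add: distrib_left sum.distrib sum_distrib_left ac_simps)
  qed
  moreover have "Im (\<Sum>i<n. \<i> * (v i * cnj (v i))) = (\<Sum>i<n. (norm (v i))\<^sup>2)"
    by (simp only: complex_norm_square[symmetric] Im_sum) simp
  ultimately show ?thesis
    using hermitian_quadratic_form_real[OF assms, of v] by simp
qed

lemma norm_mdet_le:
  fixes b :: "nat \<Rightarrow> nat \<Rightarrow> complex"
  assumes "\<And>i j. i < n \<Longrightarrow> j < n \<Longrightarrow> norm (b i j) \<le> C"
  shows "norm (mdet n b) \<le> fact n * C ^ n"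
proof -
  have "norm (signof \<sigma> * (\<Prod>i<n. b i (\<sigma> i))) \<le> C ^ n" if \<sigma>: "\<sigma> permutes {..<n}" for \<sigma>
  proof -
    have "norm (\<Prod>i<n. b i (\<sigma> i)) \<le> (\<Prod>i<n. C)"
      unfolding prod_norm[symmetric]
      using permutes_in_image[OF \<sigma>] by (intro prod_mono) (auto intro: assms)
    moreover have "norm (signof \<sigma> :: complex) = 1"
      by (cases \<sigma> rule: sign_cases) simp_all
    ultimately show ?thesis by (simp add: norm_mult)
  qed
  then have "norm (mdet n b) \<le> (\<Sum>\<sigma> | \<sigma> permutes {..<n}. C ^ n)"
    unfolding mdet_leibniz by (intro order.trans[OF norm_sum] sum_mono) auto
  then show ?thesis by (simp add: card_permutations)
qed

text \<open>The resolvent \<open>(a + \<i>)\<^sup>-\<^sup>1\<close> of a Hermitian matrix has entries of modulus at most 1, so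
  that \<open>a + h = (a + \<i>) (1 + (a + \<i>)\<^sup>-\<^sup>1 (h - \<i>))\<close> bounds the determinant of a perturbation
  without any diagonalization.\<close>

lemma norm_mdet_perturbation_le:
  assumes a: "hermitian_array n a" and h: "\<And>j. j < n \<Longrightarrow> (\<Sum>l<n. norm (h l j)) \<le> s"
  shows "norm (mdet n (\<lambda>i j. a i j + h i j)) \<le>
    norm (mdet n (\<lambda>i j. a i j + (if i = j then \<i> else 0))) * (fact n * (2 + s) ^ n)"
proof -
  define g where "g i j = a i j + (if i = j then \<i> else 0)" for i j
  have "v j = 0" if 0: "\<And>i. i < n \<Longrightarrow> (\<Sum>l<n. g i l * v l) = 0" and "j < n" for v j
  proof -
    have "(\<Sum>i<n. cnj (v i) * (\<Sum>l<n. (a i l + (if i = l then \<i> else 0)) * v l)) = 0"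
      using 0 unfolding g_def by (intro sum.neutral) simp
    then have "(\<Sum>i<n. (norm (v i))\<^sup>2) = 0"
      using hermitian_shift_im[OF a, of v] by (simp only: zero_complex.sel)
    then show ?thesis using \<open>j < n\<close> by (simp add: sum_nonneg_eq_0_iff)
  qed
  then obtain w where w: "\<And>i j. i < n \<Longrightarrow> j < n \<Longrightarrow> (\<Sum>l<n. g i l * w l j) = (if i = j then 1 else 0)"
    using mdet_inverse[of n g] by blast
  have wn: "norm (w i l) \<le> 1" if "i < n" "l < n" for i l
  proof -
    \<comment> \<open>The quadratic form at column l of the inverse \<open>w\<close>: applying
      \<open>g\<close> gives a unit vector, so the squared norm of the column is at most |w_ll|.
      Hence first |w_ll| <= 1, then the same for every entry of the column.\<close>
    have "(\<Sum>i<n. cnj (w i l) * (\<Sum>k<n. g i k * w k l)) = (\<Sum>i<n. if i = l then cnj (w l l) else 0)"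
      using w \<open>l < n\<close> by (intro sum.cong) auto
    then have "(\<Sum>i<n. (norm (w i l))\<^sup>2) = Im (cnj (w l l))"
      using hermitian_shift_im[OF a, of "\<lambda>i. w i l"] \<open>l < n\<close> by (simp add: g_def)
    also have "\<dots> \<le> norm (w l l)"
      using abs_Im_le_cmod[of "cnj (w l l)"] by simp
    finally have le: "(\<Sum>i<n. (norm (w i l))\<^sup>2) \<le> norm (w l l)" .
    have entry: "(norm (w k l))\<^sup>2 \<le> (\<Sum>i<n. (norm (w i l))\<^sup>2)" if "k < n" for k
      using that by (intro member_le_sum) auto
    have "norm (w l l) * norm (w l l) \<le> norm (w l l) * 1"
      using le entry[OF \<open>l < n\<close>] by (simp add: power2_eq_square)
    then have "norm (w l l) \<le> 1"
      by (cases "norm (w l l) = 0") (auto simp: mult_le_cancel_left)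
    then have "(norm (w i l))\<^sup>2 \<le> 1"
      using le entry[OF \<open>i < n\<close>] by linarith
    then show ?thesis by (simp add: abs_square_le_1)
  qed
  \<comment> \<open>That is, b = 1 + w (h - i), the factor with g b = a + h. Its entries are at most
    1 from the identity, s from h and 1 from the imaginary unit, in sum 2 + s.\<close>
  define b where "b i j = (if i = j then 1 else 0) + (\<Sum>l<n. w i l * (h l j - (if l = j then \<i> else 0)))" for i j
  have "a i j + h i j = (\<Sum>l<n. g i l * b l j)" if "i < n" "j < n" for i j
  proof -
    have "(\<Sum>l<n. g i l * b l j) = (\<Sum>l<n. if l = j then g i l else 0) +
        (\<Sum>l<n. \<Sum>k<n. g i l * w l k * (h k j - (if k = j then \<i> else 0)))"
      by (simp add: b_def distrib_left sum.distrib sum_distrib_left mult.assoc if_distrib[of "\<lambda>u. _ * u"] cong: if_cong)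
    also have "(\<Sum>l<n. \<Sum>k<n. g i l * w l k * (h k j - (if k = j then \<i> else 0))) =
        (\<Sum>k<n. (\<Sum>l<n. g i l * w l k) * (h k j - (if k = j then \<i> else 0)))"
      by (subst sum.swap) (simp add: sum_distrib_right)
    also have "\<dots> = (\<Sum>k<n. if k = i then h k j - (if k = j then \<i> else 0) else 0)"
      using that by (intro sum.cong) (auto simp: w)
    also have "\<dots> = h i j - (if i = j then \<i> else 0)"
      using that by simp
    also have "(\<Sum>l<n. if l = j then g i l else 0) = a i j + (if i = j then \<i> else 0)"
      using that by (simp add: g_def)
    finally show ?thesis by simp
  qed
  then have "mdet n (\<lambda>i j. a i j + h i j) = mdet n g * mdet n b"
    unfolding mdet_mult[symmetric] by (intro mdet_cong) auto
  moreover have "norm (mdet n b) \<le> fact n * (2 + s) ^ n"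
  proof (rule norm_mdet_le)
    fix i j assume ij: "i < n" "j < n"
    have "norm (\<Sum>l<n. w i l * (h l j - (if l = j then \<i> else 0))) \<le>
        (\<Sum>l<n. norm (h l j) + (if l = j then 1 else 0))"
    proof (intro order.trans[OF norm_sum] sum_mono)
      fix l assume "l \<in> {..<n}"
      then have "norm (w i l * (h l j - (if l = j then \<i> else 0))) \<le> 1 * norm (h l j - (if l = j then \<i> else 0))"
        unfolding norm_mult using wn ij by (intro mult_right_mono) auto
      also have "\<dots> \<le> norm (h l j) + (if l = j then 1 else 0)"
        using norm_triangle_ineq4[of "h l j" "if l = j then \<i> else 0"] by (auto split: if_splits)
      finally show "norm (w i l * (h l j - (if l = j then \<i> else 0))) \<le> norm (h l j) + (if l = j then 1 else 0)" .
    qed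
    also have "\<dots> \<le> s + 1" using h[OF ij(2)] ij by (simp add: sum.distrib)
    finally show "norm (b i j) \<le> 2 + s"
      unfolding b_def by (intro order.trans[OF norm_triangle_ineq]) auto
  qed
  ultimately show ?thesis
    by (simp add: norm_mult g_def[abs_def] mult_left_mono)
qed

definition entries :: "complex mat \<Rightarrow> nat \<Rightarrow> nat \<Rightarrow> complex" where
  "entries A i j = A $$ (i, j)"

lemma hermitian_entries:
  assumes "A \<in> carrier_mat n n" "mat_adjoint A = A"
  shows "hermitian_array n (entries A)"
  unfolding hermitian_array_def entries_def
proof (intro allI impI)
  fix i j assume "i < n" "j < n"
  then have "mat_adjoint A $$ (i, j) = cnj (A $$ (j, i))"
    using assms(1) by (simp add: mat_adjoint_def mat_of_rows_def)
  then show "A $$ (i, j) = cnj (A $$ (j, i))" using assms(2) by simp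
qed

lemma poly_char_poly:
  assumes "A \<in> carrier_mat n n"
  shows "poly (char_poly A) z = mdet n (\<lambda>i j. (if i = j then z else 0) - entries A i j)"
  unfolding char_poly_def mdet_def entries_def
  using assms by (intro poly_det_cong[of _ n]) (auto simp: char_poly_matrix_def)

lemma char_poly_mdet:
  assumes "A \<in> carrier_mat n n"
  shows "char_poly A = mdet n (diag_shift x {..<n} (\<lambda>i j. (if i = j then x else 0) - entries A i j))"
  unfolding char_poly_def mdet_def
  using assms by (intro arg_cong[of _ _ Determinant.det] eq_matI)
    (auto simp: char_poly_matrix_def diag_shift_def entries_def)

lemma hermitian_root_real:
  assumes A: "A \<in> carrier_mat n n" and h: "hermitian_array n (entries A)" and z: "poly (char_poly A) z = 0"
  shows "Im z = 0"
proof -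
  obtain v where v: "v \<in> carrier_vec n" "v \<noteq> 0\<^sub>v n" "A *\<^sub>v v = z \<cdot>\<^sub>v v"
    using z A eigenvalue_root_char_poly[OF A] by (auto simp: eigenvalue_def eigenvector_def)
  let ?v = "vec_index v"
  have Av: "(\<Sum>l<n. entries A i l * ?v l) = z * ?v i" if "i < n" for i
    using arg_cong[OF v(3), of "\<lambda>u. vec_index u i"] that v(1) A
    by (simp add: entries_def scalar_prod_def atLeast0LessThan)
  have "(\<Sum>i<n. \<Sum>l<n. cnj (?v i) * entries A i l * ?v l) = (\<Sum>i<n. cnj (?v i) * (z * ?v i))"
    by (simp only: mult.assoc sum_distrib_left[symmetric]) (simp add: Av)
  also have "\<dots> = z * of_real (\<Sum>i<n. (norm (?v i))\<^sup>2)"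
    by (simp add: sum_distrib_left complex_norm_square ac_simps del: of_real_power)
  finally have "Im (z * of_real (\<Sum>i<n. (norm (?v i))\<^sup>2)) = 0"
    using hermitian_quadratic_form_real[OF h, of ?v] by simp
  moreover have "(\<Sum>i<n. (norm (?v i))\<^sup>2) \<noteq> 0"
  proof
    assume "(\<Sum>i<n. (norm (?v i))\<^sup>2) = 0"
    then have "\<forall>i<n. ?v i = 0" by (simp add: sum_nonneg_eq_0_iff)
    then have "v = 0\<^sub>v n" using v(1) by (intro eq_vecI) auto
    with v(2) show False by contradiction
  qed
  ultimately show ?thesis by simp
qed

text \<open>\<open>eigs\<close> lists the real parts of the roots. All roots are real and the
  product ignores their order, so this is the factorization of the monic characteristic
  polynomial.\<close>

lemma prod_eigs:
  assumes A: "A \<in> carrier_mat n n" and h: "hermitian_array n (entries A)"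
  shows "complex_of_real (\<Prod>j<n. x - eigs n A j) = poly (char_poly A) (of_real x)"
proof -
  let ?p = "char_poly A"
  let ?L = "sorted_list_of_multiset (image_mset Re (proots ?p))"
  have deg: "degree ?p = n" "lead_coeff ?p = 1"
    using degree_monic_char_poly[OF A] by auto
  have len: "length ?L = n"
    using deg size_proots_complex[of ?p]
    by (metis mset_sorted_list_of_multiset size_image_mset size_mset)
  have "?p \<noteq> 0" using deg(2) by auto
  have "(\<Prod>j<n. x - eigs n A j) = (\<Prod>j<n. x - ?L ! j)"
    by (intro prod.cong) (auto simp: eigs_def)
  also have "\<dots> = prod_list (map (\<lambda>r. x - r) ?L)"
    by (simp add: prod.list_conv_set_nth len atLeast0LessThan)
  also have "\<dots> = prod_mset (image_mset (\<lambda>r. x - r) (mset ?L))"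
    by (metis mset_map prod_mset_prod_list)
  also have "\<dots> = (\<Prod>z\<in>#proots ?p. x - Re z)"
    by (simp add: image_mset.compositionality o_def)
  finally have "complex_of_real (\<Prod>j<n. x - eigs n A j) = of_real (\<Prod>z\<in>#proots ?p. x - Re z)"
    by (rule arg_cong)
  also have "\<dots> = (\<Prod>z\<in>#proots ?p. of_real (x - Re z))"
    by (simp add: of_real_hom.hom_prod_mset image_mset.compositionality o_def)
  also have "\<dots> = (\<Prod>z\<in>#proots ?p. of_real x - z)"
  proof (intro arg_cong[of _ _ prod_mset] image_mset_cong)
    fix z assume "z \<in># proots ?p"
    then have "Im z = 0" using hermitian_root_real[OF A h] \<open>?p \<noteq> 0\<close> by simp
    then show "complex_of_real (x - Re z) = of_real x - z" by (simp add: complex_eq_iff)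
  qed
  also have "\<dots> = poly (\<Prod>z\<in>#proots ?p. [:- z, 1:]) (of_real x)"
    by (simp add: poly_prod_mset image_mset.compositionality o_def)
  also have "(\<Prod>z\<in>#proots ?p. [:- z, 1:]) = ?p"
    using complex_poly_decompose_multiset[of ?p] deg(2) by simp
  finally show ?thesis .
qed

section \<open>Interpolation at the nodes 0, ..., n\<close>

definition lagrange_basis :: "nat \<Rightarrow> nat \<Rightarrow> complex poly" where
  "lagrange_basis n i = (\<Prod>j\<in>{..n} - {i}. smult (1 / (of_nat i - of_nat j)) [:- of_nat j, 1:])"

lemma degree_lagrange_basis: "i \<le> n \<Longrightarrow> degree (lagrange_basis n i) \<le> n"
proof -
  assume "i \<le> n"
  then have "card ({..n} - {i}) = n" by simp
  moreover have "degree (lagrange_basis n i) \<le> (\<Sum>j\<in>{..n} - {i}. 1)"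
    unfolding lagrange_basis_def
    by (rule order.trans[OF degree_prod_sum_le]) (auto intro!: sum_mono order.trans[OF degree_smult_le])
  ultimately show ?thesis by simp
qed

lemma poly_lagrange_basis:
  "i \<le> n \<Longrightarrow> k \<le> n \<Longrightarrow> poly (lagrange_basis n i) (of_nat k) = (if k = i then 1 else 0)"
  by (cases "k = i")
    (auto simp: lagrange_basis_def poly_prod prod_zero_iff diff_divide_distrib[symmetric] intro!: prod.neutral)

lemma lagrange_interpolation:
  assumes "degree p \<le> n"
  shows "p = (\<Sum>i\<le>n. smult (poly p (of_nat i)) (lagrange_basis n i))" (is "p = ?q")
proof (rule poly_eqI_degree[where A = "of_nat ` {..n}"])
  have "card (of_nat ` {..n} :: complex set) = Suc n"
    by (subst card_image) (auto simp: inj_on_def)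
  moreover have "degree ?q \<le> n"
    by (intro degree_sum_le) (auto intro!: order.trans[OF degree_smult_le] degree_lagrange_basis)
  ultimately show "degree p < card (of_nat ` {..n} :: complex set)" "degree ?q < card (of_nat ` {..n} :: complex set)"
    using assms by auto
  fix z :: complex assume "z \<in> of_nat ` {..n}"
  then obtain k where k: "k \<le> n" "z = of_nat k" by auto
  have "poly ?q z = (\<Sum>i\<le>n. if k = i then poly p (of_nat i) else 0)"
    unfolding poly_sum using k by (intro sum.cong) (auto simp: poly_lagrange_basis)
  then show "poly p z = poly ?q z" using k by simp
qed

section \<open>Integrability and moments\<close>

lemma integrable_cong_space:
  assumes "integrable M g" "\<And>\<omega>. \<omega> \<in> space M \<Longrightarrow> f \<omega> = g \<omega>"
  shows "integrable M f"
proof -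
  have "integrable M f \<longleftrightarrow> integrable M g"
    by (intro Bochner_Integration.integrable_cong refl assms(2))
  then show ?thesis using assms(1) by simp
qed

text \<open>A class closed under domination and finite sums, so any power of the sum of all |H_ij|
  is integrable without appeal to independence.\<close>

definition all_moments :: "'w measure \<Rightarrow> ('w \<Rightarrow> real) \<Rightarrow> bool" where
  "all_moments N f \<longleftrightarrow> f \<in> borel_measurable N \<and> (\<forall>k. integrable N (\<lambda>\<omega>. \<bar>f \<omega>\<bar> ^ k))"

lemma all_moments_mono:
  assumes "all_moments N g" "f \<in> borel_measurable N" "\<And>\<omega>. \<omega> \<in> space N \<Longrightarrow> \<bar>f \<omega>\<bar> \<le> \<bar>g \<omega>\<bar>"
  shows "all_moments N f"
  unfolding all_moments_def
proof (intro conjI allI)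
  fix k
  have "integrable N (\<lambda>\<omega>. \<bar>g \<omega>\<bar> ^ k)" using assms(1) by (simp add: all_moments_def)
  then show "integrable N (\<lambda>\<omega>. \<bar>f \<omega>\<bar> ^ k)"
  proof (rule Bochner_Integration.integrable_bound)
    show "(\<lambda>\<omega>. \<bar>f \<omega>\<bar> ^ k) \<in> borel_measurable N" using assms(2) by measurable
    show "AE \<omega> in N. norm (\<bar>f \<omega>\<bar> ^ k) \<le> norm (\<bar>g \<omega>\<bar> ^ k)"
    proof (rule AE_I2)
      fix \<omega> assume "\<omega> \<in> space N"
      then have "\<bar>f \<omega>\<bar> ^ k \<le> \<bar>g \<omega>\<bar> ^ k" using assms(3) by (intro power_mono) auto
      then show "norm (\<bar>f \<omega>\<bar> ^ k) \<le> norm (\<bar>g \<omega>\<bar> ^ k)" by (simp add: power_abs)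
    qed
  qed
qed (rule assms)

lemma all_moments_add:
  assumes "all_moments N f" "all_moments N g"
  shows "all_moments N (\<lambda>\<omega>. f \<omega> + g \<omega>)"
  unfolding all_moments_def
proof (intro conjI allI)
  have [measurable]: "f \<in> borel_measurable N" "g \<in> borel_measurable N"
    using assms by (auto simp: all_moments_def)
  show "(\<lambda>\<omega>. f \<omega> + g \<omega>) \<in> borel_measurable N" by measurable
  fix k
  have i: "integrable N (\<lambda>\<omega>. 2 ^ k * (\<bar>f \<omega>\<bar> ^ k + \<bar>g \<omega>\<bar> ^ k))"
    using assms by (auto simp: all_moments_def)
  show "integrable N (\<lambda>\<omega>. \<bar>f \<omega> + g \<omega>\<bar> ^ k)"
  proof (rule Bochner_Integration.integrable_bound[OF i], measurable, rule AE_I2)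
    fix \<omega>
    have "\<bar>f \<omega> + g \<omega>\<bar> ^ k \<le> (2 * max \<bar>f \<omega>\<bar> \<bar>g \<omega>\<bar>) ^ k"
      by (intro power_mono) (auto simp: max_def abs_if)
    also have "\<dots> \<le> 2 ^ k * (\<bar>f \<omega>\<bar> ^ k + \<bar>g \<omega>\<bar> ^ k)"
      by (simp add: power_mult_distrib max_def)
    finally show "norm (\<bar>f \<omega> + g \<omega>\<bar> ^ k) \<le> norm (2 ^ k * (\<bar>f \<omega>\<bar> ^ k + \<bar>g \<omega>\<bar> ^ k))"
      by simp
  qed
qed

lemma (in prob_space) all_moments_const: "all_moments M (\<lambda>_. c)"
  by (simp add: all_moments_def)

lemma (in prob_space) all_moments_sum:
  "(\<And>i. i \<in> I \<Longrightarrow> all_moments M (f i)) \<Longrightarrow> all_moments M (\<lambda>\<omega>. \<Sum>i\<in>I. f i \<omega>)"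
  by (induction I rule: infinite_finite_induct) (auto intro: all_moments_add all_moments_const)

lemma normal_moments:
  assumes D: "distributed N lborel X (normal_density 0 \<sigma>)" and "\<sigma> > 0"
  shows "all_moments N X" "(LINT \<omega>|N. X \<omega>) = 0" "(LINT \<omega>|N. (X \<omega>)\<^sup>2) = \<sigma>\<^sup>2"
proof -
  have pos: "\<And>x. 0 \<le> normal_density 0 \<sigma> x" by simp
  have "integrable N (\<lambda>\<omega>. \<bar>X \<omega>\<bar> ^ k)" for k
    using distributed_integrable[OF D, of "\<lambda>x. \<bar>x\<bar> ^ k"] integrable_normal_moment_abs[OF \<open>\<sigma> > 0\<close>, of 0 k]
    by simp
  moreover have "X \<in> borel_measurable N" using distributed_measurable[OF D] by simp
  ultimately show "all_moments N X" by (simp add: all_moments_def)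
  show "(LINT \<omega>|N. X \<omega>) = 0"
    using distributed_integral[OF D, of "\<lambda>x. x"] integral_normal_moment_odd[OF \<open>\<sigma> > 0\<close>, of 0 0]
    by simp
  show "(LINT \<omega>|N. (X \<omega>)\<^sup>2) = \<sigma>\<^sup>2"
    using distributed_integral[OF D, of "\<lambda>x. x\<^sup>2"] integral_normal_moment_even[OF \<open>\<sigma> > 0\<close>, of 0 1] \<open>\<sigma> > 0\<close>
    by (simp add: power2_eq_square ac_simps)
qed

lemma all_moments_integrable:
  assumes "all_moments N X"
  shows "integrable N X" "integrable N (\<lambda>\<omega>. (X \<omega>)\<^sup>2)"
proof -
  have m: "X \<in> borel_measurable N" and i: "\<And>k. integrable N (\<lambda>\<omega>. \<bar>X \<omega>\<bar> ^ k)"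
    using assms by (auto simp: all_moments_def)
  show "integrable N X" using i[of 1] m by (simp add: integrable_abs_iff)
  show "integrable N (\<lambda>\<omega>. (X \<omega>)\<^sup>2)" using i[of 2] by simp
qed

section \<open>Random entries and the expected determinant\<close>

lemma matrix_entry_measurable:
  assumes "random_hermitian N n X" "j < n" "k < n"
  shows "(\<lambda>\<omega>. X \<omega> $$ (j, k)) \<in> borel_measurable N"
proof -
  have "(\<lambda>\<omega>. matrix_entries n (X \<omega>) (j, k)) \<in> borel_measurable N"
    using assms measurable_compose[of "\<lambda>\<omega>. matrix_entries n (X \<omega>)" N _ "\<lambda>f. f (j, k)"]
    by (auto simp: random_hermitian_def intro!: measurable_component_singleton)
  then show ?thesis using assms(2,3) by (simp add: matrix_entries_def)
qed

lemma random_hermitian_entries: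
  assumes "random_hermitian N n X" "\<omega> \<in> space N"
  shows "X \<omega> \<in> carrier_mat n n" "hermitian_array n (entries (X \<omega>))"
  using assms by (auto simp: random_hermitian_def intro!: hermitian_entries)

context
  fixes N :: "'w measure" and n :: nat and H :: "'w \<Rightarrow> complex mat"
  assumes N: "prob_space N" and gue: "gue N n H"
begin

interpretation prob_space N by (rule N)

lemma gue_hermitian: "random_hermitian N n H"
  using gue by (simp add: gue_def)

lemma gue_conj: "\<omega> \<in> space N \<Longrightarrow> i < n \<Longrightarrow> j < n \<Longrightarrow> H \<omega> $$ (i, j) = cnj (H \<omega> $$ (j, i))"
  using random_hermitian_entries(2)[OF gue_hermitian] unfolding hermitian_array_def entries_def by blast

lemma gue_upper_moments:
  assumes "j < k" "k < n"
  shows "all_moments N (\<lambda>\<omega>. norm (H \<omega> $$ (j, k)))"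
    and "integrable N (\<lambda>\<omega>. H \<omega> $$ (j, k))" "(LINT \<omega>|N. H \<omega> $$ (j, k)) = 0"
    and "integrable N (\<lambda>\<omega>. H \<omega> $$ (j, k) * cnj (H \<omega> $$ (j, k)))"
    and "(LINT \<omega>|N. H \<omega> $$ (j, k) * cnj (H \<omega> $$ (j, k))) = 1"
proof -
  let ?R = "\<lambda>\<omega>. Re (H \<omega> $$ (j, k))" and ?I = "\<lambda>\<omega>. Im (H \<omega> $$ (j, k))"
  have D: "distributed N lborel ?R (normal_density 0 (1 / sqrt 2))"
    "distributed N lborel ?I (normal_density 0 (1 / sqrt 2))"
    using gue assms by (auto simp: gue_def)
  note R = normal_moments[OF D(1)] and I = normal_moments[OF D(2)]
  have mR: "all_moments N ?R" and mI: "all_moments N ?I" using R I by auto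
  have meas [measurable]: "(\<lambda>\<omega>. H \<omega> $$ (j, k)) \<in> borel_measurable N"
    using matrix_entry_measurable[OF gue_hermitian] assms by auto
  have abs: "all_moments N (\<lambda>\<omega>. \<bar>?R \<omega>\<bar>)" "all_moments N (\<lambda>\<omega>. \<bar>?I \<omega>\<bar>)"
    using mR mI by (auto simp: all_moments_def)
  show "all_moments N (\<lambda>\<omega>. norm (H \<omega> $$ (j, k)))"
    using cmod_le by (intro all_moments_mono[OF all_moments_add[OF abs]]) auto
  have "integrable N (\<lambda>\<omega>. complex_of_real (?R \<omega>) + \<i> * complex_of_real (?I \<omega>))"
    using all_moments_integrable(1)[OF mR] all_moments_integrable(1)[OF mI]
    by (intro Bochner_Integration.integrable_add integrable_mult_right integrable_of_real)
  then show int: "integrable N (\<lambda>\<omega>. H \<omega> $$ (j, k))"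
    by (simp only: complex_eq[symmetric])
  show "(LINT \<omega>|N. H \<omega> $$ (j, k)) = 0"
    using integral_Re[OF int] integral_Im[OF int] R(2) I(2) by (simp add: complex_eq_iff)
  have eq: "H \<omega> $$ (j, k) * cnj (H \<omega> $$ (j, k)) = complex_of_real ((?R \<omega>)\<^sup>2 + (?I \<omega>)\<^sup>2)" for \<omega>
    by (rule complex_mult_cnj)
  have sq: "integrable N (\<lambda>\<omega>. (?R \<omega>)\<^sup>2)" "integrable N (\<lambda>\<omega>. (?I \<omega>)\<^sup>2)"
    using all_moments_integrable(2)[OF mR] all_moments_integrable(2)[OF mI] by auto
  show "integrable N (\<lambda>\<omega>. H \<omega> $$ (j, k) * cnj (H \<omega> $$ (j, k)))"
    unfolding eq by (intro integrable_of_real Bochner_Integration.integrable_add sq)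
  show "(LINT \<omega>|N. H \<omega> $$ (j, k) * cnj (H \<omega> $$ (j, k))) = 1"
  proof -
    have "(LINT \<omega>|N. (?R \<omega>)\<^sup>2 + (?I \<omega>)\<^sup>2) = 1"
      using sq R(3) I(3) by (simp add: power_divide)
    then show ?thesis unfolding eq integral_complex_of_real by (simp only: of_real_1)
  qed
qed

lemma gue_diagonal_moments:
  assumes "j < n"
  shows "all_moments N (\<lambda>\<omega>. norm (H \<omega> $$ (j, j)))"
    and "integrable N (\<lambda>\<omega>. H \<omega> $$ (j, j))" "(LINT \<omega>|N. H \<omega> $$ (j, j)) = 0"
proof -
  let ?R = "\<lambda>\<omega>. Re (H \<omega> $$ (j, j))"
  have D: "distributed N lborel ?R (normal_density 0 1)" and one: "(0::real) < 1"
    using gue assms by (auto simp: gue_def)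
  note R = normal_moments[OF D one]
  have meas [measurable]: "(\<lambda>\<omega>. H \<omega> $$ (j, j)) \<in> borel_measurable N"
    using matrix_entry_measurable[OF gue_hermitian] assms by auto
  \<comment> \<open>\<open>gue\<close> prescribes the law of the real part; Hermitian symmetry makes
    the imaginary part vanish.\<close>
  have real: "H \<omega> $$ (j, j) = complex_of_real (?R \<omega>)" if "\<omega> \<in> space N" for \<omega>
    using arg_cong[OF gue_conj[OF that assms assms], of Im] by (simp add: complex_eq_iff)
  have "norm (H \<omega> $$ (j, j)) = \<bar>?R \<omega>\<bar>" if "\<omega> \<in> space N" for \<omega>
    by (subst real[OF that]) simp
  then show "all_moments N (\<lambda>\<omega>. norm (H \<omega> $$ (j, j)))"
    by (intro all_moments_mono[OF R(1)]) auto
  show "integrable N (\<lambda>\<omega>. H \<omega> $$ (j, j))"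
    by (rule integrable_cong_space[OF integrable_of_real[OF all_moments_integrable(1)[OF R(1)]] real])
  have "(LINT \<omega>|N. H \<omega> $$ (j, j)) = (LINT \<omega>|N. complex_of_real (?R \<omega>))"
    by (intro Bochner_Integration.integral_cong refl real)
  then show "(LINT \<omega>|N. H \<omega> $$ (j, j)) = 0"
    using R(2) by simp
qed

lemma gue_moments:
  assumes "j < n" "k < n"
  shows "all_moments N (\<lambda>\<omega>. norm (H \<omega> $$ (j, k)))"
proof (cases "k < j")
  case True
  have "norm (H \<omega> $$ (j, k)) = norm (H \<omega> $$ (k, j))" if "\<omega> \<in> space N" for \<omega>
    by (subst gue_conj[OF that assms]) simp
  then show ?thesis
    using gue_upper_moments(1)[OF True assms(1)] matrix_entry_measurable[OF gue_hermitian assms]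
    by (intro all_moments_mono[OF gue_upper_moments(1)[OF True assms(1)]]) auto
next
  case False
  then show ?thesis
    using gue_upper_moments(1) gue_diagonal_moments(1) assms by (cases "j = k") auto
qed

text \<open>The rows i whose factor in the Leibniz term of \<open>\<sigma>\<close> involves the same
  independent entry, indexed by the pair {i, \<open>\<sigma> i\<close>} with the smaller index
  first.\<close>

definition position_class :: "(nat \<Rightarrow> nat) \<Rightarrow> nat \<times> nat \<Rightarrow> nat set" where
  "position_class \<sigma> e = {i \<in> {..<n}. (min i (\<sigma> i), max i (\<sigma> i)) = e}"

definition class_factor :: "(nat \<Rightarrow> nat) \<Rightarrow> (nat \<Rightarrow> nat \<Rightarrow> complex) \<Rightarrow> nat \<times> nat \<Rightarrow> complex \<Rightarrow> complex" where
  "class_factor \<sigma> a e h = (\<Prod>i\<in>position_class \<sigma> e. a i (\<sigma> i) - (if i \<le> \<sigma> i then h else cnj h))"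

lemma position_class_diagonal: "j < n \<Longrightarrow> position_class \<sigma> (j, j) = (if \<sigma> j = j then {j} else {})"
  by (auto simp: position_class_def min_def max_def split: if_splits)

lemma position_class_upper:
  "j < k \<Longrightarrow> k < n \<Longrightarrow> position_class \<sigma> (j, k) =
    (if \<sigma> j = k then {j} else {}) \<union> (if \<sigma> k = j then {k} else {})"
  by (auto simp: position_class_def min_def max_def split: if_splits)

text \<open>A class has two rows only for a 2-cycle; then h and its conjugate meet and E|h|^2 = 1
  gives the extra summand. A class of one row is linear in a centred entry, so the randomness drops
  out, and an empty class gives 1. Longer cycles meet each pair at most once.\<close>

lemma class_factor_expectation:
  assumes e: "e = (j, k)" "j \<le> k" "k < n"
  shows "integrable N (\<lambda>\<omega>. class_factor \<sigma> a e (H \<omega> $$ e))" (is ?int)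
    and "(LINT \<omega>|N. class_factor \<sigma> a e (H \<omega> $$ e)) = (\<Prod>i\<in>position_class \<sigma> e. wick_factor {..<n} \<sigma> a i)" (is ?eq)
proof -
  have "?int \<and> ?eq"
  proof (cases "j = k")
    case True
    then show ?thesis
      using gue_diagonal_moments(2,3)[of j] e
      by (simp add: class_factor_def position_class_diagonal wick_factor_def prob_space)
  next
    case False
    then have jk: "j < k" "k < n" "j < n" using e by auto
    let ?h = "\<lambda>\<omega>. H \<omega> $$ (j, k)"
    note m = gue_upper_moments(2-5)[OF jk(1,2)]
    have c: "integrable N (\<lambda>\<omega>. cnj (?h \<omega>))" "(LINT \<omega>|N. cnj (?h \<omega>)) = 0"
      using m(1,2) by (simp_all add: integral_cnj)
    show ?thesis
    proof (cases "\<sigma> j = k \<and> \<sigma> k = j")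
      case True
      have "class_factor \<sigma> a e (?h \<omega>) = a j k * a k j - a j k * cnj (?h \<omega>) - a k j * ?h \<omega> + ?h \<omega> * cnj (?h \<omega>)" for \<omega>
        using True jk by (simp add: class_factor_def position_class_upper e algebra_simps)
      moreover have "(\<Prod>i\<in>position_class \<sigma> e. wick_factor {..<n} \<sigma> a i) = a j k * a k j + 1"
        using True jk by (simp add: position_class_upper e wick_factor_def)
      ultimately show ?thesis
        using m c e by (simp add: prob_space)
    next
      case False
      then consider "\<sigma> j = k" "\<sigma> k \<noteq> j" | "\<sigma> j \<noteq> k" "\<sigma> k = j" | "\<sigma> j \<noteq> k" "\<sigma> k \<noteq> j" by blast
      then show ?thesis
        using m(1,2) c jk
        by cases (simp_all add: class_factor_def position_class_upper e wick_factor_def prob_space)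
    qed
  qed
  then show ?int ?eq by auto
qed

text \<open>Within one Leibniz term, entries above and below the diagonal are dependent; grouping
  the rows by unordered pair restores independence, so the expectation factorizes over the
  classes.\<close>

lemma gue_expected_det:
  "integrable N (\<lambda>\<omega>. mdet n (\<lambda>i j. a i j - H \<omega> $$ (i, j)))" (is ?int)
  "(LINT \<omega>|N. mdet n (\<lambda>i j. a i j - H \<omega> $$ (i, j))) = wick_det n {..<n} a" (is ?eq)
proof -
  define I where "I = {(j, k). j \<le> k \<and> k < n}"
  have fin: "finite I"
    by (rule finite_subset[of _ "{..<n} \<times> {..<n}"]) (auto simp: I_def)
  have group: "(\<Prod>e\<in>I. \<Prod>i\<in>position_class \<sigma> e. g i) = (\<Prod>i<n. g i)" if \<sigma>: "\<sigma> permutes {..<n}" for \<sigma> and g :: "nat \<Rightarrow> complex"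
    unfolding position_class_def
  proof (rule prod.group[OF finite_lessThan fin], rule image_subsetI)
    fix i assume "i \<in> {..<n}"
    then have "i < n" "\<sigma> i < n" using permutes_in_image[OF \<sigma>, of i] by auto
    then show "(min i (\<sigma> i), max i (\<sigma> i)) \<in> I" by (auto simp: I_def)
  qed
  have factor: "(\<Prod>i<n. a i (\<sigma> i) - H \<omega> $$ (i, \<sigma> i)) = (\<Prod>e\<in>I. class_factor \<sigma> a e (H \<omega> $$ e))"
    if \<sigma>: "\<sigma> permutes {..<n}" and \<omega>: "\<omega> \<in> space N" for \<sigma> \<omega>
  proof -
    have "class_factor \<sigma> a e (H \<omega> $$ e) = (\<Prod>i\<in>position_class \<sigma> e. a i (\<sigma> i) - H \<omega> $$ (i, \<sigma> i))" for e
      unfolding class_factor_def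
    proof (intro prod.cong refl arg_cong2[of _ _ _ _ "(-)"])
      fix i assume i: "i \<in> position_class \<sigma> e"
      then have "i < n" "\<sigma> i < n" "e = (min i (\<sigma> i), max i (\<sigma> i))"
        using permutes_in_image[OF \<sigma>, of i] by (auto simp: position_class_def)
      then show "(if i \<le> \<sigma> i then H \<omega> $$ e else cnj (H \<omega> $$ e)) = H \<omega> $$ (i, \<sigma> i)"
        using gue_conj[OF \<omega>, of i "\<sigma> i"] by (auto simp: min_def max_def)
    qed
    then show ?thesis using group[OF \<sigma>] by simp
  qed
  have indep: "indep_vars (\<lambda>_. borel) (\<lambda>e \<omega>. class_factor \<sigma> a e (H \<omega> $$ e)) I" for \<sigma>
  proof -
    have "indep_vars (\<lambda>_. borel) (\<lambda>e \<omega>. H \<omega> $$ e) I"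
      using gue by (simp add: gue_def I_def case_prod_unfold)
    moreover have "(\<lambda>h::complex. if i \<le> \<sigma> i then h else cnj h) \<in> borel_measurable borel" for i
      by (cases "i \<le> \<sigma> i") (auto intro!: borel_measurable_continuous_onI continuous_intros)
    then have "class_factor \<sigma> a e \<in> borel_measurable borel" for e
      unfolding class_factor_def by (intro borel_measurable_prod borel_measurable_diff borel_measurable_const)
    ultimately show ?thesis by (rule indep_vars_compose2)
  qed
  have I_int: "integrable N (\<lambda>\<omega>. class_factor \<sigma> a e (H \<omega> $$ e))"
    "(LINT \<omega>|N. class_factor \<sigma> a e (H \<omega> $$ e)) = (\<Prod>i\<in>position_class \<sigma> e. wick_factor {..<n} \<sigma> a i)"
    if "e \<in> I" for e \<sigma>
    using that class_factor_expectation[of e "fst e" "snd e" \<sigma> a] by (auto simp: I_def)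
  have perm_int: "integrable N (\<lambda>\<omega>. \<Prod>i<n. a i (\<sigma> i) - H \<omega> $$ (i, \<sigma> i))" if \<sigma>: "\<sigma> permutes {..<n}" for \<sigma>
    by (rule integrable_cong_space[OF indep_vars_integrable[OF fin indep I_int(1)] factor[OF \<sigma>]])
  have perm_eq: "(LINT \<omega>|N. (\<Prod>i<n. a i (\<sigma> i) - H \<omega> $$ (i, \<sigma> i))) = (\<Prod>i<n. wick_factor {..<n} \<sigma> a i)"
    if \<sigma>: "\<sigma> permutes {..<n}" for \<sigma>
  proof -
    have "(LINT \<omega>|N. (\<Prod>i<n. a i (\<sigma> i) - H \<omega> $$ (i, \<sigma> i))) =
        (LINT \<omega>|N. (\<Prod>e\<in>I. class_factor \<sigma> a e (H \<omega> $$ e)))"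
      by (intro Bochner_Integration.integral_cong refl factor[OF \<sigma>])
    also have "\<dots> = (\<Prod>e\<in>I. LINT \<omega>|N. class_factor \<sigma> a e (H \<omega> $$ e))"
      by (rule indep_vars_lebesgue_integral[OF fin indep I_int(1)])
    also have "\<dots> = (\<Prod>e\<in>I. \<Prod>i\<in>position_class \<sigma> e. wick_factor {..<n} \<sigma> a i)"
      by (intro prod.cong refl I_int(2))
    also have "\<dots> = (\<Prod>i<n. wick_factor {..<n} \<sigma> a i)" by (rule group[OF \<sigma>])
    finally show ?thesis .
  qed
  show ?int
    unfolding mdet_leibniz by (intro Bochner_Integration.integrable_sum integrable_mult_right perm_int) auto
  show ?eq
    unfolding mdet_leibniz wick_det_def
    by (subst Bochner_Integration.integral_sum) (auto simp: perm_int perm_eq)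
qed

end

text \<open>Fubini for an independent pair, pulled back to the original space: an independent copy
  of X is X at a second sample point, while Y stays frozen at the first.\<close>

lemma (in prob_space) integral_independent_pair:
  fixes \<Phi> :: "_ \<Rightarrow> 'b::{banach, second_countable_topology}"
  assumes ind: "indep_var S X T Y" and \<Phi>: "\<Phi> \<in> borel_measurable (S \<Otimes>\<^sub>M T)"
    and int: "integrable M (\<lambda>\<omega>. \<Phi> (X \<omega>, Y \<omega>))"
  shows "(LINT \<omega>|M. \<Phi> (X \<omega>, Y \<omega>)) = (LINT \<omega>|M. LINT \<omega>'|M. \<Phi> (X \<omega>', Y \<omega>))"
proof -
  have X [measurable]: "random_variable S X" and Y [measurable]: "random_variable T Y"
    and prod: "distr M S X \<Otimes>\<^sub>M distr M T Y = distr M (S \<Otimes>\<^sub>M T) (\<lambda>\<omega>. (X \<omega>, Y \<omega>))"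
    using ind by (auto simp: indep_var_distribution_eq)
  interpret X: prob_space "distr M S X" by (rule prob_space_distr) fact
  interpret Y: prob_space "distr M T Y" by (rule prob_space_distr) fact
  interpret XY: pair_prob_space "distr M S X" "distr M T Y" ..
  have pair: "(\<lambda>\<omega>. (X \<omega>, Y \<omega>)) \<in> M \<rightarrow>\<^sub>M S \<Otimes>\<^sub>M T" by measurable
  have int': "integrable (distr M S X \<Otimes>\<^sub>M distr M T Y) (\<lambda>(x, y). \<Phi> (x, y))"
    using integrable_distr_eq[OF pair \<Phi>] int by (simp add: prod)
  have "(LINT \<omega>|M. \<Phi> (X \<omega>, Y \<omega>)) = (LINT z|distr M (S \<Otimes>\<^sub>M T) (\<lambda>\<omega>. (X \<omega>, Y \<omega>)). \<Phi> z)"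
    using integral_distr[OF pair \<Phi>] by simp
  also have "\<dots> = (LINT y|distr M T Y. LINT x|distr M S X. \<Phi> (x, y))"
    using XY.integral_snd[OF int'] by (simp add: prod)
  also have "\<dots> = (LINT y|distr M T Y. LINT \<omega>'|M. \<Phi> (X \<omega>', y))"
  proof (intro Bochner_Integration.integral_cong refl)
    fix y assume "y \<in> space (distr M T Y)"
    then have "(\<lambda>x. \<Phi> (x, y)) \<in> borel_measurable S"
      using \<Phi> by (intro measurable_compose[OF measurable_Pair2' \<Phi>]) simp
    then show "(LINT x|distr M S X. \<Phi> (x, y)) = (LINT \<omega>'|M. \<Phi> (X \<omega>', y))"
      by (rule integral_distr[OF X])
  qed
  also have "\<dots> = (LINT \<omega>|M. LINT \<omega>'|M. \<Phi> (X \<omega>', Y \<omega>))"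
  proof (rule integral_distr[OF Y])
    have "(\<lambda>(y, \<omega>'). \<Phi> (X \<omega>', y)) \<in> borel_measurable (T \<Otimes>\<^sub>M M)"
      using \<Phi> by measurable
    then show "(\<lambda>y. LINT \<omega>'|M. \<Phi> (X \<omega>', y)) \<in> borel_measurable T"
      by (rule borel_measurable_lebesgue_integral)
  qed
  finally show ?thesis .
qed

text \<open>Interpolation writes the random polynomial as a fixed combination of its values at n + 1
  real nodes, which are integrable, so expectation passes through every linear functional. It is
  needed for evaluation at the nonreal point x + i and for the Hermite transform evaluated at
  x.\<close>

lemma linear_functional_char_poly:
  fixes \<phi> :: "complex poly \<Rightarrow> complex"
  assumes X: "random_hermitian N n X" and avg: "average_char_poly N n X (poly r)"
    and add: "\<And>p q. \<phi> (p + q) = \<phi> p + \<phi> q" and scale: "\<And>c p. \<phi> (smult c p) = c * \<phi> p"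
  shows "integrable N (\<lambda>\<omega>. \<phi> (char_poly (X \<omega>)))"
    and "(LINT \<omega>|N. \<phi> (char_poly (X \<omega>))) = \<phi> (map_poly of_real r)"
proof -
  have "\<phi> 0 = 0" using scale[of 0 0] by simp
  then have sum: "\<phi> (\<Sum>i\<in>A. p i) = (\<Sum>i\<in>A. \<phi> (p i))" for p :: "nat \<Rightarrow> complex poly" and A
    by (induction A rule: infinite_finite_induct) (auto simp: add)
  let ?\<chi> = "\<lambda>\<omega>. char_poly (X \<omega>)"
  have chi: "poly (?\<chi> \<omega>) (of_real y) = of_real (\<Prod>j<n. y - eigs n (X \<omega>) j)" if "\<omega> \<in> space N" for \<omega> y
    using prod_eigs random_hermitian_entries[OF X that] by metis
  have int: "integrable N (\<lambda>\<omega>. poly (?\<chi> \<omega>) (of_real y))"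
    and val: "(LINT \<omega>|N. poly (?\<chi> \<omega>) (of_real y)) = of_real (poly r y)" for y
  proof -
    have e: "integrable N (\<lambda>\<omega>. \<Prod>j<n. y - eigs n (X \<omega>) j)"
      "poly r y = (LINT \<omega>|N. (\<Prod>j<n. y - eigs n (X \<omega>) j))"
      using avg by (auto simp: average_char_poly_def)
    show "integrable N (\<lambda>\<omega>. poly (?\<chi> \<omega>) (of_real y))"
      by (rule integrable_cong_space[OF integrable_of_real[OF e(1)] chi])
    show "(LINT \<omega>|N. poly (?\<chi> \<omega>) (of_real y)) = of_real (poly r y)"
      unfolding e(2) integral_complex_of_real[symmetric]
      by (intro Bochner_Integration.integral_cong refl chi)
  qed
  have inter: "?\<chi> \<omega> = (\<Sum>i\<le>n. smult (poly (?\<chi> \<omega>) (of_real (real i))) (lagrange_basis n i))"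
    if "\<omega> \<in> space N" for \<omega>
    using lagrange_interpolation[of "?\<chi> \<omega>" n] degree_monic_char_poly[OF random_hermitian_entries(1)[OF X that]]
    by simp
  \<comment> \<open>Used twice: with evaluation at a node, to identify the averaged polynomial, and
    then with \<open>\<phi>\<close> itself.\<close>
  have functional: "integrable N (\<lambda>\<omega>. \<psi> (?\<chi> \<omega>)) \<and>
      (LINT \<omega>|N. \<psi> (?\<chi> \<omega>)) = (\<Sum>i\<le>n. of_real (poly r (real i)) * \<psi> (lagrange_basis n i))"
    if "\<And>\<omega>. \<omega> \<in> space N \<Longrightarrow> \<psi> (?\<chi> \<omega>) = (\<Sum>i\<le>n. poly (?\<chi> \<omega>) (of_real (real i)) * \<psi> (lagrange_basis n i))"
    for \<psi> :: "complex poly \<Rightarrow> complex"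
  proof -
    have "integrable N (\<lambda>\<omega>. \<Sum>i\<le>n. poly (?\<chi> \<omega>) (of_real (real i)) * \<psi> (lagrange_basis n i))"
      by (intro Bochner_Integration.integrable_sum integrable_mult_left int)
    moreover have "(LINT \<omega>|N. (\<Sum>i\<le>n. poly (?\<chi> \<omega>) (of_real (real i)) * \<psi> (lagrange_basis n i))) =
        (\<Sum>i\<le>n. of_real (poly r (real i)) * \<psi> (lagrange_basis n i))"
      by (subst Bochner_Integration.integral_sum)
         (simp_all only: integrable_mult_left int integral_mult_left_zero val)
    moreover have "(LINT \<omega>|N. \<psi> (?\<chi> \<omega>)) =
        (LINT \<omega>|N. (\<Sum>i\<le>n. poly (?\<chi> \<omega>) (of_real (real i)) * \<psi> (lagrange_basis n i)))"
      by (intro Bochner_Integration.integral_cong refl that)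
    ultimately show ?thesis using integrable_cong_space[OF _ that] by simp
  qed
  define R where "R = (\<Sum>i\<le>n. smult (complex_of_real (poly r (real i))) (lagrange_basis n i))"
  have "map_poly of_real r = R"
  \<comment> \<open>The degree of \<open>r\<close> is not prescribed, so the number of nodes is
    chosen to exceed the degrees of both polynomials.\<close>
  proof (rule poly_eqI_degree[where A = "of_nat ` {..degree r + degree R}"])
    have "card (of_nat ` {..degree r + degree R} :: complex set) = Suc (degree r + degree R)"
      by (subst card_image) (auto simp: inj_on_def)
    then show "degree (map_poly complex_of_real r) < card (of_nat ` {..degree r + degree R} :: complex set)"
      "degree R < card (of_nat ` {..degree r + degree R} :: complex set)" by auto
    fix z :: complex assume "z \<in> of_nat ` {..degree r + degree R}"
    then obtain k where z: "z = of_real (real k)" by auto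
    have "poly (?\<chi> \<omega>) z = (\<Sum>i\<le>n. poly (?\<chi> \<omega>) (of_real (real i)) * poly (lagrange_basis n i) z)"
      if "\<omega> \<in> space N" for \<omega>
      using arg_cong[OF inter[OF that], of "\<lambda>p. poly p z"] by (simp only: poly_sum poly_smult)
    from functional[of "\<lambda>p. poly p z", OF this] have "of_real (poly r (real k)) = poly R z"
      unfolding z val by (simp add: R_def poly_sum)
    then show "poly (map_poly of_real r) z = poly R z"
      unfolding z using cpoly_of_real[of r "real k"] by (simp add: cpoly_def)
  qed
  moreover have "\<phi> (?\<chi> \<omega>) = (\<Sum>i\<le>n. poly (?\<chi> \<omega>) (of_real (real i)) * \<phi> (lagrange_basis n i))"
    if "\<omega> \<in> space N" for \<omega>
    using arg_cong[OF inter[OF that], of \<phi>] by (simp only: sum scale)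
  ultimately show "integrable N (\<lambda>\<omega>. \<phi> (?\<chi> \<omega>))"
    "(LINT \<omega>|N. \<phi> (?\<chi> \<omega>)) = \<phi> (map_poly of_real r)"
    using functional[of \<phi>] by (simp_all add: R_def sum scale)
qed

lemma measurable_mdet_entries:
  assumes "\<And>i j. i < n \<Longrightarrow> j < n \<Longrightarrow> (\<lambda>z. b z i j) \<in> borel_measurable M"
  shows "(\<lambda>z. mdet n (b z) :: complex) \<in> borel_measurable M"
  unfolding mdet_leibniz
proof (intro borel_measurable_sum borel_measurable_times borel_measurable_const borel_measurable_prod)
  fix \<sigma> i assume "\<sigma> \<in> {\<sigma>. \<sigma> permutes {..<n}}" "i \<in> {..<n}"
  then show "(\<lambda>z. b z i (\<sigma> i)) \<in> borel_measurable M"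
    using permutes_in_image[of \<sigma> "{..<n}" i] by (intro assms) auto
qed

lemma average_char_poly_gue_sum:
  assumes N: "prob_space N" and gue: "gue N n H" and M: "random_hermitian N n M"
    and ind: "independent_matrices N n H M" and avg: "average_char_poly N n M (poly r)"
  shows "average_char_poly N n (\<lambda>\<omega>. H \<omega> + M \<omega>) (poly (hermite_transform r))"
proof -
  interpret prob_space N by (rule N)
  have H: "random_hermitian N n H" using gue by (simp add: gue_def)
  let ?S = "Pi\<^sub>M ({..<n} \<times> {..<n}) (\<lambda>_. borel) :: (nat \<times> nat \<Rightarrow> complex) measure"
  let ?h = "\<lambda>\<omega>. matrix_entries n (H \<omega>)" and ?m = "\<lambda>\<omega>. matrix_entries n (M \<omega>)"
  have ind': "indep_var ?S ?h ?S ?m" using ind by (simp add: independent_matrices_def)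
  have comp: "(\<lambda>\<alpha>. \<alpha> (i, j)) \<in> borel_measurable ?S" if "i < n" "j < n" for i j
    using that by (intro measurable_component_singleton) auto
  \<comment> \<open>The sum over all entries dominates every column sum, as the perturbation bound
    requires.\<close>
  define s where "s \<alpha> = (\<Sum>i<n. \<Sum>j<n. norm (\<alpha> (i, j)))" for \<alpha> :: "nat \<times> nat \<Rightarrow> complex"
  define C where "C \<alpha> = fact n * (2 + s \<alpha>) ^ n" for \<alpha>
  have s_meas: "s \<in> borel_measurable ?S"
    unfolding s_def by (intro borel_measurable_sum measurable_compose[OF comp borel_measurable_norm]) auto
  have "all_moments N (\<lambda>\<omega>. 2 + s (?h \<omega>))"
    unfolding s_def
    by (intro all_moments_add all_moments_const all_moments_sum)
       (auto simp: matrix_entries_def gue_moments[OF N gue])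
  moreover have s0: "0 \<le> s \<alpha>" for \<alpha> by (simp add: s_def sum_nonneg)
  moreover have "\<bar>2 + s \<alpha>\<bar> = 2 + s \<alpha>" for \<alpha> using s0[of \<alpha>] by simp
  ultimately have C_int: "integrable N (\<lambda>\<omega>. C (?h \<omega>))"
    by (auto simp: all_moments_def C_def)
  have C_meas: "C \<in> borel_measurable ?S"
    unfolding C_def using s_meas by measurable
  have sum_entries: "H \<omega> + M \<omega> \<in> carrier_mat n n" "hermitian_array n (entries (H \<omega> + M \<omega>))"
    if "\<omega> \<in> space N" for \<omega>
  proof -
    note rh = random_hermitian_entries[OF H that] and rm = random_hermitian_entries[OF M that]
    show "H \<omega> + M \<omega> \<in> carrier_mat n n" using rh rm by simp
    have e: "entries (H \<omega> + M \<omega>) i j = entries (H \<omega>) i j + entries (M \<omega>) i j" if "i < n" "j < n" for i j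
      using rh(1) rm(1) that by (simp add: entries_def)
    show "hermitian_array n (entries (H \<omega> + M \<omega>))"
      unfolding hermitian_array_def
    proof (intro allI impI)
      fix i j assume ij: "i < n" "j < n"
      have "entries (H \<omega>) i j = cnj (entries (H \<omega>) j i)" "entries (M \<omega>) i j = cnj (entries (M \<omega>) j i)"
        using rh(2) rm(2) ij unfolding hermitian_array_def by blast+
      then show "entries (H \<omega> + M \<omega>) i j = cnj (entries (H \<omega> + M \<omega>) j i)"
        unfolding e[OF ij] e[OF ij(2,1)] complex_cnj_add by (rule arg_cong2)
    qed
  qed
  have "integrable N (\<lambda>\<omega>. \<Prod>j<n. x - eigs n (H \<omega> + M \<omega>) j) \<and>
      poly (hermite_transform r) x = (LINT \<omega>|N. (\<Prod>j<n. x - eigs n (H \<omega> + M \<omega>) j))" for x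
  proof -
    \<comment> \<open>\<open>a\<close>, \<open>\<Phi>\<close> and \<open>D\<close> are functions of
      entry families rather than of matrices, because independence and measurability are stated for
      the entries.\<close>
    define a where "a \<beta> i j = (if i = j then complex_of_real x else 0) - \<beta> (i, j)" for \<beta> :: "nat \<times> nat \<Rightarrow> complex" and i j
    define \<Phi> where "\<Phi> z = mdet n (\<lambda>i j. a (snd z) i j - fst z (i, j))" for z
    define D where "D \<beta> = norm (mdet n (\<lambda>i j. a \<beta> i j + (if i = j then \<i> else 0)))" for \<beta>
    have \<Phi>_meas: "\<Phi> \<in> borel_measurable (?S \<Otimes>\<^sub>M ?S)"
      unfolding \<Phi>_def a_def
    proof (rule measurable_mdet_entries)
      fix i j assume "i < n" "j < n"
      then have [measurable]: "(\<lambda>\<alpha>. \<alpha> (i, j)) \<in> borel_measurable ?S" by (rule comp)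
      show "(\<lambda>z. (if i = j then complex_of_real x else 0) - snd z (i, j) - fst z (i, j)) \<in> borel_measurable (?S \<Otimes>\<^sub>M ?S)"
        by measurable
    qed
    have D_meas: "D \<in> borel_measurable ?S"
      unfolding D_def a_def
    proof (rule measurable_compose[OF measurable_mdet_entries borel_measurable_norm])
      fix i j assume "i < n" "j < n"
      then have [measurable]: "(\<lambda>\<alpha>. \<alpha> (i, j)) \<in> borel_measurable ?S" by (rule comp)
      show "(\<lambda>\<beta>. (if i = j then complex_of_real x else 0) - \<beta> (i, j) + (if i = j then \<i> else 0)) \<in> borel_measurable ?S"
        by measurable
    qed
    have a_m: "a (?m \<omega>) i j = (if i = j then complex_of_real x else 0) - entries (M \<omega>) i j"
      if "i < n" "j < n" for \<omega> i j
      using that by (simp add: a_def matrix_entries_def entries_def)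
    have a_herm: "hermitian_array n (a (?m \<omega>))" if "\<omega> \<in> space N" for \<omega>
      unfolding hermitian_array_def
    proof (intro allI impI)
      fix i j assume ij: "i < n" "j < n"
      have "entries (M \<omega>) i j = cnj (entries (M \<omega>) j i)"
        using random_hermitian_entries(2)[OF M that] ij unfolding hermitian_array_def by blast
      then have "cnj (entries (M \<omega>) j i) = entries (M \<omega>) i j" by (rule sym)
      then show "a (?m \<omega>) i j = cnj (a (?m \<omega>) j i)"
        using ij by (simp add: a_m)
    qed
    have D_int: "integrable N (\<lambda>\<omega>. D (?m \<omega>))"
    proof -
      \<comment> \<open>The shift of x - M by i moves the evaluation point of the characteristic
        polynomial of M from x to x + i.\<close>
      have eq: "D (?m \<omega>) = norm (poly (char_poly (M \<omega>)) (of_real x + \<i>))" if "\<omega> \<in> space N" for \<omega>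
        unfolding D_def poly_char_poly[OF random_hermitian_entries(1)[OF M that]]
        by (intro arg_cong[of _ _ norm] mdet_cong) (simp add: a_m)
      have "integrable N (\<lambda>\<omega>. norm (poly (char_poly (M \<omega>)) (of_real x + \<i>)))"
        by (intro integrable_norm linear_functional_char_poly(1)[OF M avg]) simp_all
      then show ?thesis
        by (rule integrable_cong_space[OF _ eq])
    qed
    have "indep_var borel (C \<circ> ?h) borel (D \<circ> ?m)"
      by (rule indep_var_compose[OF ind' C_meas D_meas])
    from indep_var_integrable[OF this] have CD_int: "integrable N (\<lambda>\<omega>. C (?h \<omega>) * D (?m \<omega>))"
      using C_int D_int by (simp add: o_def)
    have \<Phi>_bound: "norm (\<Phi> (?h \<omega>, ?m \<omega>)) \<le> C (?h \<omega>) * D (?m \<omega>)" if \<omega>: "\<omega> \<in> space N" for \<omega>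
    proof -
      have "(\<Sum>l<n. norm (- ?h \<omega> (l, j))) \<le> s (?h \<omega>)" if "j < n" for j
        unfolding s_def using that by (intro sum_mono) (auto intro!: member_le_sum)
      from norm_mdet_perturbation_le[OF a_herm[OF \<omega>], of "\<lambda>l j. - ?h \<omega> (l, j)", OF this]
      show ?thesis by (simp add: \<Phi>_def D_def C_def mult.commute)
    qed
    have pair_meas: "(\<lambda>\<omega>. (?h \<omega>, ?m \<omega>)) \<in> N \<rightarrow>\<^sub>M ?S \<Otimes>\<^sub>M ?S"
      using H M by (intro measurable_Pair) (auto simp: random_hermitian_def)
    have \<Phi>_int: "integrable N (\<lambda>\<omega>. \<Phi> (?h \<omega>, ?m \<omega>))"
    proof (rule Bochner_Integration.integrable_bound[OF CD_int])
      show "(\<lambda>\<omega>. \<Phi> (?h \<omega>, ?m \<omega>)) \<in> borel_measurable N"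
        by (rule measurable_compose[OF pair_meas \<Phi>_meas])
      show "AE \<omega> in N. norm (\<Phi> (?h \<omega>, ?m \<omega>)) \<le> norm (C (?h \<omega>) * D (?m \<omega>))"
        using order.trans[OF \<Phi>_bound abs_ge_self] by (intro AE_I2) simp
    qed
    have \<Phi>_eigs: "complex_of_real (\<Prod>j<n. x - eigs n (H \<omega> + M \<omega>) j) = \<Phi> (?h \<omega>, ?m \<omega>)" if \<omega>: "\<omega> \<in> space N" for \<omega>
      unfolding prod_eigs[OF sum_entries[OF \<omega>]] poly_char_poly[OF sum_entries(1)[OF \<omega>]] \<Phi>_def
      using random_hermitian_entries(1)[OF H \<omega>] random_hermitian_entries(1)[OF M \<omega>]
      by (intro mdet_cong) (simp add: a_def matrix_entries_def entries_def)
    \<comment> \<open>With M frozen at one sample point, the Gaussian average is linear in its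
      characteristic polynomial, so the outer average only concerns that polynomial.\<close>
    have inner: "(LINT \<omega>'|N. \<Phi> (?h \<omega>', ?m \<omega>)) = poly (hermite_transform (char_poly (M \<omega>))) (of_real x)"
      if \<omega>: "\<omega> \<in> space N" for \<omega>
    proof -
      have "\<Phi> (?h \<omega>', ?m \<omega>) = mdet n (\<lambda>i j. a (?m \<omega>) i j - H \<omega>' $$ (i, j))" for \<omega>'
        unfolding \<Phi>_def by (intro mdet_cong) (simp add: matrix_entries_def)
      then have "(LINT \<omega>'|N. \<Phi> (?h \<omega>', ?m \<omega>)) = wick_det n {..<n} (a (?m \<omega>))"
        using gue_expected_det(2)[OF N gue] by simp
      also have "\<dots> = poly (hermite_transform (mdet n (diag_shift (of_real x) {..<n} (a (?m \<omega>))))) (of_real x)"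
        by (rule wick_det_eq_hermite_transform) simp
      also have "mdet n (diag_shift (of_real x) {..<n} (a (?m \<omega>))) = char_poly (M \<omega>)"
        unfolding char_poly_mdet[OF random_hermitian_entries(1)[OF M \<omega>], of "of_real x"]
        by (intro mdet_cong) (simp add: diag_shift_def a_m)
      finally show ?thesis .
    qed
    have "(LINT \<omega>|N. complex_of_real (\<Prod>j<n. x - eigs n (H \<omega> + M \<omega>) j)) = (LINT \<omega>|N. \<Phi> (?h \<omega>, ?m \<omega>))"
      by (intro Bochner_Integration.integral_cong refl \<Phi>_eigs)
    also have "\<dots> = (LINT \<omega>|N. LINT \<omega>'|N. \<Phi> (?h \<omega>', ?m \<omega>))"
      by (rule integral_independent_pair[OF ind' \<Phi>_meas \<Phi>_int])
    also have "\<dots> = (LINT \<omega>|N. poly (hermite_transform (char_poly (M \<omega>))) (of_real x))"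
      by (intro Bochner_Integration.integral_cong refl inner)
    also have "\<dots> = poly (hermite_transform (map_poly of_real r)) (of_real x)"
      by (rule linear_functional_char_poly(2)[OF M avg])
         (simp_all add: hermite_transform_add hermite_transform_smult)
    also have "\<dots> = of_real (poly (hermite_transform r) x)"
      unfolding map_poly_of_real_hermite_transform[symmetric] cpoly_def[symmetric] by (rule cpoly_of_real)
    finally have "(LINT \<omega>|N. (\<Prod>j<n. x - eigs n (H \<omega> + M \<omega>) j)) = poly (hermite_transform r) x"
      unfolding integral_complex_of_real of_real_eq_iff .
    moreover have "integrable N (\<lambda>\<omega>. complex_of_real (\<Prod>j<n. x - eigs n (H \<omega> + M \<omega>) j))"
      by (rule integrable_cong_space[OF \<Phi>_int \<Phi>_eigs])
    ultimately show ?thesis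
      unfolding complex_of_real_integrable_eq by simp
  qed
  then show ?thesis by (simp add: average_char_poly_def)
qed

theorem theorem2p3:
  fixes N :: "'w measure" and n :: nat
    and H M :: "'w \<Rightarrow> complex mat"
    and f q F Q :: "nat \<Rightarrow> real \<Rightarrow> real" and Z :: real
    and p :: "nat \<Rightarrow> real poly" and p\<^sub>n :: "real poly"
    and K :: "real \<Rightarrow> real \<Rightarrow> complex"
  assumes "prob_space N" and "n \<ge> 1"
    and "gue N n H"
    and "random_hermitian N n M"
    and "independent_matrices N n H M"
    and "eigenvalues_follow N n M f Z"
    and "biorthogonal_system n f p q"
    and "average_char_poly N n M (poly p\<^sub>n)"
    and F: "\<And>k y. F k y = (LINT t|lborel. f k t * exp (- (1/2) * (y - t)\<^sup>2))"
    and Q: "\<And>k y. Q k y = 1 / sqrt (2 * pi) * (LINT t|lborel. q k t * exp (- (1/2) * (y - t)\<^sup>2))"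
    and K: "\<And>x y. K x y = 1 / (2 * of_real pi * \<i>) *
              imag_axis_integral (\<lambda>s. LINT t|lborel. ensemble_kernel n p q s t *
                exp (1/2 * ((of_real x - s)\<^sup>2 - (of_real y - of_real t)\<^sup>2)))"
  shows
    "(\<exists>P :: nat \<Rightarrow> real poly.
        (\<forall>k<n. \<forall>x. of_real (poly (P k) x) = 1 / (of_real (sqrt (2 * pi)) * \<i>) *
             imag_axis_integral (\<lambda>s. cpoly (p k) s * exp (1/2 * (of_real x - s)\<^sup>2))) \<and>
        biorthogonal_system n F P Q) \<and>
     ((\<forall>P' Q'. biorthogonal_system n F P' Q' \<longrightarrow>
          (\<forall>x y. K x y = ensemble_kernel n P' Q' (of_real x) y)) \<and>
      (\<forall>Z'. eigenvalues_follow N n (\<lambda>\<omega>. H \<omega> + M \<omega>) F Z' \<longrightarrow>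
          eigenvalues_determinantal N n (\<lambda>\<omega>. H \<omega> + M \<omega>) K)) \<and>
     (\<exists>P\<^sub>n :: real poly.
        (\<forall>x. of_real (poly P\<^sub>n x) = 1 / (of_real (sqrt (2 * pi)) * \<i>) *
             imag_axis_integral (\<lambda>s. cpoly p\<^sub>n s * exp (1/2 * (of_real x - s)\<^sup>2))) \<and>
        average_char_poly N n (\<lambda>\<omega>. H \<omega> + M \<omega>) (poly P\<^sub>n))"
proof -
  let ?P = "\<lambda>k. hermite_transform (p k)"
  have bi: "biorthogonal_system n F ?P Q"
    by (rule heat_flow_biorthogonal[OF assms(7) F Q])
  have kernel: "K x y = complex_of_real (\<Sum>j<n. poly (?P j) x * Q j y)" for x y
    unfolding K by (rule heat_flow_kernel[OF assms(7) F Q])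
  have unique: "K x y = ensemble_kernel n P' Q' (of_real x) y" if "biorthogonal_system n F P' Q'" for P' Q' x y
    unfolding kernel biorthogonal_kernel_unique[OF bi that]
    by (simp add: ensemble_kernel_def cpoly_of_real)
  have det: "eigenvalues_determinantal N n (\<lambda>\<omega>. H \<omega> + M \<omega>) K"
    if "eigenvalues_follow N n (\<lambda>\<omega>. H \<omega> + M \<omega>) F Z'" for Z'
    by (rule eigenvalues_determinantal_kernel[OF bi assms(1) that kernel])
  have avg: "average_char_poly N n (\<lambda>\<omega>. H \<omega> + M \<omega>) (poly (hermite_transform p\<^sub>n))"
    by (rule average_char_poly_gue_sum[OF assms(1,3,4,5,8)])
  show ?thesis
    by (intro conjI exI[of _ ?P] exI[of _ "hermite_transform p\<^sub>n"] allI impI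
        imag_axis_integral_eq_hermite_transform[symmetric] bi unique det avg)
qed

end
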